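(* Let $H_0 = 3.061\cdot 10^{10}$, and assume the fact that every nontrivial zero $\varrho$ of $\zeta$ with $0< \Im\varrho\le H_0$ satisfies $\Re\varrho=1/2$. Let $0.55\le \sigma\le 1$ and $T\ge H_0$. Let $\sigma_0$ and $H$ satisfy $0.5208<\sigma_0<0.9723$, $\sigma_0<\sigma$, and $10^3\le H<H_0$. Then \[ N(\sigma,T)\le b_1\,(T-H)+b_2\log(TH)+b_3, \] where \[ b_1=\frac{\log\big(\zeta(2\sigma_0)+\mathcal{E}_1(\sigma_0,H)\big)}{4\pi(\sigma-\sigma_0)},\qquad b_2=\frac{\mathcal{E}_3(\sigma_0)}{2\pi(\sigma-\sigma_0)},\qquad b_3=\frac{\mathcal{E}_2+\mathcal{E}_4(\sigma_0,H)}{2\pi(\sigma-\sigma_0)}. \] Equivalently, $N(\sigma,T)\le c_1T+c_2\log T+c_3$ with $c_1=b_1$, $c_2=b_2$, $c_3=-b_1H+b_2\log H+b_3$.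
   Context: $N(\sigma,T)$ denotes the number of zeros $s$ of the Riemann zeta function $\zeta$ (counted with multiplicity) with $\sigma\le\Re s\le 1$ and $0\le \Im s\le T$. Constants: $H_0=3.061\cdot10^{10}$, $c_0=2.1946$, $\eta=0.0001$, $\sigma_1=3/2+2\eta=1.5002$, $\mathcal{E}_2=1.7655$. Define \[ \epsilon_1(\sigma_0,H)=\frac{4H_0}{H_0-H}\Big(\frac{(\log H_0)H_0^{1-2\sigma_0}}{2(1-\sigma_0)}-\frac{(2\sigma_0-1)\log H_0}{2(1-\sigma_0)H_0}+\frac{\max\big(0,\frac{1-3\sigma_0+3\sigma_0^2}{2(1-\sigma_0)^2}-\frac{\zeta(2\sigma_0)}{2}\big)}{H_0}+\frac{(2-\sigma_0)H_0^{1-2\sigma_0}}{2(1-\sigma_0)^2}-\frac{\sigma_0H_0^{-\sigma_0}}{(1-\sigma_0)^2}+\frac{H_0^{-2\sigma_0}}{2(2\sigma_0-1)}+\frac{H_0^{-2\sigma_0-1}}{2}\Big), \] \[ \epsilon_2(\sigma_0,H)=\frac{c_0^2}{2\sigma_0-1}\cdot\frac{H^{-(2\sigma_0-1)}-H_0^{-(2\sigma_0-1)}}{H_0-H},\qquad \epsilon_3(\sigma_0,H)=2\sqrt{\epsilon_2(\sigma_0,H)\big(\zeta(2\sigma_0)+\epsilon_1(\sigma_0,H)\big)}, \] $\mathcal{E}_1=\epsilon_1+\epsilon_2+\epsilon_3$, \[ \mathcal{E}_3(\sigma_0)=\frac{\pi(1+2\eta)(\sigma_1-\sigma_0)}{4\log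 2},\qquad \mathcal{E}_4(\sigma_0,H)=\frac{\pi(\sigma_1-\sigma_0)}{\log 2}\log\Big(3\,\frac{H+3(1+\eta)}{H-(1+2\eta)}\Big(\frac{3(1+\eta)/H+1}{2\pi}\Big)^{\frac{1+2\eta}{2}}\frac{\zeta(1+\eta)^4}{\zeta(2(1+\eta))^2}\Big). \] *)

theory Defs
  imports "HOL-Analysis.Analysis"
begin

text \<open>Riemann zeta on the half plane Re s > 0 (s \<noteq> 1), via the classical formula
  zeta(s) = lim_{N\<rightarrow>\<infinity>} (\<Sum>_{n=1}^N n^{-s} - N^{1-s}/(1-s)),
  valid for Re s > 0, s \<noteq> 1 (analytic continuation of the Dirichlet series).
  Values for Re s \<le> 0 or s = 1 are not meaningful and are never used.\<close>
definition zeta :: "complex \<Rightarrow> complex" where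
  "zeta s = lim (\<lambda>N::nat. (\<Sum>n=1..N. of_nat n powr (-s)) - of_nat N powr (1 - s) / (1 - s))"

definition zero_mult :: "(complex \<Rightarrow> complex) \<Rightarrow> complex \<Rightarrow> nat" where
  "zero_mult f z = (LEAST n. (deriv ^^ n) f z \<noteq> 0)"

definition N_zeros :: "real \<Rightarrow> real \<Rightarrow> nat" where
  "N_zeros \<sigma> T = (\<Sum>\<rho>\<in>{\<rho>. \<rho> \<noteq> 1 \<and> \<sigma> \<le> Re \<rho> \<and> Re \<rho> \<le> 1 \<and> 0 \<le> Im \<rho> \<and> Im \<rho> \<le> T \<and> zeta \<rho> = 0}.
                      zero_mult zeta \<rho>)"

definition zetaR :: "real \<Rightarrow> real" where
  "zetaR x = Re (zeta (complex_of_real x))"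

definition H0 :: real where "H0 = 30610000000"
definition c0 :: real where "c0 = 2.1946"
definition eta :: real where "eta = 0.0001"
definition sigma1 :: real where "sigma1 = 3/2 + 2 * eta"
definition E2 :: real where "E2 = 1.7655"

definition eps1 :: "real \<Rightarrow> real \<Rightarrow> real" where
  "eps1 sg0 H = 4 * H0 / (H0 - H) *
     ( ln H0 * H0 powr (1 - 2* sg0) / (2 * (1 - sg0))
     - (2* sg0 - 1) * ln H0 / (2 * (1 - sg0) * H0)
     + max 0 ((1 - 3* sg0 + 3* sg0^2) / (2 * (1 - sg0)^2) - zetaR (2* sg0) / 2) / H0
     + (2 - sg0) * H0 powr (1 - 2* sg0) / (2 * (1 - sg0)^2)
     - sg0 * H0 powr (-sg0) / (1 - sg0)^2
     + H0 powr (-2* sg0) / (2 * (2* sg0 - 1))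
     + H0 powr (-2* sg0 - 1) / 2)"

definition eps2 :: "real \<Rightarrow> real \<Rightarrow> real" where
  "eps2 sg0 H = c0^2 / (2* sg0 - 1) * (H powr (-(2* sg0 - 1)) - H0 powr (-(2* sg0 - 1))) / (H0 - H)"

definition eps3 :: "real \<Rightarrow> real \<Rightarrow> real" where
  "eps3 sg0 H = 2 * sqrt (eps2 sg0 H * (zetaR (2* sg0) + eps1 sg0 H))"

definition E1 :: "real \<Rightarrow> real \<Rightarrow> real" where
  "E1 sg0 H = eps1 sg0 H + eps2 sg0 H + eps3 sg0 H"

definition E3 :: "real \<Rightarrow> real" where
  "E3 sg0 = pi * (1 + 2*eta) * (sigma1 - sg0) / (4 * ln 2)"

definition E4 :: "real \<Rightarrow> real \<Rightarrow> real" where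
  "E4 sg0 H = pi * (sigma1 - sg0) / ln 2 *
     ln (3 * ((H + 3*(1 + eta)) / (H - (1 + 2*eta)))
          * ((3*(1 + eta)/H + 1) / (2*pi)) powr ((1 + 2*eta)/2)
          * zetaR (1 + eta)^4 / zetaR (2*(1 + eta))^2)"

end

theory Submission
  imports Defs "HOL-Complex_Analysis.Complex_Analysis" "HOL-Computational_Algebra.Primes"
begin

text \<open>
  Littlewood's method, in a form that never needs the argument of \<open>\<zeta>\<close>. Green's identity for \<open>ln \<bar>\<zeta>\<bar>\<close>
  and the weight \<open>Re z - s\<close> on the rectangle with sides \<open>Re z = s\<close>, \<open>Re z = X\<close>, \<open>Im z = H\<close>, \<open>Im z = T\<close>
  counts each zero by its distance to the left side. The right side contributes almost nothing, and the left
  side gives \<open>\<integral> ln \<bar>\<zeta>(s + it)\<bar> dt\<close>, which \<open>ln x \<le> ln a + x/a - 1\<close> bounds by the mean square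
  of \<open>\<zeta>\<close> on \<open>Re z = s\<close>. The mean square is computed from
  \<open>\<zeta>(s + it) = (\<Sum>n\<le>t. n\<^sup>-\<^sup>s\<^sup>-\<^sup>i\<^sup>t) + O(t\<^sup>-\<^sup>s)\<close>, which Euler--Maclaurin summation gives with
  the explicit constant \<open>c\<^sub>0\<close>.

  The horizontal sides contribute \<open>\<integral> (x - s) Im (\<zeta>'/\<zeta>) dx\<close>. Each is bounded by Green's identity on an
  adjacent rectangle of height \<open>2\<close>, with the weight \<open>(x - s) (1 - (t - c)/2)\<close>, which vanishes on the far side
  and is nonnegative at the zeros inside. This leaves integrals of \<open>ln \<bar>\<zeta>\<bar>\<close>, one of them with the wrong sign.
  Adding the identity for the nonnegative weight \<open>sinh (\<pi>(x - s)/2) sin (\<pi>(t - c)/2)\<close> makes all coefficients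
  of \<open>ln \<bar>\<zeta>\<bar>\<close> for \<open>x \<le> 3/2\<close> positive, so that only upper bounds for \<open>\<bar>\<zeta>\<bar>\<close> are needed there.
  The constants \<open>\<E>\<^sub>3\<close> and \<open>\<E>\<^sub>4\<close> leave ample room for this.
\<close>

section \<open>Euler--Maclaurin summation\<close>

text \<open>Green's identity needs sides free of zeros, and nothing is known about zeros on
  \<open>Re z = \<sigma>0\<close> or at height \<open>T\<close>. Both sides are therefore moved
  outwards, to \<open>s < \<sigma>0\<close> and \<open>T' > T\<close>, so that no counted zero is
  lost: by continuity the mean square at \<open>s\<close> exceeds the one at
  \<open>\<sigma>0\<close> by at most \<open>1\<close>, and \<open>T'\<close> is so close to
  \<open>T\<close> that the extra length costs at most \<open>1/2\<close>. The hypothesis on zeros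
  up to \<open>H0\<close> puts all counted zeros above \<open>H0\<close>, and it keeps the bottom
  side and its auxiliary rectangle below free of zeros.

  \<open>E3\<close> can pay for the horizontal sides because \<open>\<pi> / (4 ln 2)\<close> exceeds
  \<open>1.13\<close>, and \<open>E4\<close> because \<open>zetaR (1 + eta)\<close> is at least
  \<open>10^4\<close> and enters to the fourth power: its logarithm times
  \<open>\<pi> / ln 2\<close> is at least \<open>153\<close>.

  \<open>eps1\<close> is evaluated at \<open>H0\<close> although the mean square runs up to
  \<open>T\<close>, so the off-diagonal bound divided by \<open>T\<close> has to be shown to
  decrease beyond \<open>H0\<close>. This is the longest calculation about the mean square.\<close>

lemma has_vector_derivative_of_real_powr:
  assumes "x > 0"
  shows "((\<lambda>u. of_real u powr w :: complex) has_vector_derivative w * of_real x powr (w - 1)) (at x within S)"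
proof -
  have "((\<lambda>z. z powr w) has_field_derivative w * of_real x powr (w - 1)) (at (of_real x :: complex))"
    by (rule has_field_derivative_powr) (use assms in \<open>auto simp: complex_nonpos_Reals_iff\<close>)
  from field_vector_diff_chain_at[where f = of_real, OF has_vector_derivative_of_real[OF DERIV_ident] this]
  have "((\<lambda>u. of_real u powr w :: complex) has_vector_derivative w * of_real x powr (w - 1)) (at x)"
    by (simp add: o_def)
  then show ?thesis by (rule has_vector_derivative_at_within)
qed

text \<open>Bernoulli polynomials up to normalisation: iterated mean-zero antiderivatives of \<open>x - 1/2\<close>.\<close>
primrec bern :: "nat \<Rightarrow> real \<Rightarrow> real" where
  "bern 0 = (\<lambda>x. x - 1/2)"
| "bern (Suc k) = (\<lambda>x. integral {0..x} (bern k) - integral {0..1} (\<lambda>y. integral {0..y} (bern k)))"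

text \<open>Each order gains a factor \<open>1/2\<close>. If \<open>bern k\<close> has mean zero and
  is bounded by \<open>M\<close>, its primitive changes between points at distance \<open>d\<close>
  by at most \<open>M d\<close>, and, going round the complement, by at most
  \<open>M (1 - d)\<close>, hence by at most \<open>M/2\<close>. A mean-zero primitive is the
  average of its own differences, so it obeys the same bound.\<close>

lemma
  shows bern_cont: "continuous_on {0..1} (bern k)"
    and bern_bound: "x \<in> {0..1} \<Longrightarrow> \<bar>bern k x\<bar> \<le> (1/2) ^ (k + 1)"
    and bern_deriv: "x \<in> {0..1} \<Longrightarrow> (bern (Suc k) has_real_derivative bern k x) (at x within {0..1})"
    and bern_ends: "bern (Suc k) 0 = bern (Suc k) 1"
proof -
  have D: "(bern (Suc k) has_real_derivative bern k x) (at x within {0..1})"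
    if "continuous_on {0..1} (bern k)" "x \<in> {0..1}" for x k
    using integral_has_real_derivative[OF that]
    by (auto intro!: derivative_eq_intros)
  have main: "continuous_on {0..1} (bern k) \<and> (bern k has_integral 0) {0..1} \<and>
     (\<forall>x\<in>{0..1}. \<bar>bern k x\<bar> \<le> (1/2) ^ (k + 1))" for k
  proof (induction k)
    case 0
    have "((\<lambda>x::real. x - 1/2) has_integral ((1^2/2 - 1/2) - (0^2/2 - 0/2))) {0..1}"
      by (rule fundamental_theorem_of_calculus)
         (auto intro!: derivative_eq_intros simp: has_real_derivative_iff_has_vector_derivative[symmetric])
    moreover have "\<bar>x - 1/2\<bar> \<le> 1/2" if "x \<in> {0..1}" for x :: real
      using that by (auto simp: abs_if)
    ultimately show ?case by (auto intro!: continuous_intros)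
  next
    case (Suc k)
    then have c: "continuous_on {0..1} (bern k)" and i: "(bern k has_integral 0) {0..1}"
      and b: "\<And>x. x \<in> {0..1} \<Longrightarrow> \<bar>bern k x\<bar> \<le> (1/2)^(k+1)" by auto
    have c': "continuous_on {0..1} (bern (Suc k))"
      using D[OF c] by (meson DERIV_continuous_on)
    have ci: "continuous_on {0..1} (\<lambda>y. integral {0..y} (bern k))"
      using integral_has_real_derivative[OF c] by (meson DERIV_continuous_on)
    have int0: "(bern (Suc k) has_integral 0) {0..1}"
    proof -
      have "((\<lambda>x. integral {0..x} (bern k) - integral {0..1} (\<lambda>y. integral {0..y} (bern k))) has_integral
        integral {0..1} (\<lambda>y. integral {0..y} (bern k)) - integral {0..1} (\<lambda>y. integral {0..y} (bern k))) {0..1}"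
        by (intro has_integral_diff integrable_integral integrable_continuous_real ci)
           (use has_integral_const_real[of "integral {0..1} (\<lambda>y. integral {0..y} (bern k))" 0 1] in simp)
      then show ?thesis by simp
    qed
    define M :: real where "M = (1/2)^(k+1)"
    note b = b[folded M_def]
    have io: "bern k integrable_on {a..b}" if "0 \<le> a" "b \<le> 1" for a b
      using c by (rule integrable_on_subinterval[OF integrable_continuous_real]) (use that in auto)
    have ib: "\<bar>integral {a..b} (bern k)\<bar> \<le> M * (b - a)" if "0 \<le> a" "a \<le> b" "b \<le> 1" for a b
    proof -
      have "norm (integral {a..b} (bern k)) \<le> M * (b - a)"
        by (rule integral_bound) (use that b in \<open>auto intro: continuous_on_subset[OF c]\<close>)
      then show ?thesis by simp
    qed
    have diff: "\<bar>bern (Suc k) y - bern (Suc k) x\<bar> \<le> M / 2" if "0 \<le> x" "x \<le> y" "y \<le> 1" for x y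
    proof -
      have e1: "integral {0..x} (bern k) + integral {x..y} (bern k) = integral {0..y} (bern k)"
        by (rule Henstock_Kurzweil_Integration.integral_combine) (use that io in auto)
      have e2: "integral {0..y} (bern k) + integral {y..1} (bern k) = integral {0..1} (bern k)"
        by (rule Henstock_Kurzweil_Integration.integral_combine) (use that io in auto)
      have e3: "integral {0..1} (bern k) = 0" using i by (rule integral_unique)
      have eq: "bern (Suc k) y - bern (Suc k) x = integral {x..y} (bern k)" using e1 by simp
      have b1: "\<bar>integral {x..y} (bern k)\<bar> \<le> M * (y - x)" using ib that by simp
      have "\<bar>integral {x..y} (bern k)\<bar> \<le> \<bar>integral {0..x} (bern k)\<bar> + \<bar>integral {y..1} (bern k)\<bar>"
        using e1 e2 e3 by linarith
      also have "\<dots> \<le> M * (x - 0) + M * (1 - y)" using ib[of 0 x] ib[of y 1] that by linarith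
      finally have b2: "\<bar>integral {x..y} (bern k)\<bar> \<le> M * (1 - (y - x))" by (simp add: algebra_simps)
      have "2 * \<bar>integral {x..y} (bern k)\<bar> \<le> M * (y - x) + M * (1 - (y - x))" using b1 b2 by linarith
      also have "\<dots> = M" by (simp add: algebra_simps)
      finally show ?thesis unfolding eq by simp
    qed
    have "\<bar>bern (Suc k) x\<bar> \<le> (1/2)^(Suc k + 1)" if x: "x \<in> {0..1}" for x
    proof -
      have "((\<lambda>y. bern (Suc k) x - bern (Suc k) y) has_integral bern (Suc k) x - 0) {0..1}"
        by (intro has_integral_diff int0) (use has_integral_const_real[of "bern (Suc k) x" 0 1] in simp)
      then have "bern (Suc k) x = integral {0..1} (\<lambda>y. bern (Suc k) x - bern (Suc k) y)"
        by (simp add: integral_unique)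
      also have "norm \<dots> \<le> M/2 * (1 - 0)"
      proof (rule integral_bound)
        show "norm (bern (Suc k) x - bern (Suc k) y) \<le> M / 2" if "y \<in> {0..1}" for y
          using diff[of x y] diff[of y x] x that by (cases "x \<le> y") (auto simp del: bern.simps simp: abs_minus_commute)
      qed (auto intro!: continuous_on_diff c' simp del: bern.simps)
      finally show ?thesis by (simp add: M_def)
    qed
    with c' int0 show ?case by blast
  qed
  show "continuous_on {0..1} (bern k)"
    "x \<in> {0..1} \<Longrightarrow> \<bar>bern k x\<bar> \<le> (1/2) ^ (k + 1)" using main[of k] by auto
  show "x \<in> {0..1} \<Longrightarrow> (bern (Suc k) has_real_derivative bern k x) (at x within {0..1})"
    using D main by blast
  show "bern (Suc k) 0 = bern (Suc k) 1" using main[of k] by (simp add: integral_unique)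
qed

section \<open>Partial sums of zeta and their Euler--Maclaurin remainders\<close>

lemma powr_at_top_0:
  assumes "a < 0"
  shows "(\<lambda>n::nat. real n powr a) \<longlonglongrightarrow> 0"
  using tendsto_neg_powr[OF assms filterlim_real_sequentially] .

lemma norm_of_nat_powr: "n > 0 \<Longrightarrow> norm (of_nat n powr w :: complex) = real n powr Re w"
  using norm_powr_real_powr[of "of_nat n" w] by simp

definition partial_zeta :: "complex \<Rightarrow> nat \<Rightarrow> complex" where
  "partial_zeta s N = (\<Sum>n=1..N. of_nat n powr (-s)) - of_nat N powr (1 - s) / (1 - s)"

lemma zeta_eq_lim: "zeta s = lim (partial_zeta s)"
  unfolding zeta_def partial_zeta_def ..

text \<open>The \<open>k\<close>-th derivative of \<open>u\<^sup>-\<^sup>s\<close>.\<close>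
definition powr_deriv :: "complex \<Rightarrow> nat \<Rightarrow> real \<Rightarrow> complex" where
  "powr_deriv s k u = (-1)^k * pochhammer s k * of_real u powr (- s - of_nat k)"

lemma powr_deriv_0: "powr_deriv s 0 u = of_real u powr (- s)"
  by (simp add: powr_deriv_def)

lemma has_vector_derivative_powr_deriv:
  assumes "u > 0"
  shows "(powr_deriv s k has_vector_derivative powr_deriv s (Suc k) u) (at u within S)"
proof -
  have "((\<lambda>u. (-1)^k * pochhammer s k * of_real u powr (- s - of_nat k)) has_vector_derivative
     (-1)^k * pochhammer s k * ((- s - of_nat k) * of_real u powr (- s - of_nat k - 1))) (at u within S)"
    using has_vector_derivative_of_real_powr[OF assms] has_vector_derivative_mult_right by blast
  moreover have "(-1)^k * pochhammer s k * ((- s - of_nat k) * of_real u powr (- s - of_nat k - 1))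
      = powr_deriv s (Suc k) u"
    by (simp add: powr_deriv_def pochhammer_Suc algebra_simps)
  ultimately show ?thesis unfolding powr_deriv_def[abs_def] by simp
qed

lemma continuous_on_powr_deriv:
  "S \<subseteq> {0<..} \<Longrightarrow> continuous_on S (powr_deriv s k)"
  unfolding continuous_on_eq_continuous_within
  by (blast intro: has_vector_derivative_continuous has_vector_derivative_powr_deriv)

lemma norm_powr_deriv:
  "u > 0 \<Longrightarrow> norm (powr_deriv s k u) = norm (pochhammer s k) * u powr (- Re s - real k)"
  using norm_powr_real_powr[of "of_real u" "- s - of_nat k"]
  by (simp add: powr_deriv_def norm_mult norm_power)

lemma has_real_derivative_shift:
  fixes g :: "real \<Rightarrow> real"
  assumes "x \<in> {c..c+1}" "\<And>y. y \<in> {0..1} \<Longrightarrow> (g has_real_derivative g' y) (at y within {0..1})"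
  shows "((\<lambda>u. g (u - c)) has_real_derivative g' (x - c)) (at x within {c..c+1})"
proof -
  have im: "(\<lambda>u. u - c) ` {c..c+1} = {0..1}" by (auto simp: image_iff intro!: bexI[of _ "_ + c"])
  have "(g \<circ> (\<lambda>u. u - c) has_real_derivative g' (x - c) * 1) (at x within {c..c+1})"
    by (rule DERIV_image_chain) (use assms im in \<open>auto intro!: derivative_eq_intros\<close>)
  then show ?thesis by (simp add: o_def)
qed

text \<open>Stated for an arbitrary primitive \<open>Q\<close>, so that it serves both the
  trapezoidal rule (\<open>q = 1\<close>, \<open>Q = bern 0\<close>) and every later passage from
  \<open>bern k\<close> to \<open>bern (Suc k)\<close>.\<close>

lemma bern_by_parts:
  fixes c :: real
  assumes "c > 0"
    and Q: "\<And>y. y \<in> {0..1} \<Longrightarrow> (Q has_real_derivative q y) (at y within {0..1})"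
    and q: "continuous_on {0..1} q"
  shows "integral {c..c+1} (\<lambda>u. q (u - c) *\<^sub>R powr_deriv s k u) =
     Q 1 *\<^sub>R powr_deriv s k (c + 1) - Q 0 *\<^sub>R powr_deriv s k c -
     integral {c..c+1} (\<lambda>u. Q (u - c) *\<^sub>R powr_deriv s (Suc k) u)"
proof -
  have sub: "{c..c+1} \<subseteq> {0<..}" using assms by auto
  have Qc: "continuous_on {0..1} Q" using Q by (meson DERIV_continuous_on)
  have im: "(\<lambda>u. u - c) ` {c..c+1} \<subseteq> {0..1}" by auto
  have Qc': "continuous_on {c..c+1} (\<lambda>u. Q (u - c))"
    by (rule continuous_on_compose2[OF Qc _ im]) (auto intro!: continuous_intros)
  have qc': "continuous_on {c..c+1} (\<lambda>u. q (u - c))"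
    by (rule continuous_on_compose2[OF q _ im]) (auto intro!: continuous_intros)
  have i1: "(\<lambda>u. Q (u - c) *\<^sub>R powr_deriv s (Suc k) u) integrable_on {c..c+1}"
    by (intro integrable_continuous_real continuous_on_scaleR Qc' continuous_on_powr_deriv sub)
  have i2: "(\<lambda>u. q (u - c) *\<^sub>R powr_deriv s k u) integrable_on {c..c+1}"
    by (intro integrable_continuous_real continuous_on_scaleR qc' continuous_on_powr_deriv sub)
  have "((\<lambda>u. Q (u - c) *\<^sub>R powr_deriv s (Suc k) u + q (u - c) *\<^sub>R powr_deriv s k u) has_integral
     (Q (c + 1 - c) *\<^sub>R powr_deriv s k (c + 1) - Q (c - c) *\<^sub>R powr_deriv s k c)) {c..c+1}"
  proof (rule fundamental_theorem_of_calculus)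
    fix x assume x: "x \<in> {c..c+1}"
    show "((\<lambda>u. Q (u - c) *\<^sub>R powr_deriv s k u) has_vector_derivative
       Q (x - c) *\<^sub>R powr_deriv s (Suc k) x + q (x - c) *\<^sub>R powr_deriv s k x) (at x within {c..c+1})"
      by (rule has_vector_derivative_scaleR)
        (use x sub in \<open>auto intro!: has_real_derivative_shift Q has_vector_derivative_powr_deriv\<close>)
  qed simp
  from integral_unique[OF this, unfolded Henstock_Kurzweil_Integration.integral_add[OF i1 i2]] show ?thesis
    by (simp add: algebra_simps)
qed

text \<open>The Euler--Maclaurin remainder of order \<open>k\<close>. Keeping it as a sum over unit
  intervals avoids a periodic extension of \<open>bern k\<close>, which for \<open>k = 0\<close>
  would jump at the integers.\<close>

definition em_int :: "complex \<Rightarrow> nat \<Rightarrow> nat \<Rightarrow> nat \<Rightarrow> complex" where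
  "em_int s k N M = (\<Sum>n=N..<M. integral {real n..real n + 1}
     (\<lambda>u. bern k (u - real n) *\<^sub>R powr_deriv s (Suc k) u))"

text \<open>The trapezoidal rule on each unit interval. The integral of \<open>u\<close> to the
  power \<open>- s\<close> is exactly the increment of the correction term in
  \<open>partial_zeta\<close>, so only end terms and the remainder survive.\<close>

lemma partial_zeta_diff:
  assumes "1 \<le> N" "N \<le> M" "s \<noteq> 1"
  shows "partial_zeta s M - partial_zeta s N =
    (powr_deriv s 0 (real M) - powr_deriv s 0 (real N)) / 2 + em_int s 0 N M"
  using assms(2)
proof (induction M rule: dec_induct)
  case base
  show ?case by (simp add: em_int_def)
next
  case (step m)
  have m: "real m > 0" using step assms by simp
  have "((\<lambda>u. powr_deriv s 0 u) has_integral
     (of_real (real m + 1) powr (1 - s) / (1 - s) - of_real (real m) powr (1 - s) / (1 - s))) {real m..real m + 1}"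
  proof (rule fundamental_theorem_of_calculus)
    fix x assume "x \<in> {real m..real m + 1}"
    then have "((\<lambda>u. of_real u powr (1 - s) :: complex) has_vector_derivative
       (1 - s) * of_real x powr (1 - s - 1)) (at x within {real m..real m + 1})"
      by (intro has_vector_derivative_of_real_powr) (use m in auto)
    from has_vector_derivative_mult_right[OF this, of "1 / (1 - s)"]
    show "((\<lambda>u. of_real u powr (1 - s) / (1 - s)) has_vector_derivative powr_deriv s 0 x)
            (at x within {real m..real m + 1})"
      using assms by (simp add: powr_deriv_0)
  qed simp
  note FT = integral_unique[OF this]
  define I where "I = integral {real m..real m+1} (\<lambda>u. bern 0 (u - real m) *\<^sub>R powr_deriv s (Suc 0) u)"
  have "integral {real m..real m + 1} (\<lambda>u. 1 *\<^sub>R powr_deriv s 0 u) =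
     bern 0 1 *\<^sub>R powr_deriv s 0 (real m + 1) - bern 0 0 *\<^sub>R powr_deriv s 0 (real m) - I"
    unfolding I_def by (rule bern_by_parts) (use m in \<open>auto intro!: derivative_eq_intros\<close>)
  with FT have *: "of_real (real m + 1) powr (1 - s) / (1 - s) - of_real (real m) powr (1 - s) / (1 - s) =
     (powr_deriv s 0 (real m + 1) + powr_deriv s 0 (real m)) / 2 -
     I"
    by (simp add: scaleR_conv_of_real add_divide_distrib)
  have "partial_zeta s (Suc m) - partial_zeta s N = (partial_zeta s m - partial_zeta s N) +
    of_nat (Suc m) powr (-s) - (of_real (real m + 1) powr (1 - s) / (1 - s) - of_real (real m) powr (1 - s) / (1 - s))"
    by (simp add: partial_zeta_def add.commute)
  also have "\<dots> = (powr_deriv s 0 (real m) - powr_deriv s 0 (real N)) / 2 + em_int s 0 N m +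
    powr_deriv s 0 (real m + 1) - ((powr_deriv s 0 (real m + 1) + powr_deriv s 0 (real m)) / 2 - I)"
    unfolding step.IH * by (simp add: powr_deriv_0 add.commute)
  also have "\<dots> = (powr_deriv s 0 (real (Suc m)) - powr_deriv s 0 (real N)) / 2 + em_int s 0 N (Suc m)"
    using step(1) by (simp add: em_int_def I_def[symmetric] add_divide_distrib diff_divide_distrib add.commute del: bern.simps)
      (simp add: I_def add.commute)
  finally show ?case .
qed

text \<open>Since \<open>bern (Suc k)\<close> takes the same value at both ends, the boundary terms
  of neighbouring intervals telescope.\<close>

lemma em_int_step:
  assumes "1 \<le> N" "N \<le> M"
  shows "em_int s k N M = bern (Suc k) 0 *\<^sub>R (powr_deriv s (Suc k) (real M) - powr_deriv s (Suc k) (real N))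
     - em_int s (Suc k) N M"
proof -
  have "em_int s k N M = (\<Sum>n=N..<M. bern (Suc k) 0 *\<^sub>R (powr_deriv s (Suc k) (real (Suc n)) - powr_deriv s (Suc k) (real n))
      - integral {real n..real n + 1} (\<lambda>u. bern (Suc k) (u - real n) *\<^sub>R powr_deriv s (Suc (Suc k)) u))"
    unfolding em_int_def
  proof (intro sum.cong refl)
    fix n assume "n \<in> {N..<M}"
    then have "real n > 0" using assms by auto
    from bern_by_parts[OF this bern_deriv[of _ k] bern_cont[of k], of s "Suc k"]
    show "integral {real n..real n + 1} (\<lambda>u. bern k (u - real n) *\<^sub>R powr_deriv s (Suc k) u) =
      bern (Suc k) 0 *\<^sub>R (powr_deriv s (Suc k) (real (Suc n)) - powr_deriv s (Suc k) (real n)) -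
      integral {real n..real n + 1} (\<lambda>u. bern (Suc k) (u - real n) *\<^sub>R powr_deriv s (Suc (Suc k)) u)"
      using bern_ends[of k] by (simp add: add.commute scaleR_diff_right del: bern.simps)
  qed
  also have "\<dots> = (\<Sum>n=N..<M. bern (Suc k) 0 *\<^sub>R (powr_deriv s (Suc k) (real (Suc n)) - powr_deriv s (Suc k) (real n)))
      - em_int s (Suc k) N M"
    by (simp add: sum_subtractf em_int_def del: bern.simps of_nat_Suc)
  also have "(\<Sum>n=N..<M. bern (Suc k) 0 *\<^sub>R (powr_deriv s (Suc k) (real (Suc n)) - powr_deriv s (Suc k) (real n)))
     = bern (Suc k) 0 *\<^sub>R (powr_deriv s (Suc k) (real M) - powr_deriv s (Suc k) (real N))"
    unfolding scaleR_right.sum[symmetric] using assms(2)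
    by (subst sum_Suc_diff'[of N M "\<lambda>n. powr_deriv s (Suc k) (real n)"]) auto
  finally show ?thesis .
qed

lemma norm_em_int_le:
  assumes "1 \<le> N" "N \<le> M" "Re s + real k > 0"
  shows "norm (em_int s k N M) \<le> (1/2)^(k+1) * norm (pochhammer s (Suc k)) * (real N powr (- Re s - real k) / (Re s + real k))"
proof -
  define C where "C = (1/2)^(k+1) * norm (pochhammer s (Suc k))"
  define F where "F = (\<lambda>u::real. - (u powr (- Re s - real k) / (Re s + real k)))"
  have C: "C \<ge> 0" by (simp add: C_def)
  have *: "norm (integral {real n..real n + 1} (\<lambda>u. bern k (u - real n) *\<^sub>R powr_deriv s (Suc k) u))
       \<le> C * (F (real (Suc n)) - F (real n))" if "n \<ge> N" for n
  proof -
    have n: "real n > 0" using that assms by simp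
    have "((\<lambda>u. C * u powr (- Re s - real (Suc k))) has_integral (C * F (real n + 1) - C * F (real n))) {real n..real n + 1}"
    proof (rule fundamental_theorem_of_calculus)
      fix x assume "x \<in> {real n..real n + 1}"
      then have "x > 0" using n by auto
      define r where "r = - Re s - real k"
      have r: "r \<noteq> 0" "F = (\<lambda>u. u powr r / r)" using assms(3) by (auto simp: r_def F_def fun_eq_iff field_simps)
      have "((\<lambda>u. C * F u) has_real_derivative C * (r * x powr (r - 1) / r)) (at x)"
        unfolding r(2) using \<open>x > 0\<close> by (auto intro!: derivative_eq_intros)
      then have "((\<lambda>u. C * F u) has_real_derivative C * x powr (- Re s - real k - 1)) (at x)"
        using r(1) by (simp add: r_def)
      then show "((\<lambda>u. C * F u) has_vector_derivative C * x powr (- Re s - real (Suc k))) (at x within {real n..real n + 1})"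
        by (simp add: has_real_derivative_iff_has_vector_derivative algebra_simps has_vector_derivative_at_within)
    qed simp
    note I = this
    have im: "(\<lambda>u. u - real n) ` {real n..real n+1} \<subseteq> {0..1}" by auto
    have "norm (integral {real n..real n + 1} (\<lambda>u. bern k (u - real n) *\<^sub>R powr_deriv s (Suc k) u))
       \<le> integral {real n..real n + 1} (\<lambda>u. C * u powr (- Re s - real (Suc k)))"
    proof (rule integral_norm_bound_integral)
      show "(\<lambda>u. bern k (u - real n) *\<^sub>R powr_deriv s (Suc k) u) integrable_on {real n..real n + 1}"
        by (intro integrable_continuous_real continuous_on_scaleR continuous_on_powr_deriv
            continuous_on_compose2[OF bern_cont _ im]) (use n in \<open>auto intro!: continuous_intros\<close>)
      show "(\<lambda>u. C * u powr (- Re s - real (Suc k))) integrable_on {real n..real n + 1}"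
        using I by blast
      fix x assume x: "x \<in> {real n..real n + 1}"
      then have "\<bar>bern k (x - real n)\<bar> \<le> (1/2)^(k+1)" by (intro bern_bound) auto
      moreover have "norm (powr_deriv s (Suc k) x) = norm (pochhammer s (Suc k)) * x powr (- Re s - real (Suc k))"
        by (rule norm_powr_deriv) (use x n in auto)
      ultimately have "norm (bern k (x - real n) *\<^sub>R powr_deriv s (Suc k) x) \<le>
          (1/2)^(k+1) * (norm (pochhammer s (Suc k)) * x powr (- Re s - real (Suc k)))"
        unfolding norm_scaleR by (intro mult_mono) auto
      then show "norm (bern k (x - real n) *\<^sub>R powr_deriv s (Suc k) x) \<le> C * x powr (- Re s - real (Suc k))"
        unfolding C_def by (simp only: mult.assoc)
    qed
    also have "\<dots> = C * (F (real (Suc n)) - F (real n))"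
      using integral_unique[OF I] by (simp add: algebra_simps)
    finally show ?thesis .
  qed
  have "norm (em_int s k N M) \<le> (\<Sum>n=N..<M. C * (F (real (Suc n)) - F (real n)))"
    unfolding em_int_def by (rule sum_norm_le) (use * in auto)
  also have "\<dots> = C * (F (real M) - F (real N))"
    unfolding sum_distrib_left[symmetric] using assms(2)
    by (subst sum_Suc_diff'[of N M "\<lambda>n. F (real n)"]) auto
  also have "\<dots> \<le> C * (- F (real N))"
    by (intro mult_left_mono C) (use assms(3) in \<open>auto simp: F_def\<close>)
  finally show ?thesis by (simp add: C_def F_def)
qed

text \<open>The bound from an expansion to order \<open>K\<close>. The contribution of the upper
  limit is left as a parameter \<open>v\<close>, so that one expression covers a finite upper limit
  and, with \<open>v = 0\<close>, its limit at infinity.\<close>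

definition em_error :: "complex \<Rightarrow> nat \<Rightarrow> nat \<Rightarrow> (nat \<Rightarrow> real) \<Rightarrow> real" where
  "em_error s K N v = (v 0 + real N powr (- Re s)) / 2 +
    (\<Sum>k<K. (1/2)^(k+2) * norm (pochhammer s (Suc k)) * (v (Suc k) + real N powr (- Re s - real (Suc k)))) +
    (1/2)^(K+1) * norm (pochhammer s (Suc K)) * (real N powr (- Re s - real K) / (Re s + real K))"

lemma partial_zeta_diff_bound:
  assumes "1 \<le> N" "N \<le> M" "s \<noteq> 1" "Re s > 0"
  shows "norm (partial_zeta s M - partial_zeta s N) \<le> em_error s K N (\<lambda>k. real M powr (- Re s - real k))"
proof -
  have ex: "norm (em_int s 0 N M) \<le>
    (\<Sum>k<K. (1/2)^(k+2) * norm (pochhammer s (Suc k)) * (real M powr (- Re s - real (Suc k)) + real N powr (- Re s - real (Suc k)))) +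
    norm (em_int s K N M)" for K
  proof (induction K)
    case (Suc K)
    have MN: "real M > 0" "real N > 0" using assms by auto
    have "norm (em_int s K N M) \<le> \<bar>bern (Suc K) 0\<bar> * norm (powr_deriv s (Suc K) (real M) - powr_deriv s (Suc K) (real N))
       + norm (em_int s (Suc K) N M)"
      unfolding em_int_step[OF assms(1,2), of s K] by (rule order_trans[OF norm_triangle_ineq4]) simp
    also have "\<bar>bern (Suc K) 0\<bar> * norm (powr_deriv s (Suc K) (real M) - powr_deriv s (Suc K) (real N)) \<le>
      (1/2)^(Suc K+1) * (norm (powr_deriv s (Suc K) (real M)) + norm (powr_deriv s (Suc K) (real N)))"
      by (intro mult_mono bern_bound norm_triangle_ineq4) auto
    finally show ?case using Suc MN by (simp add: norm_powr_deriv algebra_simps)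
  qed simp
  have "norm (partial_zeta s M - partial_zeta s N) \<le>
     norm ((powr_deriv s 0 (real M) - powr_deriv s 0 (real N)) / 2) + norm (em_int s 0 N M)"
    unfolding partial_zeta_diff[OF assms(1-3)] by (rule norm_triangle_ineq)
  also have "norm ((powr_deriv s 0 (real M) - powr_deriv s 0 (real N)) / 2) \<le>
     (norm (powr_deriv s 0 (real M)) + norm (powr_deriv s 0 (real N))) / 2"
    by (simp add: norm_divide norm_triangle_ineq4)
  also have "\<dots> = (real M powr (- Re s) + real N powr (- Re s)) / 2"
    using assms by (simp add: norm_powr_deriv)
  finally show ?thesis
    using ex[of K] norm_em_int_le[OF assms(1,2), of s K] assms(4) unfolding em_error_def of_nat_0 diff_0_right by linarith
qed

section \<open>Analytic continuation to the right half-plane\<close>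

text \<open>The expansion of order zero. It depends on \<open>s\<close> only through
  \<open>Re s\<close> and \<open>norm s\<close>, which gives convergence and its local
  uniformity.\<close>

lemma partial_zeta_tail_bound:
  assumes "1 \<le> N" "N \<le> M" "s \<noteq> 1" "Re s > 0"
  shows "norm (partial_zeta s M - partial_zeta s N) \<le> real N powr (- Re s) * (1 + norm s / Re s)"
proof -
  have "real M powr (- Re s) \<le> real N powr (- Re s)"
    by (rule powr_mono2') (use assms in auto)
  then have "(real M powr (- Re s) + real N powr (- Re s)) / 2 \<le> real N powr (- Re s)" by simp
  moreover have "(1/2) * norm s * (real N powr (- Re s) / Re s) \<le> real N powr (- Re s) * (norm s / Re s)"
    using assms by (simp add: field_simps)
  moreover have "norm (partial_zeta s M - partial_zeta s N) \<le>
     (real M powr (- Re s) + real N powr (- Re s)) / 2 + (1/2) * norm s * (real N powr (- Re s) / Re s)"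
    using partial_zeta_diff_bound[OF assms, of 0] by (simp add: em_error_def)
  ultimately show ?thesis unfolding distrib_left by linarith
qed

lemma partial_zeta_tendsto:
  assumes "s \<noteq> 1" "Re s > 0"
  shows "partial_zeta s \<longlonglongrightarrow> zeta s"
proof -
  define C where "C = 1 + norm s / Re s"
  have "(\<lambda>N. real N powr (- Re s) * C) \<longlonglongrightarrow> 0"
    using tendsto_mult_right[OF powr_at_top_0[of "- Re s"], of C] assms by simp
  have "Cauchy (partial_zeta s)"
  proof (rule CauchyI')
    fix e :: real assume "e > 0"
    then have "eventually (\<lambda>N. real N powr (- Re s) * C < e) sequentially"
      using \<open>(\<lambda>N. real N powr (- Re s) * C) \<longlonglongrightarrow> 0\<close> order_tendstoD(2) by blast
    then obtain N0 where N0: "\<And>N. N \<ge> N0 \<Longrightarrow> real N powr (- Re s) * C < e"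
      by (auto simp: eventually_sequentially)
    show "\<exists>M. \<forall>m\<ge>M. \<forall>n>m. dist (partial_zeta s m) (partial_zeta s n) < e"
    proof (intro exI[of _ "max 1 N0"] allI impI)
      fix m n assume "max 1 N0 \<le> m" "m < n"
      then have "norm (partial_zeta s n - partial_zeta s m) \<le> real m powr (- Re s) * C"
        unfolding C_def by (intro partial_zeta_tail_bound) (use assms in auto)
      with N0[of m] \<open>max 1 N0 \<le> m\<close> show "dist (partial_zeta s m) (partial_zeta s n) < e"
        by (simp add: dist_norm norm_minus_commute)
    qed
  qed
  then show ?thesis unfolding zeta_eq_lim by (simp add: Cauchy_convergent_iff convergent_LIMSEQ_iff)
qed

lemma zeta_minus_partial_bound:
  assumes "1 \<le> N" "s \<noteq> 1" "Re s > 0"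
  shows "norm (zeta s - partial_zeta s N) \<le> em_error s K N (\<lambda>_. 0)"
proof (rule LIMSEQ_le)
  show "(\<lambda>M. norm (partial_zeta s M - partial_zeta s N)) \<longlonglongrightarrow> norm (zeta s - partial_zeta s N)"
    by (intro tendsto_intros partial_zeta_tendsto assms)
  have *: "(\<lambda>M. real M powr (- Re s - real k)) \<longlonglongrightarrow> 0" for k
    by (rule powr_at_top_0) (use assms in auto)
  show "(\<lambda>M. em_error s K N (\<lambda>k. real M powr (- Re s - real k))) \<longlonglongrightarrow> em_error s K N (\<lambda>_. 0)"
    unfolding em_error_def by (intro tendsto_intros *) auto
  show "\<exists>N0. \<forall>M\<ge>N0. norm (partial_zeta s M - partial_zeta s N) \<le> em_error s K N (\<lambda>k. real M powr (- Re s - real k))"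
    using partial_zeta_diff_bound[OF assms(1) _ assms(2,3)] by blast
qed

lemma partial_zeta_holomorphic: "(\<lambda>s. partial_zeta s (Suc N)) holomorphic_on {s. Re s > 0} - {1}"
  unfolding partial_zeta_def by (auto intro!: holomorphic_intros)

lemma open_zeta_domain: "open ({s. Re s > 0} - {1})"
  by (intro open_Diff open_halfspace_Re_gt) auto

lemma connected_zeta_domain: "connected ({s. Re s > 0} - {1})"
  by (intro connected_open_delete open_halfspace_Re_gt convex_connected convex_halfspace_Re_gt) auto

lemma zeta_holomorphic: "zeta holomorphic_on {s. Re s > 0} - {1}"
proof (rule holomorphic_uniform_sequence[OF open_zeta_domain])
  show "(\<lambda>s. partial_zeta s (Suc n)) holomorphic_on {s. Re s > 0} - {1}" for n
    by (rule partial_zeta_holomorphic)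
  fix x assume x: "x \<in> {s. Re s > 0} - {1}"
  obtain d0 where d0: "d0 > 0" "cball x d0 \<subseteq> {s. Re s > 0} - {1}"
    using open_contains_cball open_zeta_domain x by blast
  \<comment> \<open>On this ball \<open>Re s\<close> stays above \<open>Re x / 2\<close>, which
    makes the tail bound uniform.\<close>
  define d where "d = min d0 (Re x / 2)"
  have d: "d > 0" "cball x d \<subseteq> {s. Re s > 0} - {1}" using d0 x by (auto simp: d_def)
  define r where "r = Re x / 2"
  have r: "r > 0" using x by (simp add: r_def)
  define C where "C = 1 + (norm x + d) / r"
  have "uniform_limit (cball x d) (\<lambda>n s. partial_zeta s (Suc n)) zeta sequentially"
  proof (rule uniform_limitI)
    fix e :: real assume "e > 0"
    have "(\<lambda>N. real (Suc N) powr (- r) * C) \<longlonglongrightarrow> 0"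
      using tendsto_mult_right[OF LIMSEQ_Suc[OF powr_at_top_0[of "- r"]], of C] r by simp
    then have "eventually (\<lambda>N. real (Suc N) powr (- r) * C < e) sequentially"
      using order_tendstoD(2) \<open>e > 0\<close> by blast
    then show "\<forall>\<^sub>F n in sequentially. \<forall>s\<in>cball x d. dist (partial_zeta s (Suc n)) (zeta s) < e"
    proof eventually_elim
      case (elim n)
      show ?case
      proof
        fix s assume s: "s \<in> cball x d"
        then have s1: "Re s > 0" "s \<noteq> 1" using d by auto
        have ds: "norm (x - s) \<le> d" using s by (simp add: dist_norm)
        have "\<bar>Re (x - s)\<bar> \<le> d" using abs_Re_le_cmod[of "x - s"] ds by linarith
        moreover have "d \<le> Re x / 2" by (simp add: d_def)
        ultimately have rs: "Re s \<ge> r" unfolding r_def minus_complex.simps by linarith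
        have ns: "norm s \<le> norm x + d" using ds norm_triangle_ineq4[of x "x - s"] by simp
        have "norm (zeta s - partial_zeta s (Suc n)) \<le> real (Suc n) powr (- Re s) * (1 + norm s / Re s)"
        proof (rule LIMSEQ_le_const2)
          show "(\<lambda>M. norm (partial_zeta s M - partial_zeta s (Suc n))) \<longlonglongrightarrow> norm (zeta s - partial_zeta s (Suc n))"
            by (intro tendsto_intros partial_zeta_tendsto s1)
          show "\<exists>N. \<forall>M\<ge>N. norm (partial_zeta s M - partial_zeta s (Suc n)) \<le> real (Suc n) powr (- Re s) * (1 + norm s / Re s)"
            by (intro exI[of _ "Suc n"] allI impI partial_zeta_tail_bound) (use s1 in auto)
        qed
        also have "\<dots> \<le> real (Suc n) powr (- r) * C" unfolding C_def
          by (intro mult_mono powr_mono add_left_mono frac_le) (use rs ns r d in auto)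
        also note elim
        finally show "dist (partial_zeta s (Suc n)) (zeta s) < e" by (simp add: dist_norm norm_minus_commute)
      qed
    qed
  qed
  with d show "\<exists>d>0. cball x d \<subseteq> {s. Re s > 0} - {1} \<and>
    uniform_limit (cball x d) (\<lambda>n s. partial_zeta s (Suc n)) zeta sequentially" by blast
qed

lemma zeta_analytic: "Re s > 0 \<Longrightarrow> s \<noteq> 1 \<Longrightarrow> zeta analytic_on {s}"
  using zeta_holomorphic open_zeta_domain by (auto simp: analytic_at)

lemma zeta_cnj:
  assumes "s \<noteq> 1" "Re s > 0"
  shows "zeta (cnj s) = cnj (zeta s)"
proof -
  have "partial_zeta (cnj s) = (\<lambda>N. cnj (partial_zeta s N))"
    by (auto simp: partial_zeta_def fun_eq_iff cnj_powr)
  then have "partial_zeta (cnj s) \<longlonglongrightarrow> cnj (zeta s)"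
    using tendsto_cnj[OF partial_zeta_tendsto[OF assms]] by simp
  moreover have "partial_zeta (cnj s) \<longlonglongrightarrow> zeta (cnj s)"
    by (rule partial_zeta_tendsto) (use assms in \<open>auto simp: complex_eq_iff\<close>)
  ultimately show ?thesis by (rule LIMSEQ_unique[symmetric])
qed

lemma zeta_of_real:
  assumes "x > 0" "x \<noteq> 1"
  shows "zeta (of_real x) = of_real (zetaR x)"
proof -
  have "cnj (zeta (of_real x)) = zeta (of_real x)"
    using zeta_cnj[of "of_real x"] assms by (auto simp: complex_eq_iff)
  then show ?thesis by (simp add: zetaR_def complex_eq_iff)
qed

section \<open>Power sums against integrals, and the sign of zeta on the interval
  \<open>(0, 1)\<close>\<close>

lemma powr_increment_bounds:
  fixes x a :: real
  assumes "x > 0" "a > 0" "a \<noteq> 1"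
  shows "(x + 1) powr (- a) \<le> ((x + 1) powr (1 - a) - x powr (1 - a)) / (1 - a)"
    and "((x + 1) powr (1 - a) - x powr (1 - a)) / (1 - a) \<le> x powr (- a)"
proof -
  have "\<exists>z. x < z \<and> z < x + 1 \<and> (x + 1) powr (1 - a) / (1 - a) - x powr (1 - a) / (1 - a) = (x + 1 - x) * z powr (- a)"
  proof (rule MVT2)
    fix u assume "x \<le> u"
    then have "((\<lambda>u. u powr (1 - a) / (1 - a)) has_real_derivative ((1 - a) * u powr (1 - a - 1) / (1 - a))) (at u)"
      using assms by (auto intro!: derivative_eq_intros)
    then show "((\<lambda>u. u powr (1 - a) / (1 - a)) has_real_derivative u powr (- a)) (at u)"
      using assms by simp
  qed simp
  then obtain z where z: "x < z" "z < x + 1"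
    "((x + 1) powr (1 - a) - x powr (1 - a)) / (1 - a) = z powr (- a)" by (auto simp: diff_divide_distrib)
  show "(x + 1) powr (- a) \<le> ((x + 1) powr (1 - a) - x powr (1 - a)) / (1 - a)"
    "((x + 1) powr (1 - a) - x powr (1 - a)) / (1 - a) \<le> x powr (- a)"
    unfolding z(3) using z(1,2) assms by (auto intro!: powr_mono2')
qed

lemma sum_powr_le:
  fixes a :: real
  assumes "1 \<le> M" "M \<le> N" "a > 0" "a \<noteq> 1"
  shows "(\<Sum>n=Suc M..N. real n powr (- a)) \<le> (real N powr (1 - a) - real M powr (1 - a)) / (1 - a)"
  using assms(2)
proof (induction N rule: dec_induct)
  case (step n)
  then show ?case using powr_increment_bounds(1)[of "real n" a] assms
    by (simp add: add.commute diff_divide_distrib)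
qed simp

lemma sum_powr_ge:
  fixes a :: real
  assumes "1 \<le> M" "M \<le> N" "a > 0" "a \<noteq> 1"
  shows "(\<Sum>n=M..<N. real n powr (- a)) \<ge> (real N powr (1 - a) - real M powr (1 - a)) / (1 - a)"
  using assms(2)
proof (induction N rule: dec_induct)
  case (step n)
  then show ?case using powr_increment_bounds(2)[of "real n" a] assms
    by (simp add: add.commute diff_divide_distrib)
qed simp

text \<open>Comparing the sum with the integral from \<open>1\<close> bounds every partial sum by
  \<open>1 - 1/(1 - x) = - x/(1 - x)\<close>. \<open>N_zeros\<close> also counts points with
  \<open>Im \<rho> = 0\<close>, and this is what excludes real zeros.\<close>

lemma zeta_real_neg:
  assumes "0 < x" "x < 1"
  shows "zetaR x < 0"
proof -
  define R where "R = (\<lambda>N. (\<Sum>n=1..N. real n powr (- x)) - real N powr (1 - x) / (1 - x))"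
  have p: "(of_nat n :: complex) powr of_real y = of_real (real n powr y)" for n y
    using powr_of_real[of "real n" y] by simp
  have "partial_zeta (of_real x) N =
      (\<Sum>n=1..N. of_nat n powr of_real (- x)) - of_nat N powr of_real (1 - x) / of_real (1 - x)" for N
    by (simp add: partial_zeta_def)
  then have eq: "partial_zeta (of_real x) N = of_real (R N)" for N
    unfolding p by (simp add: R_def)
  have "partial_zeta (of_real x) \<longlonglongrightarrow> zeta (of_real x)"
    by (rule partial_zeta_tendsto) (use assms in auto)
  then have "(\<lambda>N. Re (partial_zeta (of_real x) N)) \<longlonglongrightarrow> zetaR x"
    unfolding zetaR_def by (intro tendsto_intros)
  then have "R \<longlonglongrightarrow> zetaR x" by (simp add: eq)
  moreover have "R N \<le> 1 - 1 / (1 - x)" if "N \<ge> 1" for N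
  proof -
    have "(\<Sum>n=1..N. real n powr (- x)) = 1 + (\<Sum>n=Suc 1..N. real n powr (- x))"
      using sum.atLeast_Suc_atMost[of 1 N "\<lambda>n. real n powr (- x)"] that by simp
    then show ?thesis using sum_powr_le[of 1 N x] that assms by (simp add: R_def diff_divide_distrib)
  qed
  ultimately have "zetaR x \<le> 1 - 1 / (1 - x)" by (intro LIMSEQ_le_const2) auto
  also have "\<dots> < 0" using assms by (simp add: field_simps)
  finally show ?thesis .
qed

section \<open>Euler product and non-vanishing on the line \<open>Re s = 1\<close>\<close>

lemma
  assumes "Re s > 1"
  shows zeta_sums: "(\<lambda>n. of_nat (Suc n) powr (- s)) sums zeta s"
    and summable_norm_zeta: "summable (\<lambda>n. norm (of_nat (Suc n) powr (- s) :: complex))"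
    and norm_zeta_le: "norm (zeta s) \<le> Re s / (Re s - 1)"
proof -
  have s1: "s \<noteq> 1" "Re s > 0" using assms by auto
  have "(\<lambda>N. real N powr (1 - Re s)) \<longlonglongrightarrow> 0" by (rule powr_at_top_0) (use assms in auto)
  then have "(\<lambda>N. of_nat N powr (1 - s) :: complex) \<longlonglongrightarrow> 0"
    by (rule Lim_null_comparison[rotated])
      (auto simp: eventually_sequentially norm_of_nat_powr intro!: exI[of _ 1])
  then have "(\<lambda>N. partial_zeta s N + of_nat N powr (1 - s) / (1 - s)) \<longlonglongrightarrow> zeta s + 0 / (1 - s)"
    by (intro tendsto_intros partial_zeta_tendsto s1) (use s1 in auto)
  moreover have "partial_zeta s N + of_nat N powr (1 - s) / (1 - s) = (\<Sum>n<N. of_nat (Suc n) powr (- s))" for N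
    unfolding partial_zeta_def by (simp add: sum.atLeast1_atMost_eq)
  ultimately show sums: "(\<lambda>n. of_nat (Suc n) powr (- s)) sums zeta s" by (simp add: sums_def)
  have le: "(\<Sum>n<N. norm (of_nat (Suc n) powr (- s) :: complex)) \<le> Re s / (Re s - 1)" for N
  proof (cases "N = 0")
    case False
    have "(\<Sum>n<N. norm (of_nat (Suc n) powr (- s) :: complex)) = (\<Sum>n=1..N. real n powr (- Re s))"
      unfolding sum.atLeast1_atMost_eq One_nat_def
      by (intro sum.cong refl) (simp add: norm_of_nat_powr del: of_nat_Suc)
    also have "\<dots> = 1 + (\<Sum>n=Suc 1..N. real n powr (- Re s))"
      using sum.atLeast_Suc_atMost[of 1 N "\<lambda>n. real n powr (- Re s)"] False by simp
    also have "\<dots> \<le> 1 + (real N powr (1 - Re s) - real 1 powr (1 - Re s)) / (1 - Re s)"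
      using sum_powr_le[of 1 N "Re s"] False assms by simp
    also have "(real N powr (1 - Re s) - real 1 powr (1 - Re s)) / (1 - Re s) = (1 - real N powr (1 - Re s)) / (Re s - 1)"
      by (metis minus_diff_eq minus_divide_divide of_nat_1 powr_one_eq_one)
    also have "1 + \<dots> \<le> 1 + 1 / (Re s - 1)"
      using assms by (intro add_left_mono divide_right_mono) auto
    also have "\<dots> = Re s / (Re s - 1)" using assms by (simp add: field_simps)
    finally show ?thesis .
  qed (use assms in simp)
  show summ: "summable (\<lambda>n. norm (of_nat (Suc n) powr (- s) :: complex))"
    by (rule summableI_nonneg_bounded[OF _ le]) simp
  have "norm (zeta s) \<le> (\<Sum>n. norm (of_nat (Suc n) powr (- s) :: complex))"
    using sums_unique[OF sums] summable_norm[OF summ] by simp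
  also have "\<dots> \<le> Re s / (Re s - 1)" by (rule suminf_le_const[OF summ le])
  finally show "norm (zeta s) \<le> Re s / (Re s - 1)" .
qed

lemma zetaR_sums:
  assumes "x > 1"
  shows "(\<lambda>n. real (Suc n) powr (- x)) sums zetaR x"
proof -
  have p: "(of_nat n :: complex) powr (- of_real x) = of_real (real n powr (- x))" for n
    using powr_of_real[of "real n" "- x"] by simp
  have "(\<lambda>n. Re (of_nat (Suc n) powr (- of_real x))) sums Re (zeta (of_real x))"
    by (intro sums_Re zeta_sums) (use assms in simp)
  then show ?thesis unfolding p zetaR_def by simp
qed

lemma zetaR_le: "x > 1 \<Longrightarrow> zetaR x \<le> x / (x - 1)"
  using norm_zeta_le[of "of_real x"] complex_Re_le_cmod[of "zeta (of_real x)"] by (simp add: zetaR_def)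

text \<open>The first bound, by the integral, is sharp near the pole and is what makes
  \<open>zetaR (1 + eta)\<close> at least \<open>10^4\<close> in \<open>E4_ge\<close>.\<close>

lemma zetaR_ge:
  assumes "x > 1"
  shows "zetaR x \<ge> 1 / (x - 1)" "zetaR x \<ge> 1"
proof -
  have summ: "summable (\<lambda>n. real (Suc n) powr (- x))" using zetaR_sums[OF assms] by (rule sums_summable)
  have "(\<lambda>N. real N powr (1 - x)) \<longlonglongrightarrow> 0" by (rule powr_at_top_0) (use assms in auto)
  then have "(\<lambda>N. (real N powr (1 - x) - 1) / (1 - x)) \<longlonglongrightarrow> (0 - 1) / (1 - x)"
    by (intro tendsto_intros) (use assms in auto)
  moreover have "(real N powr (1 - x) - 1) / (1 - x) \<le> zetaR x" if "N \<ge> 1" for N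
  proof -
    have "(real N powr (1 - x) - 1) / (1 - x) \<le> (\<Sum>n=1..<N. real n powr (- x))"
      using sum_powr_ge[of 1 N x] that assms by simp
    also have "\<dots> = (\<Sum>n<N-1. real (Suc n) powr (- x))"
      using that by (intro sum.reindex_bij_witness[of _ Suc "\<lambda>n. n - 1"]) auto
    also have "\<dots> \<le> zetaR x" using sum_le_suminf[OF summ, of "{..<N-1}"] sums_unique[OF zetaR_sums[OF assms]] by simp
    finally show ?thesis .
  qed
  ultimately have "(0 - 1) / (1 - x) \<le> zetaR x" by (intro LIMSEQ_le_const2) auto
  then show "zetaR x \<ge> 1 / (x - 1)" using assms by (simp add: field_simps)
  show "zetaR x \<ge> 1"
    using sum_le_suminf[OF summ, of "{..<1}"] sums_unique[OF zetaR_sums[OF assms]] by simp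
qed

lemma norm_zeta_le_zetaR:
  assumes "Re s > 1"
  shows "norm (zeta s) \<le> zetaR (Re s)"
proof -
  have "norm (zeta s) \<le> (\<Sum>n. norm (of_nat (Suc n) powr (- s) :: complex))"
    using sums_unique[OF zeta_sums[OF assms]] summable_norm[OF summable_norm_zeta[OF assms]] by simp
  also have "(\<lambda>n. norm (of_nat (Suc n) powr (- s) :: complex)) = (\<lambda>n. real (Suc n) powr (- Re s))"
    by (intro ext) (simp add: norm_of_nat_powr del: of_nat_Suc)
  finally show ?thesis using sums_unique[OF zetaR_sums[OF assms]] by simp
qed

lemma norm_zeta_minus_1_le:
  assumes "Re s > 1"
  shows "norm (zeta s - 1) \<le> zetaR (Re s) - 1"
proof -
  have "(\<lambda>n. of_nat (Suc (Suc n)) powr (- s)) sums (zeta s - 1)"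
    using zeta_sums[OF assms] by (subst sums_Suc_iff) simp
  moreover have "summable (\<lambda>n. norm (of_nat (Suc (Suc n)) powr (- s) :: complex))"
    using summable_norm_zeta[OF assms] by (subst summable_Suc_iff)
  ultimately have "norm (zeta s - 1) \<le> (\<Sum>n. norm (of_nat (Suc (Suc n)) powr (- s) :: complex))"
    using sums_unique summable_norm by metis
  also have "(\<lambda>n. norm (of_nat (Suc (Suc n)) powr (- s) :: complex)) = (\<lambda>n. real (Suc (Suc n)) powr (- Re s))"
    by (intro ext) (simp add: norm_of_nat_powr del: of_nat_Suc)
  also have "(\<lambda>n. real (Suc (Suc n)) powr (- Re s)) sums (zetaR (Re s) - 1)"
    using zetaR_sums[OF assms] by (subst sums_Suc_iff) simp
  then have "(\<Sum>n. real (Suc (Suc n)) powr (- Re s)) = zetaR (Re s) - 1" by (rule sums_unique[symmetric])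
  finally show ?thesis .
qed

text \<open>The term \<open>n = 2\<close> contributes one unit of \<open>2 powr (- x)\<close>; the
  integral from \<open>2\<close> contributes at most two more because
  \<open>x - 1 \<ge> 1\<close>.\<close>

lemma zetaR_minus_1_le:
  assumes "x \<ge> 2"
  shows "zetaR x - 1 \<le> 3 * 2 powr (- x)"
proof -
  have "(\<lambda>n. real (Suc (Suc n)) powr (- x)) sums (zetaR x - 1)"
    using zetaR_sums[of x] assms by (subst sums_Suc_iff) simp
  moreover have "(\<Sum>n<N. real (Suc (Suc n)) powr (- x)) \<le> 3 * 2 powr (- x)" for N
  proof (cases "N = 0")
    case False
    have "(\<Sum>n<N. real (Suc (Suc n)) powr (- x)) = (\<Sum>n=2..Suc N. real n powr (- x))"
      by (intro sum.reindex_bij_witness[of _ "\<lambda>n. n - 2" "\<lambda>n. Suc (Suc n)"]) auto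
    also have "\<dots> = 2 powr (- x) + (\<Sum>n=Suc 2..Suc N. real n powr (- x))"
      using sum.atLeast_Suc_atMost[of 2 "Suc N" "\<lambda>n. real n powr (- x)"] False by simp
    also have "\<dots> \<le> 2 powr (- x) + (real (Suc N) powr (1 - x) - real 2 powr (1 - x)) / (1 - x)"
      using sum_powr_le[of 2 "Suc N" x] False assms by simp
    also have "\<dots> = 2 powr (- x) + (2 powr (1 - x) - real (Suc N) powr (1 - x)) / (x - 1)"
      using assms by (simp add: field_simps)
    also have "\<dots> \<le> 2 powr (- x) + 2 powr (1 - x) / 1"
      by (intro add_left_mono frac_le) (use assms in auto)
    also have "2 powr (1 - x) = 2 * 2 powr (-x)" by (simp add: powr_diff powr_minus field_simps)
    finally show ?thesis by simp
  qed simp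
  ultimately show ?thesis unfolding sums_def by (intro LIMSEQ_le_const2) auto
qed

section \<open>The Euler product by sieving\<close>

definition sifted :: "nat set \<Rightarrow> nat set" where
  "sifted S = {n. n > 0 \<and> (\<forall>p\<in>S. \<not> p dvd n)}"

lemma sifted_insert:
  assumes "prime p" "p \<notin> S" "\<forall>q\<in>S. prime q"
  shows "sifted S = sifted (insert p S) \<union> (*) p ` sifted S" "sifted (insert p S) \<inter> (*) p ` sifted S = {}"
proof -
  have "\<not> q dvd p" if "q \<in> S" for q
    using assms that by (metis primes_dvd_imp_eq)
  then have *: "q dvd p * n \<longleftrightarrow> q dvd n" if "q \<in> S" for q n
    using that assms(3) prime_dvd_mult_iff by blast
  show "sifted S = sifted (insert p S) \<union> (*) p ` sifted S"
  proof (intro equalityI subsetI)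
    fix n assume n: "n \<in> sifted S"
    show "n \<in> sifted (insert p S) \<union> (*) p ` sifted S"
    proof (cases "p dvd n")
      case True
      then obtain m where "n = p * m" by (elim dvdE)
      then show ?thesis using n * by (auto simp: sifted_def)
    qed (use n in \<open>auto simp: sifted_def\<close>)
  next
    fix n assume "n \<in> sifted (insert p S) \<union> (*) p ` sifted S"
    then show "n \<in> sifted S" using * assms(1) by (auto simp: sifted_def prime_gt_0_nat)
  qed
  show "sifted (insert p S) \<inter> (*) p ` sifted S = {}" by (auto simp: sifted_def)
qed

lemma zeta_has_sum:
  assumes "Re s > 1"
  shows "((\<lambda>n. of_nat n powr (- s)) has_sum zeta s) {0<..}"
proof -
  have "((\<lambda>n. of_nat (Suc n) powr (- s)) has_sum zeta s) UNIV"
    by (rule norm_summable_imp_has_sum[OF summable_norm_zeta zeta_sums]) (use assms in auto)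
  then have "((\<lambda>n. of_nat n powr (- s)) has_sum zeta s) (range Suc)"
    by (subst has_sum_reindex) (auto simp: o_def)
  moreover have "range Suc = {0<..}" using greaterThan_0 by auto
  ultimately show ?thesis by simp
qed

text \<open>Multiplying by \<open>1 - p powr (- s)\<close> subtracts the sum over the multiples of
  \<open>p\<close> among the numbers still present. One prime is thus sieved out at each
  step.\<close>

lemma euler_product_sifted:
  assumes "Re s > 1" "finite S" "\<forall>p\<in>S. prime p"
  shows "((\<lambda>n. of_nat n powr (- s)) has_sum (\<Prod>p\<in>S. 1 - of_nat p powr (- s)) * zeta s) (sifted S)"
  using assms(2,3)
proof (induction S rule: finite_induct)
  case empty
  have "sifted {} = {0<..}" by (auto simp: sifted_def)
  then show ?case using zeta_has_sum[OF assms(1)] by simp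
next
  case (insert p S)
  define Z where "Z = (\<Prod>p\<in>S. 1 - of_nat p powr (- s)) * zeta s"
  have IH: "((\<lambda>n. of_nat n powr (- s)) has_sum Z) (sifted S)" using insert by (auto simp: Z_def)
  have p: "prime p" using insert by auto
  note spl = sifted_insert[OF p insert(2)]
  have "((\<lambda>n. of_nat p powr (- s) * of_nat n powr (- s)) has_sum of_nat p powr (- s) * Z) (sifted S)"
    by (rule has_sum_cmult_right[OF IH])
  also have "(\<lambda>n. of_nat p powr (- s) * of_nat n powr (- s)) = (\<lambda>n. of_nat n powr (- s)) \<circ> (*) p"
    by (auto simp: fun_eq_iff powr_times_real)
  finally have "((\<lambda>n. of_nat n powr (- s)) has_sum of_nat p powr (- s) * Z) ((*) p ` sifted S)"
    by (subst has_sum_reindex) (use p in \<open>auto simp: inj_on_def o_def\<close>)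
  from has_sum_Diff[OF IH this] spl insert.prems
  have "((\<lambda>n. of_nat n powr (- s)) has_sum Z - of_nat p powr (- s) * Z) (sifted S - (*) p ` sifted S)" by blast
  also have "sifted S - (*) p ` sifted S = sifted (insert p S)" using spl insert.prems by blast
  finally show ?case using insert by (simp add: Z_def algebra_simps)
qed

definition primes_le :: "nat \<Rightarrow> nat set" where "primes_le N = {p. prime p \<and> p \<le> N}"

lemma finite_primes_le [simp]: "finite (primes_le N)"
  by (rule finite_subset[of _ "{..N}"]) (auto simp: primes_le_def)

text \<open>After sieving by the primes up to \<open>N\<close>, every remaining number except
  \<open>1\<close> has a prime factor above \<open>N\<close> and so exceeds \<open>N\<close>. The
  difference from \<open>1\<close> is bounded by the tail of the series at the real point
  \<open>Re s\<close>.\<close>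

lemma euler_product_tendsto:
  assumes "Re s > 1"
  shows "(\<lambda>N. (\<Prod>p\<in>primes_le N. 1 - of_nat p powr (- s)) * zeta s) \<longlonglongrightarrow> 1"
proof -
  let ?f = "\<lambda>n. of_nat n powr (- s) :: complex"
  let ?g = "\<lambda>n. real n powr (- Re s)"
  have gsum: "(?g has_sum zetaR (Re s)) {0<..}"
  proof -
    have "((\<lambda>n. real (Suc n) powr (- Re s)) has_sum zetaR (Re s)) UNIV"
      by (rule norm_summable_imp_has_sum) (use zetaR_sums[OF assms] in \<open>auto simp: sums_iff\<close>)
    then have "(?g has_sum zetaR (Re s)) (range Suc)"
      by (subst has_sum_reindex) (auto simp: o_def)
    moreover have "range Suc = {0<..}" using greaterThan_0 by auto
    ultimately show ?thesis by simp
  qed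
  have bound: "norm ((\<Prod>p\<in>primes_le N. 1 - of_nat p powr (- s)) * zeta s - 1) \<le> zetaR (Re s) - (\<Sum>n<N. real (Suc n) powr (- Re s))"
    if "N \<ge> 1" for N
  proof -
    have "((\<lambda>n. of_nat n powr (- s)) has_sum (\<Prod>p\<in>primes_le N. 1 - of_nat p powr (- s)) * zeta s) (sifted (primes_le N))"
      by (rule euler_product_sifted[OF assms]) (auto simp: primes_le_def)
    moreover have "(?f has_sum 1) {1}" using has_sum_finite[of "{1::nat}" ?f] by simp
    moreover have "{1} \<subseteq> sifted (primes_le N)" by (auto simp: sifted_def primes_le_def)
    ultimately have h: "(?f has_sum (\<Prod>p\<in>primes_le N. 1 - of_nat p powr (- s)) * zeta s - 1) (sifted (primes_le N) - {1})"
      by (rule has_sum_Diff)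
    have sub: "sifted (primes_le N) - {1} \<subseteq> {N<..}"
    proof
      fix n assume n: "n \<in> sifted (primes_le N) - {1}"
      then obtain p where p: "prime p" "p dvd n" using prime_factor_nat[of n] by auto
      with n have "p > N" "n > 0" by (auto simp: sifted_def primes_le_def not_le)
      with dvd_imp_le[OF p(2)] show "n \<in> {N<..}" by simp
    qed
    have s1: "(?g has_sum (\<Sum>n\<in>{1..N}. ?g n)) {1..N}" by (rule has_sum_finite) simp
    have "(?g has_sum zetaR (Re s) - (\<Sum>n\<in>{1..N}. ?g n)) ({0<..} - {1..N})"
      by (rule has_sum_Diff[OF gsum s1]) auto
    also have "{0<..} - {1..N} = {N<..}" by auto
    finally have gN: "(?g has_sum zetaR (Re s) - (\<Sum>n\<in>{1..N}. ?g n)) {N<..}" .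
    have nf: "norm (?f n) = ?g n" if "n > 0" for n using that by (rule norm_of_nat_powr[THEN trans]) simp
    have abs: "(\<lambda>n. norm (?f n)) summable_on (sifted (primes_le N) - {1})"
    proof -
      have "?g summable_on (sifted (primes_le N) - {1})"
        by (rule summable_on_subset_banach[OF has_sum_imp_summable[OF gN] sub])
      then show ?thesis by (subst summable_on_cong[where g = ?g]) (auto simp: nf sifted_def)
    qed
    have "norm ((\<Prod>p\<in>primes_le N. 1 - of_nat p powr (- s)) * zeta s - 1) \<le>
        infsum (\<lambda>n. norm (?f n)) (sifted (primes_le N) - {1})"
      using norm_infsum_bound[OF abs] infsumI[OF h] by simp
    also have "\<dots> \<le> zetaR (Re s) - (\<Sum>n\<in>{1..N}. ?g n)"
      by (rule has_sum_mono_neutral[OF has_sum_infsum[OF abs] gN]) (use sub in \<open>auto simp: nf sifted_def\<close>)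
    finally show ?thesis by (simp add: sum.atLeast1_atMost_eq)
  qed
  have "(\<lambda>N. zetaR (Re s) - (\<Sum>n<N. real (Suc n) powr (- Re s))) \<longlonglongrightarrow> zetaR (Re s) - zetaR (Re s)"
    by (intro tendsto_intros) (use zetaR_sums[OF assms] in \<open>simp add: sums_def\<close>)
  then have "(\<lambda>N. (\<Prod>p\<in>primes_le N. 1 - of_nat p powr (- s)) * zeta s - 1) \<longlonglongrightarrow> 0"
    by (intro Lim_null_comparison[OF eventually_mono[OF eventually_ge_at_top[of 1] bound]]) auto
  then show ?thesis using Lim_null by blast
qed

lemma zeta_nonzero_Re_gt_1:
  assumes "Re s > 1"
  shows "zeta s \<noteq> 0"
  using LIMSEQ_unique[OF euler_product_tendsto[OF assms], of 0] by (intro notI) simp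

text \<open>Prime by prime, with \<open>u = p powr (- Re s)\<close>:
  \<open>norm (1 - p powr (- s)) \<le> 1 + u \<le> 1 / (1 - u)\<close>, and the last is the Euler
  factor at the real point \<open>Re s\<close>. This gives lower bounds for
  \<open>ln \<bar>\<zeta>\<bar>\<close> to the right of \<open>1\<close>.\<close>

lemma norm_inverse_zeta_le:
  assumes "Re s > 1"
  shows "1 / norm (zeta s) \<le> zetaR (Re s)"
proof -
  have nz: "zeta s \<noteq> 0" using assms by (rule zeta_nonzero_Re_gt_1)
  have x: "Re (of_real (Re s)) > 1" using assms by simp
  have nzR: "zeta (of_real (Re s)) \<noteq> 0" using x by (rule zeta_nonzero_Re_gt_1)
  define P where "P = (\<lambda>z N. \<Prod>p\<in>primes_le N. 1 - of_nat p powr (- z) :: complex)"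
  have l1: "(\<lambda>N. norm (P s N * zeta s) / norm (zeta s)) \<longlonglongrightarrow> norm (1::complex) / norm (zeta s)"
    unfolding P_def by (intro tendsto_intros euler_product_tendsto assms) (use nz in auto)
  have l2: "(\<lambda>N. norm (zeta (of_real (Re s))) / norm (P (of_real (Re s)) N * zeta (of_real (Re s))))
      \<longlonglongrightarrow> norm (zeta (of_real (Re s))) / norm (1::complex)"
    unfolding P_def by (intro tendsto_intros euler_product_tendsto x) auto
  have "norm (1::complex) / norm (zeta s) \<le> norm (zeta (of_real (Re s))) / norm (1::complex)"
  proof (rule LIMSEQ_le[OF l1 l2], intro exI allI impI)
    fix N :: nat
    have "(\<Prod>p\<in>primes_le N. norm (1 - of_nat p powr (- s) :: complex)) \<le>
        (\<Prod>p\<in>primes_le N. 1 / norm (1 - of_nat p powr (- of_real (Re s)) :: complex))"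
    proof (rule prod_mono, safe)
      fix p assume "p \<in> primes_le N"
      then have "prime p" by (simp add: primes_le_def)
      then have p: "p > 1" by (rule prime_gt_1_nat)
      have r: "real p powr (- Re s) < 1" using p assms powr_less_mono[of "- Re s" 0 "real p"] by simp
      have "(of_nat p :: complex) powr (- of_real (Re s)) = of_real (real p powr (- Re s))"
        using powr_of_real[of "real p" "- Re s"] by simp
      then have e: "norm (1 - of_nat p powr (- of_real (Re s)) :: complex) = 1 - real p powr (- Re s)"
        using r by (metis norm_of_real of_real_1 of_real_diff abs_of_pos diff_gt_0_iff_gt)
      have "norm (1 - of_nat p powr (- s) :: complex) \<le> 1 + real p powr (- Re s)"
        using norm_triangle_ineq4[of 1 "of_nat p powr (- s) :: complex"] p by (simp add: norm_of_nat_powr)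
      also have "\<dots> \<le> 1 / (1 - real p powr (- Re s))"
        using r by (simp add: field_simps)
      finally show "norm (1 - of_nat p powr (- s) :: complex) \<le> 1 / norm (1 - of_nat p powr (- of_real (Re s)) :: complex)"
        using e by simp
    qed auto
    then have "norm (P s N) \<le> 1 / norm (P (of_real (Re s)) N)"
      unfolding P_def prod_norm prod_dividef by simp
    then show "norm (P s N * zeta s) / norm (zeta s) \<le>
       norm (zeta (of_real (Re s))) / norm (P (of_real (Re s)) N * zeta (of_real (Re s)))"
      using nz nzR by (simp add: norm_mult)
  qed
  also have "\<dots> \<le> zetaR (Re s)" using zetaR_ge(2)[OF assms] assms by (simp add: zeta_of_real)
  finally show ?thesis by simp
qed

text \<open>Expanding the logarithms, this is \<open>3 + 4 cos \<theta> + cos 2\<theta> \<ge> 0\<close> applied to every frequency.\<close>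
lemma three_four_one_local:
  fixes r :: real and z :: complex
  assumes "0 < r" "r < 1" "norm z = 1"
  shows "(1 - r)^3 * norm (1 - of_real r * z)^4 * norm (1 - of_real r * z^2) \<le> 1"
proof -
  have L: "(\<lambda>n. - (r^n * Re (w^n) / real n)) sums ln (norm (1 - of_real r * w))" if "norm w = 1" for w :: complex
  proof -
    have n: "norm (- (of_real r * w)) < 1" using assms that by (simp add: norm_mult)
    have nz: "1 - of_real r * w \<noteq> 0" using n by auto
    have "(\<lambda>n. Re ((-1)^Suc n / of_nat n * (- (of_real r * w))^n)) sums Re (ln (1 + - (of_real r * w)))"
      by (intro sums_Re Ln_series n)
    moreover have "Re ((-1)^Suc n / of_nat n * (- (of_real r * w))^n) = - (r^n * Re (w^n) / real n)" for n
    proof -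
      have gen: "(-1)^Suc n / c * v = - (((-1)^n * v) / c)" for v c :: complex by simp
      have "(-1)^Suc n / of_nat n * (- (of_real r * w))^n = - ((of_real r * w)^n / of_nat n)"
        unfolding gen power_mult_distrib[symmetric] by simp
      also have "\<dots> = - (of_real (r^n / real n) * w^n)" by (simp add: power_mult_distrib)
      finally have e: "(-1)^Suc n / of_nat n * (- (of_real r * w))^n = - (of_real (r^n / real n) * w^n)" .
      show ?thesis unfolding e by simp
    qed
    ultimately have "(\<lambda>n. - (r^n * Re (w^n) / real n)) sums Re (ln (1 + - (of_real r * w)))" by (simp only:)
    then show ?thesis using nz by simp
  qed
  have L1: "(\<lambda>n. - (r^n / real n)) sums ln (1 - r)"
  proof -
    have "norm (1 - of_real r * 1 :: complex) = norm (of_real (1 - r) :: complex)" by simp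
    also have "\<dots> = 1 - r" using assms by (simp only: norm_of_real abs_of_pos diff_gt_0_iff_gt)
    finally show ?thesis using L[of 1] by simp
  qed
  have nz: "1 - of_real r * z \<noteq> 0" "1 - of_real r * z^2 \<noteq> 0"
    using assms norm_mult[of "of_real r" z] norm_mult[of "of_real r" "z^2"] by (auto simp: norm_power)
  have A: "(\<lambda>n. 3 * - (r^n / real n) + 4 * - (r^n * Re (z^n) / real n) + - (r^n * Re ((z^2)^n) / real n)) sums
     (3 * ln (1 - r) + 4 * ln (norm (1 - of_real r * z)) + ln (norm (1 - of_real r * z^2)))"
    by (intro sums_add sums_mult L L1) (use assms in \<open>auto simp: norm_power\<close>)
  have B: "3 * - (r^n / real n) + 4 * - (r^n * Re (z^n) / real n) + - (r^n * Re ((z^2)^n) / real n) \<le> 0" for n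
  proof -
    define w where "w = z^n"
    have "norm w = 1" using assms by (simp add: w_def norm_power)
    then have i: "(Im w)^2 = 1 - (Re w)^2" by (simp add: cmod_def)
    have "Re ((z^2)^n) = Re (w^2)" by (simp add: w_def power_mult[symmetric] mult.commute)
    also have "\<dots> = 2 * (Re w)^2 - 1" using i by (simp add: power2_eq_square)
    finally have "3 + 4 * Re (z^n) + Re ((z^2)^n) = 2 * (1 + Re w)^2"
      unfolding w_def by (simp add: power2_eq_square algebra_simps)
    then have "r^n / real n * (3 + 4 * Re (z^n) + Re ((z^2)^n)) \<ge> 0" using assms by simp
    then show ?thesis by (simp add: algebra_simps)
  qed
  have "3 * ln (1 - r) + 4 * ln (norm (1 - of_real r * z)) + ln (norm (1 - of_real r * z^2)) \<le> 0"
    by (rule sums_le[OF B A sums_zero])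
  then have "ln ((1 - r)^3 * norm (1 - of_real r * z)^4 * norm (1 - of_real r * z^2)) \<le> 0"
    using nz assms by (simp add: ln_mult ln_realpow)
  then show ?thesis using nz assms by (subst (asm) ln_le_zero_iff) auto
qed

lemma of_nat_powr_Complex:
  assumes "n > 0"
  shows "(of_nat n :: complex) powr (- Complex x t) = of_real (real n powr (- x)) * cis (- t * ln n)"
proof -
  have "(of_nat n :: complex) powr (- Complex x t) = exp (- Complex x t * of_real (ln (real n)))"
    using assms by (simp add: powr_def Ln_of_nat)
  also have "- Complex x t * of_real (ln (real n)) = of_real (- x * ln n) + \<i> * of_real (- t * ln n)"
    by (simp add: complex_eq_iff)
  also have "exp \<dots> = of_real (real n powr (- x)) * cis (- t * ln n)"
    using assms by (simp only: exp_add cis_conv_exp exp_of_real) (simp add: powr_def)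
  finally show ?thesis .
qed

text \<open>The local inequality is multiplied over the primes up to \<open>N\<close>; each finite
  product times the corresponding zeta value tends to \<open>1\<close>.\<close>

lemma three_four_one:
  assumes "x > 1"
  shows "1 \<le> zetaR x ^ 3 * norm (zeta (Complex x t)) ^ 4 * norm (zeta (Complex x (2 * t)))"
proof -
  define P where "P = (\<lambda>z N. norm (\<Prod>p\<in>primes_le N. 1 - of_nat p powr (- z) :: complex))"
  have lim: "(\<lambda>N. P s N * norm (zeta s)) \<longlonglongrightarrow> 1" if "Re s > 1" for s
    using tendsto_norm[OF euler_product_tendsto[OF that]] by (simp add: P_def norm_mult)
  define Z where "Z = norm (zeta (of_real x))^3 * norm (zeta (Complex x t)) ^ 4 * norm (zeta (Complex x (2 * t)))"
  have "(\<lambda>N. (P (of_real x) N * norm (zeta (of_real x)))^3 * (P (Complex x t) N * norm (zeta (Complex x t)))^4 *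
     (P (Complex x (2*t)) N * norm (zeta (Complex x (2*t))))) \<longlonglongrightarrow> 1^3*1^4*1"
    by (intro tendsto_intros lim) (use assms in auto)
  moreover have "(P (of_real x) N * norm (zeta (of_real x)))^3 * (P (Complex x t) N * norm (zeta (Complex x t)))^4 *
     (P (Complex x (2*t)) N * norm (zeta (Complex x (2*t)))) \<le> Z" for N
  proof -
    have "P (of_real x) N ^3 * P (Complex x t) N ^4 * P (Complex x (2*t)) N =
       (\<Prod>p\<in>primes_le N. norm (1 - of_nat p powr (- of_real x) :: complex)^3 *
        norm (1 - of_nat p powr (- Complex x t) :: complex)^4 * norm (1 - of_nat p powr (- Complex x (2*t)) :: complex))"
      unfolding P_def by (simp add: prod_norm[symmetric] prod.distrib prod_power_distrib)
    also have "\<dots> \<le> 1"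
    proof (rule prod_le_1, safe)
      fix p assume "p \<in> primes_le N"
      then have "prime p" by (simp add: primes_le_def)
      then have p: "p > 1" by (rule prime_gt_1_nat)
      define r where "r = real p powr (- x)"
      define z where "z = cis (- t * ln p)"
      have r: "0 < r" "r < 1" using p assms powr_less_mono[of "- x" 0 "real p"] by (auto simp: r_def)
      have pz: "of_nat p powr (- Complex x u) = of_real r * cis (- u * ln p)" for u
        unfolding r_def using p by (intro of_nat_powr_Complex) simp
      have "of_nat p powr (- of_real x) = (of_real r :: complex)"
        using pz[of 0] by (simp add: complex_of_real_def[of x])
      then have "1 - of_nat p powr (- of_real x) = (of_real (1 - r) :: complex)" by simp
      then have 0: "norm (1 - of_nat p powr (- of_real x) :: complex) = 1 - r"
        using r by (metis norm_of_real abs_of_pos diff_gt_0_iff_gt)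
      have 2: "of_nat p powr (- Complex x (2 * t)) = of_real r * z^2"
        unfolding pz z_def by (simp add: Complex.DeMoivre mult.assoc)
      show "norm (1 - of_nat p powr (- of_real x) :: complex)^3 *
        norm (1 - of_nat p powr (- Complex x t) :: complex)^4 * norm (1 - of_nat p powr (- Complex x (2*t)) :: complex) \<le> 1"
        using three_four_one_local[of r z] r unfolding 0 2 pz[of t] z_def[symmetric] by (simp add: z_def)
    qed auto
    finally have "P (of_real x) N ^3 * P (Complex x t) N ^4 * P (Complex x (2*t)) N \<le> 1" .
    from mult_right_mono[OF this, of Z] show ?thesis
      by (simp add: Z_def power_mult_distrib mult_ac)
  qed
  ultimately have "1 \<le> Z" by (intro LIMSEQ_le_const2) auto
  moreover have "norm (zeta (of_real x)) = zetaR x" using zetaR_ge(2)[OF assms] assms by (simp add: zeta_of_real)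
  ultimately show ?thesis by (simp add: Z_def)
qed

text \<open>A zero at height \<open>t\<close> would enter \<open>three_four_one\<close> to the
  fourth power against the third power of the pole at \<open>1\<close>, leaving a factor
  \<open>x - 1\<close> that tends to \<open>0\<close>. The result is needed because the hypothesis
  on zeros speaks only of \<open>Re \<rho> < 1\<close>, while the rectangles cross the line
  \<open>Re z = 1\<close>.\<close>

lemma zeta_nonzero_Re_1:
  assumes "t \<noteq> 0"
  shows "zeta (Complex 1 t) \<noteq> 0"
proof
  assume z0: "zeta (Complex 1 t) = 0"
  have an: "zeta analytic_on {Complex 1 u}" if "u \<noteq> 0" for u
    by (rule zeta_analytic) (use that in \<open>auto simp: complex_eq_iff\<close>)
  have lim0: "((\<lambda>x. Complex x u) \<longlongrightarrow> Complex 1 u) (at_right 1)" for u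
    by (intro tendsto_intros)
  obtain D where "(zeta has_field_derivative D) (at (Complex 1 t))"
    using an[OF assms] analytic_on_imp_differentiable_at field_differentiable_def by (metis singletonI)
  then have "((\<lambda>s. (zeta s - zeta (Complex 1 t)) / (s - Complex 1 t)) \<longlongrightarrow> D) (at (Complex 1 t))"
    by (simp add: has_field_derivative_iff)
  then have "((\<lambda>x. (zeta (Complex x t) - zeta (Complex 1 t)) / (Complex x t - Complex 1 t)) \<longlongrightarrow> D) (at_right 1)"
    by (rule filterlim_compose) (auto simp: filterlim_at eventually_at_filter intro!: lim0)
  then have l1: "((\<lambda>x. norm ((zeta (Complex x t) - zeta (Complex 1 t)) / (Complex x t - Complex 1 t))) \<longlongrightarrow> norm D) (at_right 1)"
    by (rule tendsto_norm)
  have "isCont zeta (Complex 1 (2 * t))"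
    using an[of "2 * t"] assms analytic_at_imp_isCont by auto
  then have l2: "((\<lambda>x. norm (zeta (Complex x (2 * t)))) \<longlongrightarrow> norm (zeta (Complex 1 (2 * t)))) (at_right 1)"
    by (intro tendsto_norm isCont_tendsto_compose[OF _ lim0])
  have "((\<lambda>x. x ^ 3 * norm ((zeta (Complex x t) - zeta (Complex 1 t)) / (Complex x t - Complex 1 t)) ^ 4 *
     norm (zeta (Complex x (2 * t))) * (x - 1)) \<longlongrightarrow> 1 ^ 3 * norm D ^ 4 * norm (zeta (Complex 1 (2 * t))) * (1 - 1)) (at_right (1::real))"
    by (intro tendsto_intros l1 l2)
  moreover have "\<forall>\<^sub>F x in at_right (1::real). x ^ 3 * norm ((zeta (Complex x t) - zeta (Complex 1 t)) / (Complex x t - Complex 1 t)) ^ 4 *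
     norm (zeta (Complex x (2 * t))) * (x - 1) \<ge> 1"
    using eventually_at_right_less
  proof eventually_elim
    case (elim x)
    have e: "Complex x t - Complex 1 t = of_real (x - 1)" by (simp add: complex_eq_iff)
    have "1 \<le> zetaR x ^ 3 * norm (zeta (Complex x t)) ^ 4 * norm (zeta (Complex x (2 * t)))"
      by (rule three_four_one[OF elim])
    also have "\<dots> \<le> (x / (x - 1)) ^ 3 * norm (zeta (Complex x t)) ^ 4 * norm (zeta (Complex x (2 * t)))"
      using zetaR_le[OF elim] zetaR_ge(2)[OF elim] by (intro mult_right_mono power_mono) auto
    also have "\<dots> = x ^ 3 * (norm (zeta (Complex x t)) / (x - 1)) ^ 4 * norm (zeta (Complex x (2 * t))) * (x - 1)"
    proof -
      have *: "(x / y) ^ 3 * A ^ 4 * B = x ^ 3 * (A / y) ^ 4 * B * y" if "y > 0" for y A B :: real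
        using that by (simp add: power_divide power4_eq_xxxx power3_eq_cube)
      show ?thesis by (rule *) (use elim in simp)
    qed
    finally show ?case unfolding e z0 using elim by (simp add: norm_divide del: of_real_diff)
  qed
  ultimately have "1 ^ 3 * norm D ^ 4 * norm (zeta (Complex 1 (2 * t))) * (1 - 1) \<ge> (1::real)"
    by (intro tendsto_lowerbound) auto
  then show False by simp
qed

section \<open>Approximation by a partial sum\<close>

lemma norm_pochhammer_le:
  fixes s :: complex
  assumes "\<And>j. j < k \<Longrightarrow> norm s + real j \<le> B"
  shows "norm (pochhammer s k) \<le> B ^ k"
  using assms
proof (induction k)
  case (Suc k)
  have "norm (s + of_nat k) \<le> B"
    using norm_triangle_ineq[of s "of_nat k"] Suc.prems[of k] by simp
  moreover have "norm (pochhammer s k) \<le> B ^ k" by (rule Suc.IH) (use Suc.prems in auto)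
  ultimately show ?case by (simp add: pochhammer_Suc norm_mult mult.commute[of B] mult_mono')
qed simp

text \<open>With the sum cut at \<open>N = \<lfloor>t\<rfloor>\<close>, each further order
  multiplies the Euler--Maclaurin term by at most \<open>1.06 / 2\<close>: the factor
  \<open>1/2\<close> comes from \<open>bern_bound\<close>, and
  \<open>norm s + j \<le> 1.06 N\<close>. In units of \<open>N powr (- x)\<close> the end term costs
  \<open>1/2\<close>, the geometric series \<open>0.564\<close>, the remainder \<open>0.001\<close>,
  and the correction term \<open>1\<close>, since \<open>norm (1 - s) \<ge> N\<close>. Passing from
  \<open>N\<close> back to \<open>t\<close> keeps the total \<open>2.065\<close> below
  \<open>c0\<close>.\<close>

lemma zeta_approx:
  assumes t: "t \<ge> 990" and x: "1/2 \<le> x" "x \<le> 3/2"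
  shows "norm (zeta (Complex x t) - (\<Sum>n=1..nat \<lfloor>t\<rfloor>. of_nat n powr (- Complex x t))) \<le> c0 * t powr (- x)"
proof -
  define s where "s = Complex x t"
  define N where "N = nat \<lfloor>t\<rfloor>"
  \<comment> \<open>Small enough that \<open>norm s + j \<le> 1.06 N\<close> for all
    \<open>j \<le> K\<close>, and large enough that \<open>0.53 ^ (K + 1)\<close> outweighs the
    quotient \<open>N / (x + K)\<close>, which is at most \<open>21\<close>.\<close>
  define K where "K = nat \<lfloor>t / 20\<rfloor>"
  have N: "real N \<le> t" "t < real N + 1" using t by (auto simp: N_def)
  have K: "real K \<le> t / 20" "t / 20 < real K + 1"
    using t of_int_floor_le[of "t / 20"] real_of_int_floor_add_one_gt[of "t / 20"] by (simp_all add: K_def)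
  have "real K > 48" using K t by simp
  then have K49: "K \<ge> 49" by simp
  have N1: "1 \<le> N" using N t by simp
  have s1: "s \<noteq> 1" "Re s > 0" "Re s = x" using t x by (auto simp: s_def complex_eq_iff)
  have ns: "norm s \<le> t + 3/2" using cmod_le[of s] t x by (simp add: s_def)
  have poch: "norm (pochhammer s k) \<le> (1.06 * real N) ^ k" if "k \<le> Suc K" for k
  proof (rule norm_pochhammer_le)
    fix j assume "j < k"
    then have "real j \<le> real K" using that by simp
    then show "norm s + real j \<le> 1.06 * real N" proof -
      have "norm s + real j \<le> (t + 3/2) + t / 20" using ns K(1) \<open>real j \<le> real K\<close> by linarith
      also have "\<dots> \<le> 106 / 100 * (t - 1)" using t by (simp add: field_simps)
      also have "\<dots> \<le> 106 / 100 * real N" using N by simp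
      finally have "100 * (norm s + real j) \<le> 106 * real N" by simp
      then show ?thesis by simp
    qed
  qed
  define P where "P = real N powr (- x)"
  have P: "P > 0" using N1 by (simp add: P_def)
  have Npow: "real N powr (- x - real k) * real N ^ k = P" for k
    using N1 by (simp add: P_def powr_diff powr_realpow)
  have trm: "(1/2)^(k+2) * norm (pochhammer s (Suc k)) * real N powr (- Re s - real (Suc k)) \<le> 0.265 * 0.53^k * P"
    if "k < K" for k
  proof -
    have "(1/2)^(k+2) * norm (pochhammer s (Suc k)) * real N powr (- Re s - real (Suc k)) \<le>
      (1/2)^(k+2) * (1.06 * real N) ^ Suc k * real N powr (- x - real (Suc k))"
      unfolding s1 by (intro mult_right_mono mult_left_mono poch) (use that in auto)
    also have "\<dots> = (1/2)^(k+2) * 1.06 ^ Suc k * (real N powr (- x - real (Suc k)) * real N ^ Suc k)"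
      unfolding power_mult_distrib by (simp only: mult_ac)
    also have "\<dots> = 0.265 * ((1/2)^k * 1.06^k) * P"
      unfolding Npow by (simp add: power_add)
    also have "(1/2::real)^k * 1.06^k = 0.53^k" by (simp flip: power_mult_distrib)
    finally show ?thesis .
  qed
  have "(\<Sum>k<K. (1/2)^(k+2) * norm (pochhammer s (Suc k)) * real N powr (- Re s - real (Suc k))) \<le>
     (\<Sum>k<K. 0.265 * 0.53^k * P)" by (intro sum_mono trm) auto
  also have "\<dots> = 0.265 * P * (\<Sum>k<K. 0.53^k)" by (simp add: sum_distrib_left mult_ac)
  also have "(\<Sum>k<K. 0.53^k) = (1 - 0.53^K) / (0.47::real)"
    by (subst sum_gp_strict) (simp add: field_simps)
  also have "0.265 * P * \<dots> \<le> 0.265 * P * (1 / 0.47)"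
    using P by (intro mult_left_mono divide_right_mono) auto
  also have "\<dots> \<le> 0.564 * P" using P by simp
  finally have S1: "(\<Sum>k<K. (1/2)^(k+2) * norm (pochhammer s (Suc k)) * real N powr (- Re s - real (Suc k))) \<le> 0.564 * P" .
  have "(1/2)^(K+1) * norm (pochhammer s (Suc K)) * (real N powr (- Re s - real K) / (Re s + real K)) \<le>
     (1/2)^(K+1) * (1.06 * real N) ^ Suc K * (real N powr (- Re s - real K) / (Re s + real K))"
    by (intro mult_right_mono mult_left_mono poch) (use s1 in auto)
  also have "\<dots> = ((1/2)^(K+1) * 1.06^(K+1)) * (real N powr (- x - real K) * real N ^ K) * (real N / (x + real K))"
    unfolding s1 power_mult_distrib by simp
  also have "(1/2::real)^(K+1) * 1.06^(K+1) = 0.53^(K+1)" unfolding power_mult_distrib[symmetric] by simp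
  also have "0.53^(K+1) * (real N powr (- x - real K) * real N ^ K) * (real N / (x + real K))
      = 0.53^(K+1) * (real N / (x + real K)) * P" unfolding Npow by (simp only: mult_ac)
  also have "\<dots> \<le> (0.53^20 * 21) * P"
  proof (intro mult_right_mono mult_mono)
    show "(0.53::real)^(K+1) \<le> 0.53^20" by (rule power_decreasing) (use K49 in auto)
    have "real N \<le> 20 * (real K + 1)" using N K by simp
    also have "\<dots> \<le> 21 * (x + real K)" using x K49 by simp
    finally show "real N / (x + real K) \<le> 21" using x by (simp add: divide_le_eq)
  qed (use P x in auto)
  also have "\<dots> \<le> 0.001 * P" using P by (intro mult_right_mono) (auto simp: power_divide)
  finally have S2: "(1/2)^(K+1) * norm (pochhammer s (Suc K)) * (real N powr (- Re s - real K) / (Re s + real K)) \<le> 0.001 * P" .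
  have main: "norm (zeta s - partial_zeta s N) \<le> P / 2 + 0.564 * P + 0.001 * P"
    using zeta_minus_partial_bound[OF N1 s1(1,2), of K] S1 S2 unfolding em_error_def P_def s1 add_0 by linarith
  have "t \<le> norm (1 - s)" using abs_Im_le_cmod[of "1 - s"] t by (simp add: s_def)
  then have "real N \<le> norm (1 - s)" using N by simp
  then have "real N * P / norm (1 - s) \<le> P"
    using P N1 by (simp add: divide_le_eq)
  moreover have "norm (of_nat N powr (1 - s)) = real N powr (1 - x)"
    using N1 s1 norm_of_nat_powr[of N "1 - s"] by simp
  moreover have "real N powr (1 - x) = real N * P"
    using N1 by (simp add: P_def powr_diff powr_minus field_simps)
  ultimately have F: "norm (of_nat N powr (1 - s) / (1 - s)) \<le> P" by (simp add: norm_divide)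
  have e: "zeta s - (\<Sum>n=1..N. of_nat n powr (- s)) = (zeta s - partial_zeta s N) - of_nat N powr (1 - s) / (1 - s)"
    by (simp add: partial_zeta_def)
  have "norm (zeta s - (\<Sum>n=1..N. of_nat n powr (- s))) \<le> (P / 2 + 0.564 * P + 0.001 * P) + P"
    unfolding e using norm_triangle_ineq4 main F by (rule order_trans[OF _ add_mono])
  also have "\<dots> = 2.065 * P" by simp
  \<comment> \<open>\<open>N > t - 1\<close> and \<open>t \<ge> 990\<close> give
    \<open>t \<le> 1.0011 N\<close>; the exponent \<open>x \<le> 3/2\<close> is rounded up to
    \<open>2\<close>.\<close>
  also have "P \<le> (1.0011) ^ 2 * t powr (- x)"
  proof -
    have "10000 * t \<le> 10011 * real N" using N t by linarith
    then have "t \<le> 1.0011 * real N" by simp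
    then have "t powr x \<le> (1.0011 * real N) powr x" using t x by (intro powr_mono2) auto
    also have "\<dots> = 1.0011 powr x * real N powr x" using powr_mult[of "1.0011" "real N" x] by simp
    also have "1.0011 powr x \<le> 1.0011 powr 2" by (rule powr_mono) (use x in auto)
    also have "(1.0011::real) powr 2 = 1.0011 ^ 2" by (simp add: powr_numeral)
    finally have "t powr x \<le> 1.0011^2 * real N powr x" by (simp add: mult_right_mono)
    then show ?thesis using t N1 by (simp add: P_def powr_minus field_simps)
  qed
  also have "2.065 * (1.0011 ^ 2 * t powr (- x)) \<le> c0 * t powr (- x)"
    unfolding mult.assoc[symmetric] by (intro mult_right_mono) (auto simp: c0_def power2_eq_square)
  finally show ?thesis by (simp add: s_def N_def)
qed

section \<open>Upper bounds for zeta between \<open>Re s = 1/2\<close> and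
  \<open>Re s = 3/2\<close>\<close>

lemma zeta_abs_Im:
  assumes "x > 0" "t \<noteq> 0"
  shows "norm (zeta (Complex x t)) = norm (zeta (Complex x \<bar>t\<bar>))"
proof (cases "t \<ge> 0")
  case False
  have "zeta (cnj (Complex x \<bar>t\<bar>)) = cnj (zeta (Complex x \<bar>t\<bar>))"
    by (rule zeta_cnj) (use assms in \<open>auto simp: complex_eq_iff\<close>)
  then show ?thesis using False by (simp add: complex_cnj)
qed simp

lemma norm_zeta_le_sum:
  assumes "\<bar>t\<bar> \<ge> 990" "1/2 \<le> x" "x \<le> 3/2"
  shows "norm (zeta (Complex x t)) \<le> (\<Sum>n=1..nat \<lfloor>\<bar>t\<bar>\<rfloor>. real n powr (- x)) + 1/10"
proof -
  let ?D = "\<Sum>n=1..nat \<lfloor>\<bar>t\<bar>\<rfloor>. of_nat n powr (- Complex x \<bar>t\<bar>)"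
  have "norm (zeta (Complex x t)) = norm (zeta (Complex x \<bar>t\<bar>))" using assms by (intro zeta_abs_Im) auto
  also have "\<dots> \<le> norm ?D + norm (zeta (Complex x \<bar>t\<bar>) - ?D)" using norm_triangle_sub by blast
  also have "norm ?D \<le> (\<Sum>n=1..nat \<lfloor>\<bar>t\<bar>\<rfloor>. real n powr (- x))"
    by (rule sum_norm_le) (auto simp: norm_of_nat_powr)
  also have "norm (zeta (Complex x \<bar>t\<bar>) - ?D) \<le> c0 * \<bar>t\<bar> powr (- x)" using assms by (intro zeta_approx)
  also have "\<bar>t\<bar> powr (- x) \<le> \<bar>t\<bar> powr (- 1/2)" using assms by (intro powr_mono) auto
  also have "\<dots> = 1 / sqrt \<bar>t\<bar>" using assms by (simp add: powr_minus powr_half_sqrt field_simps)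
  also have "\<dots> \<le> 1 / 30" using assms by (intro divide_left_mono real_le_rsqrt) auto
  finally show ?thesis by (simp add: c0_def)
qed

lemma norm_zeta_le_sqrt:
  assumes "\<bar>t\<bar> \<ge> 990" "1/2 \<le> x" "x \<le> 3/2"
  shows "norm (zeta (Complex x t)) \<le> 2 * sqrt \<bar>t\<bar>"
proof -
  define N where "N = nat \<lfloor>\<bar>t\<bar>\<rfloor>"
  have N: "real N \<le> \<bar>t\<bar>" "N \<ge> 1" using assms by (auto simp: N_def) linarith
  have "(\<Sum>n=1..N. real n powr (- x)) \<le> (\<Sum>n=1..N. real n powr (- (1/2)))"
    by (intro sum_mono powr_mono) (use assms in auto)
  also have "\<dots> = 1 + (\<Sum>n=Suc 1..N. real n powr (- (1/2)))"
    using sum.atLeast_Suc_atMost[of 1 N "\<lambda>n. real n powr (- (1/2))"] N by simp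
  also have "\<dots> \<le> 1 + (real N powr (1 - 1/2) - real 1 powr (1 - 1/2)) / (1 - 1/2)"
    by (intro add_left_mono sum_powr_le) (use N in auto)
  also have "\<dots> = 2 * sqrt (real N) - 1" by (simp add: powr_half_sqrt)
  also have "\<dots> \<le> 2 * sqrt \<bar>t\<bar> - 1" using N by simp
  finally show ?thesis using norm_zeta_le_sum[OF assms] by (simp add: N_def)
qed

text \<open>The term \<open>- x/(1 - x)\<close> left over from the integral comparison absorbs the
  error \<open>1/10\<close>. This bound has the better exponent and is used on the left side of the
  strips; \<open>norm_zeta_le_sqrt\<close> is uniform up to \<open>3/2\<close> and is used on their
  horizontal sides.\<close>

lemma norm_zeta_le_powr:
  assumes "\<bar>t\<bar> \<ge> 990" "1/2 \<le> x" "x < 1"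
  shows "norm (zeta (Complex x t)) \<le> \<bar>t\<bar> powr (1 - x) / (1 - x)"
proof -
  define N where "N = nat \<lfloor>\<bar>t\<bar>\<rfloor>"
  have N: "real N \<le> \<bar>t\<bar>" "N \<ge> 1" using assms by (auto simp: N_def) linarith
  have "(\<Sum>n=1..N. real n powr (- x)) = 1 + (\<Sum>n=Suc 1..N. real n powr (- x))"
    using sum.atLeast_Suc_atMost[of 1 N "\<lambda>n. real n powr (- x)"] N by simp
  also have "\<dots> \<le> 1 + (real N powr (1 - x) - real 1 powr (1 - x)) / (1 - x)"
    by (intro add_left_mono sum_powr_le) (use N assms in auto)
  also have "\<dots> \<le> 1 + (\<bar>t\<bar> powr (1 - x) - 1) / (1 - x)"
    using assms N by (intro add_left_mono divide_right_mono diff_mono) (auto intro!: powr_mono2)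
  also have "\<dots> = \<bar>t\<bar> powr (1 - x) / (1 - x) - x / (1 - x)"
  proof -
    have "1 - 1 / (1 - x) = - (x / (1 - x))" using assms by (simp add: field_simps)
    then show ?thesis by (simp add: diff_divide_distrib)
  qed
  finally have "(\<Sum>n=1..N. real n powr (- x)) \<le> \<bar>t\<bar> powr (1 - x) / (1 - x) - x / (1 - x)" .
  moreover have "x / (1 - x) \<ge> 1/10" using assms by (simp add: field_simps)
  moreover have "norm (zeta (Complex x t)) \<le> (\<Sum>n=1..N. real n powr (- x)) + 1/10"
    unfolding N_def by (rule norm_zeta_le_sum) (use assms in auto)
  ultimately show ?thesis by linarith
qed

section \<open>Green's identity on a rectangle\<close>

text \<open>Obtained from the vertical case by rotating the plane through a right angle.\<close>

lemma contour_integral_linepath_same_Im: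
  assumes "Im z = c" "Im z' = c" "Re z = a" "Re z' = b" "a < b"
  shows "contour_integral (linepath z z') f = integral {a..b} (\<lambda>x. f (Complex x c))"
proof -
  have "contour_integral (linepath (\<i> * z) (\<i> * z')) (\<lambda>w. f (- \<i> * w)) =
      \<i> * integral {a..b} (\<lambda>x. f (- \<i> * Complex (- c) x))"
    by (rule contour_integral_linepath_same_Re) (use assms in auto)
  moreover have "- \<i> * Complex (- c) x = Complex x c" for x by (simp add: complex_eq_iff)
  moreover have "- \<i> * linepath (\<i> * z) (\<i> * z') x = linepath z z' x" for x
    by (simp add: linepath_def complex_eq_iff)
  ultimately show ?thesis
    by (simp add: contour_integral_integral right_diff_distrib[symmetric] mult.assoc)
qed

text \<open>Differentiating \<open>ln \<bar>f\<bar>\<close> as half the logarithm of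
  \<open>Re^2 + Im^2\<close> involves no branch of the complex logarithm.\<close>

lemma has_real_derivative_ln_norm:
  fixes \<gamma> :: "real \<Rightarrow> complex"
  assumes "(\<gamma> has_vector_derivative v) (at x)" "(f has_field_derivative f') (at (\<gamma> x))" "f (\<gamma> x) \<noteq> 0"
  shows "((\<lambda>u. ln (norm (f (\<gamma> u)))) has_real_derivative Re (v * f' / f (\<gamma> x))) (at x)"
proof -
  have D: "((\<lambda>u. f (\<gamma> u)) has_vector_derivative v * f') (at x)"
    using field_vector_diff_chain_at[OF assms(1,2)] by (simp add: o_def)
  have R: "((\<lambda>u. Re (f (\<gamma> u))) has_real_derivative Re (v * f')) (at x)"
    using bounded_linear.has_vector_derivative[OF bounded_linear_Re D]
    by (simp add: has_real_derivative_iff_has_vector_derivative)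
  have I: "((\<lambda>u. Im (f (\<gamma> u))) has_real_derivative Im (v * f')) (at x)"
    using bounded_linear.has_vector_derivative[OF bounded_linear_Im D]
    by (simp add: has_real_derivative_iff_has_vector_derivative)
  define w where "w = f (\<gamma> x)"
  have pos: "(Re w)^2 + (Im w)^2 > 0" using assms(3) by (simp add: w_def complex_neq_0)
  have "((\<lambda>u. ln ((A u)^2 + (B u)^2) / 2) has_real_derivative
     (2 * A x * A' + 2 * B x * B') / ((A x)^2 + (B x)^2) / 2) (at x)"
    if "(A has_real_derivative A') (at x)" "(B has_real_derivative B') (at x)" "(A x)^2 + (B x)^2 > 0"
    for A B :: "real \<Rightarrow> real" and A' B'
  proof -
    have S: "((\<lambda>u. ln (F u) / 2) has_real_derivative F' / F x / 2) (at x)"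
      if "(F has_real_derivative F') (at x)" "F x > 0" for F :: "real \<Rightarrow> real" and F'
      using that by (auto intro!: derivative_eq_intros simp: field_simps)
    show ?thesis by (rule S) (use that in \<open>auto intro!: derivative_eq_intros\<close>)
  qed
  from this[OF R I] pos
  have "((\<lambda>u. ln ((Re (f (\<gamma> u)))^2 + (Im (f (\<gamma> u)))^2) / 2) has_real_derivative
     (2 * Re w * Re (v * f') + 2 * Im w * Im (v * f')) / ((Re w)^2 + (Im w)^2) / 2) (at x)"
    by (simp only: w_def)
  also have "(\<lambda>u. ln ((Re (f (\<gamma> u)))^2 + (Im (f (\<gamma> u)))^2) / 2) = (\<lambda>u. ln (norm (f (\<gamma> u))))"
  proof
    fix u show "ln ((Re (f (\<gamma> u)))^2 + (Im (f (\<gamma> u)))^2) / 2 = ln (norm (f (\<gamma> u)))"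
      by (cases "f (\<gamma> u) = 0") (auto simp: cmod_def ln_sqrt complex_neq_0)
  qed
  also have "(2 * Re w * Re (v * f') + 2 * Im w * Im (v * f')) / ((Re w)^2 + (Im w)^2) / 2 = Re (v * f' / w)"
  proof -
    have e: "2 * Re w * X + 2 * Im w * Y = 2 * (X * Re w + Y * Im w)" for X Y by (simp add: algebra_simps)
    have e2: "2 * P / S / 2 = P / S" for P S :: real by simp
    show ?thesis unfolding e e2 by (simp only: Re_divide)
  qed
  finally show ?thesis by (simp add: w_def)
qed

text \<open>With \<open>u = Re h\<close> and \<open>\<ell> = ln \<bar>f\<bar>\<close>, the Cauchy--Riemann equations turn the integrands below into
  \<open>u \<ell>\<^sub>t - u\<^sub>t \<ell>\<close> and \<open>u \<ell>\<^sub>x - u\<^sub>x \<ell>\<close>.\<close>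

definition green_hor :: "(complex \<Rightarrow> complex) \<Rightarrow> (complex \<Rightarrow> complex) \<Rightarrow> (complex \<Rightarrow> complex) \<Rightarrow> real \<Rightarrow> real \<Rightarrow> real \<Rightarrow> real" where
  "green_hor f h h' x0 x1 t = integral {x0..x1} (\<lambda>x. - Re (h (Complex x t)) * Im (deriv f (Complex x t) / f (Complex x t))
     + Im (h' (Complex x t)) * ln (norm (f (Complex x t))))"

definition green_ver :: "(complex \<Rightarrow> complex) \<Rightarrow> (complex \<Rightarrow> complex) \<Rightarrow> (complex \<Rightarrow> complex) \<Rightarrow> real \<Rightarrow> real \<Rightarrow> real \<Rightarrow> real" where
  "green_ver f h h' a b x = integral {a..b} (\<lambda>t. Re (h (Complex x t)) * Re (deriv f (Complex x t) / f (Complex x t))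
     - Re (h' (Complex x t)) * ln (norm (f (Complex x t))))"

text \<open>The derivative of \<open>Im h * ln \<bar>f\<bar>\<close> along the edge. It trades the
  part of \<open>Im (h f'/f)\<close> that carries \<open>Im h\<close> for a multiple of
  \<open>ln \<bar>f\<bar>\<close>, so that only \<open>Re h\<close>, the actual weight, multiplies
  the logarithmic derivative.\<close>

lemma green_edge:
  fixes \<gamma> :: "real \<Rightarrow> complex"
  assumes U: "open U" "f holomorphic_on U" and h: "\<And>z. z \<in> U \<Longrightarrow> (h has_field_derivative h' z) (at z)"
    and h': "continuous_on U h'" and ab: "a \<le> b"
    and \<gamma>: "\<And>x. (\<gamma> has_vector_derivative v) (at x)" "\<And>x. x \<in> {a..b} \<Longrightarrow> \<gamma> x \<in> U \<and> f (\<gamma> x) \<noteq> 0"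
  defines "q \<equiv> \<lambda>x. deriv f (\<gamma> x) / f (\<gamma> x)"
  shows "((\<lambda>x. Im (h (\<gamma> x)) * Re (v * q x) + Im (v * h' (\<gamma> x)) * ln (norm (f (\<gamma> x)))) has_integral
    Im (h (\<gamma> b)) * ln (norm (f (\<gamma> b))) - Im (h (\<gamma> a)) * ln (norm (f (\<gamma> a)))) {a..b}"
    and "continuous_on {a..b} q" "continuous_on {a..b} (\<lambda>x. h (\<gamma> x))" "continuous_on {a..b} (\<lambda>x. h' (\<gamma> x))"
    "continuous_on {a..b} (\<lambda>x. ln (norm (f (\<gamma> x))))"
proof -
  have \<gamma>c: "continuous_on {a..b} \<gamma>"
    using \<gamma>(1) by (meson has_vector_derivative_continuous continuous_at_imp_continuous_on)
  have im: "\<gamma> ` {a..b} \<subseteq> U" using \<gamma> by auto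
  have fc: "continuous_on {a..b} (\<lambda>x. f (\<gamma> x))"
    by (rule continuous_on_compose2[OF holomorphic_on_imp_continuous_on[OF U(2)] \<gamma>c im])
  have dc: "continuous_on {a..b} (\<lambda>x. deriv f (\<gamma> x))"
    by (rule continuous_on_compose2[OF holomorphic_on_imp_continuous_on[OF holomorphic_deriv[OF U(2,1)]] \<gamma>c im])
  show "continuous_on {a..b} q" unfolding q_def
    by (intro continuous_intros fc dc) (use \<gamma> in auto)
  show "continuous_on {a..b} (\<lambda>x. ln (norm (f (\<gamma> x))))"
    by (intro continuous_intros fc) (use \<gamma> in auto)
  show "continuous_on {a..b} (\<lambda>x. h' (\<gamma> x))" by (rule continuous_on_compose2[OF h' \<gamma>c im])
  have "continuous_on U h" using h by (meson DERIV_isCont continuous_at_imp_continuous_on)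
  then show "continuous_on {a..b} (\<lambda>x. h (\<gamma> x))" by (rule continuous_on_compose2[OF _ \<gamma>c im])
  show "((\<lambda>x. Im (h (\<gamma> x)) * Re (v * q x) + Im (v * h' (\<gamma> x)) * ln (norm (f (\<gamma> x)))) has_integral
    Im (h (\<gamma> b)) * ln (norm (f (\<gamma> b))) - Im (h (\<gamma> a)) * ln (norm (f (\<gamma> a)))) {a..b}"
  proof (rule fundamental_theorem_of_calculus[OF ab])
    fix x assume x: "x \<in> {a..b}"
    have "(f has_field_derivative deriv f (\<gamma> x)) (at (\<gamma> x))"
      using U x \<gamma>(2) by (intro holomorphic_derivI) auto
    from has_real_derivative_ln_norm[OF \<gamma>(1) this] x \<gamma>(2)
    have D1: "((\<lambda>u. ln (norm (f (\<gamma> u)))) has_real_derivative Re (v * q x)) (at x)"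
      by (simp add: q_def)
    have "((\<lambda>u. h (\<gamma> u)) has_vector_derivative v * h' (\<gamma> x)) (at x)"
      using field_vector_diff_chain_at[OF \<gamma>(1) h] x \<gamma>(2) by (simp add: o_def)
    from bounded_linear.has_vector_derivative[OF bounded_linear_Im this]
    have D2: "((\<lambda>u. Im (h (\<gamma> u))) has_real_derivative Im (v * h' (\<gamma> x))) (at x)"
      by (simp add: has_real_derivative_iff_has_vector_derivative)
    have "((\<lambda>u. Im (h (\<gamma> u)) * ln (norm (f (\<gamma> u)))) has_real_derivative
       Im (h (\<gamma> x)) * Re (v * q x) + Im (v * h' (\<gamma> x)) * ln (norm (f (\<gamma> x)))) (at x)"
      by (rule derivative_eq_intros D1 D2 refl)+ simp
    then show "((\<lambda>u. Im (h (\<gamma> u)) * ln (norm (f (\<gamma> u)))) has_vector_derivative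
       Im (h (\<gamma> x)) * Re (v * q x) + Im (v * h' (\<gamma> x)) * ln (norm (f (\<gamma> x)))) (at x within {a..b})"
      by (simp add: has_real_derivative_iff_has_vector_derivative has_vector_derivative_at_within)
  qed
qed

lemma green_edge_hor:
  assumes U: "open U" "f holomorphic_on U" and h: "\<And>z. z \<in> U \<Longrightarrow> (h has_field_derivative h' z) (at z)"
    and h': "continuous_on U h'" and ab: "a < b"
    and seg: "\<And>x. x \<in> {a..b} \<Longrightarrow> Complex x t \<in> U \<and> f (Complex x t) \<noteq> 0"
  shows "Im (contour_integral (linepath (Complex a t) (Complex b t)) (\<lambda>z. deriv f z * h z / f z)) =
    - green_hor f h h' a b t + (Im (h (Complex b t)) * ln (norm (f (Complex b t))) - Im (h (Complex a t)) * ln (norm (f (Complex a t))))"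
proof -
  have \<gamma>: "((\<lambda>x. Complex x t) has_vector_derivative 1) (at x)" for x
    unfolding Complex_eq by (auto intro!: derivative_eq_intros)
  note E = green_edge[OF U h h' less_imp_le[OF ab] \<gamma> seg]
  let ?q = "\<lambda>x. deriv f (Complex x t) / f (Complex x t)"
  let ?h = "\<lambda>x. h (Complex x t)" and ?h' = "\<lambda>x. h' (Complex x t)" and ?l = "\<lambda>x. ln (norm (f (Complex x t)))"
  have "((\<lambda>x. ?q x * ?h x) has_integral integral {a..b} (\<lambda>x. ?q x * ?h x)) {a..b}"
    by (intro integrable_integral integrable_continuous_real continuous_intros E)
  from has_integral_linear[OF this bounded_linear_Im]
  have 1: "((\<lambda>x. Im (?q x * ?h x)) has_integral Im (integral {a..b} (\<lambda>x. ?q x * ?h x))) {a..b}" by (simp add: o_def)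
  have 2: "((\<lambda>x. - Re (?h x) * Im (?q x) + Im (?h' x) * ?l x) has_integral green_hor f h h' a b t) {a..b}"
    unfolding green_hor_def by (intro integrable_integral integrable_continuous_real continuous_intros E)
  have 3: "((\<lambda>x. Im (?q x * ?h x) + (- Re (?h x) * Im (?q x) + Im (?h' x) * ?l x)) has_integral
     Im (integral {a..b} (\<lambda>x. ?q x * ?h x)) + green_hor f h h' a b t) {a..b}"
    by (rule has_integral_add[OF 1 2])
  have 4: "(\<lambda>x. Im (?q x * ?h x) + (- Re (?h x) * Im (?q x) + Im (?h' x) * ?l x)) =
     (\<lambda>x. Im (?h x) * Re (1 * ?q x) + Im (1 * ?h' x) * ?l x)"
  proof -
    have e: "Im (q * h) + (- Re h * Im q + Im h' * l) = Im h * Re (1 * q) + Im (1 * h') * l" for q h h' l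
      by simp
    show ?thesis by (rule ext, rule e)
  qed
  have 5: "Im (integral {a..b} (\<lambda>x. ?q x * ?h x)) + green_hor f h h' a b t =
     Im (?h b) * ?l b - Im (?h a) * ?l a"
    by (rule has_integral_unique[OF 3[unfolded 4] E(1)])
  have 6: "contour_integral (linepath (Complex a t) (Complex b t)) (\<lambda>z. deriv f z * h z / f z) =
     integral {a..b} (\<lambda>x. deriv f (Complex x t) * ?h x / f (Complex x t))"
    by (rule contour_integral_linepath_same_Im) (use ab in auto)
  have 7: "DD / f z * h z = DD * h z / f z" for DD z by simp
  show ?thesis using 5 unfolding 6 7 by simp
qed

lemma green_edge_ver:
  assumes U: "open U" "f holomorphic_on U" and h: "\<And>z. z \<in> U \<Longrightarrow> (h has_field_derivative h' z) (at z)"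
    and h': "continuous_on U h'" and ab: "a < b"
    and seg: "\<And>t. t \<in> {a..b} \<Longrightarrow> Complex x t \<in> U \<and> f (Complex x t) \<noteq> 0"
  shows "Im (contour_integral (linepath (Complex x a) (Complex x b)) (\<lambda>z. deriv f z * h z / f z)) =
    green_ver f h h' a b x + (Im (h (Complex x b)) * ln (norm (f (Complex x b))) - Im (h (Complex x a)) * ln (norm (f (Complex x a))))"
proof -
  have \<gamma>: "((\<lambda>t. Complex x t) has_vector_derivative \<i>) (at t)" for t
    unfolding Complex_eq by (auto intro!: derivative_eq_intros)
  note E = green_edge[OF U h h' less_imp_le[OF ab] \<gamma> seg]
  let ?q = "\<lambda>t. deriv f (Complex x t) / f (Complex x t)"
  let ?h = "\<lambda>t. h (Complex x t)" and ?h' = "\<lambda>t. h' (Complex x t)" and ?l = "\<lambda>t. ln (norm (f (Complex x t)))"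
  have "((\<lambda>t. ?q t * ?h t) has_integral integral {a..b} (\<lambda>t. ?q t * ?h t)) {a..b}"
    by (intro integrable_integral integrable_continuous_real continuous_intros E)
  from has_integral_linear[OF this bounded_linear_Re]
  have 1: "((\<lambda>t. Re (?q t * ?h t)) has_integral Re (integral {a..b} (\<lambda>t. ?q t * ?h t))) {a..b}" by (simp add: o_def)
  have 2: "((\<lambda>t. Re (?h t) * Re (?q t) - Re (?h' t) * ?l t) has_integral green_ver f h h' a b x) {a..b}"
    unfolding green_ver_def by (intro integrable_integral integrable_continuous_real continuous_intros E)
  have 3: "((\<lambda>t. Re (?q t * ?h t) - (Re (?h t) * Re (?q t) - Re (?h' t) * ?l t)) has_integral
     Re (integral {a..b} (\<lambda>t. ?q t * ?h t)) - green_ver f h h' a b x) {a..b}"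
    by (rule has_integral_diff[OF 1 2])
  have 4: "(\<lambda>t. Re (?q t * ?h t) - (Re (?h t) * Re (?q t) - Re (?h' t) * ?l t)) =
     (\<lambda>t. Im (?h t) * Re (\<i> * ?q t) + Im (\<i> * ?h' t) * ?l t)"
  proof -
    have e: "Re (q * h) - (Re h * Re q - Re h' * l) = Im h * Re (\<i> * q) + Im (\<i> * h') * l" for q h h' l
      by simp
    show ?thesis by (rule ext, rule e)
  qed
  have 5: "Re (integral {a..b} (\<lambda>t. ?q t * ?h t)) - green_ver f h h' a b x =
     Im (?h b) * ?l b - Im (?h a) * ?l a"
    by (rule has_integral_unique[OF 3[unfolded 4] E(1)])
  have 6: "contour_integral (linepath (Complex x a) (Complex x b)) (\<lambda>z. deriv f z * h z / f z) =
     \<i> * integral {a..b} (\<lambda>t. deriv f (Complex x t) * ?h t / f (Complex x t))"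
    by (rule contour_integral_linepath_same_Re) (use ab in auto)
  have 7: "DD / f z * h z = DD * h z / f z" for DD z by simp
  show ?thesis using 5 unfolding 6 7 by simp
qed

text \<open>The imaginary part of the argument principle with the holomorphic factor
  \<open>h\<close>. The four edges produce values of \<open>Im h * ln \<bar>f\<bar>\<close> at the
  corners, and these cancel around the rectangle.\<close>

theorem green_rectangle:
  fixes x0 x1 a b :: real
  assumes U: "open U" "connected U" "f holomorphic_on U" and fin: "finite {z\<in>U. f z = 0}"
    and h: "\<And>z. z \<in> U \<Longrightarrow> (h has_field_derivative h' z) (at z)" and h': "continuous_on U h'"
    and xab: "x0 < x1" "a < b" and sub: "cbox (Complex x0 a) (Complex x1 b) \<subseteq> U"
    and bd: "\<And>z. z \<in> cbox (Complex x0 a) (Complex x1 b) - box (Complex x0 a) (Complex x1 b) \<Longrightarrow> f z \<noteq> 0"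
  shows "green_hor f h h' x0 x1 b - green_hor f h h' x0 x1 a + green_ver f h h' a b x1 - green_ver f h h' a b x0
    = 2 * pi * (\<Sum>z | z \<in> box (Complex x0 a) (Complex x1 b) \<and> f z = 0. Re (h z) * zorder f z)"
proof -
  let ?C = "cbox (Complex x0 a) (Complex x1 b)" and ?B = "box (Complex x0 a) (Complex x1 b)"
  let ?g = "\<lambda>z. deriv f z * h z / f z"
  let ?R = "rectpath (Complex x0 a) (Complex x1 b)"
  have in_bd: "Complex x t \<in> ?C - ?B" if "x \<in> {x0..x1} \<and> t \<in> {a, b} \<or> x \<in> {x0, x1} \<and> t \<in> {a..b}" for x t
    using that xab by (auto simp: in_cbox_complex_iff in_box_complex_iff)
  have hol: "h holomorphic_on U" using h U(1) by (auto simp: holomorphic_on_open)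
  have pi: "path_image ?R = ?C - ?B"
    by (rule path_image_rectpath_cbox_minus_box) (use xab in auto)
  have cont: "continuous_on (path_image ?R) ?g"
    unfolding pi
    by (intro continuous_intros holomorphic_on_imp_continuous_on holomorphic_on_subset[OF holomorphic_deriv[OF U(3,1)]]
        holomorphic_on_subset[OF U(3)] holomorphic_on_subset[OF hol])
      (use sub bd in auto)
  have segs: "closed_segment (Complex x0 a) (Complex x1 a) \<subseteq> path_image ?R"
    "closed_segment (Complex x1 a) (Complex x1 b) \<subseteq> path_image ?R"
    "closed_segment (Complex x1 b) (Complex x0 b) \<subseteq> path_image ?R"
    "closed_segment (Complex x0 b) (Complex x0 a) \<subseteq> path_image ?R"
    unfolding rectpath_def Let_def by (auto simp: path_image_join)
  have I: "?g contour_integrable_on linepath z w" if "closed_segment z w \<subseteq> path_image ?R" for z w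
    by (rule contour_integrable_continuous_linepath[OF continuous_on_subset[OF cont that]])
  have "contour_integral ?R ?g = contour_integral (linepath (Complex x0 a) (Complex x1 a)) ?g +
     (contour_integral (linepath (Complex x1 a) (Complex x1 b)) ?g +
     (contour_integral (linepath (Complex x1 b) (Complex x0 b)) ?g +
      contour_integral (linepath (Complex x0 b) (Complex x0 a)) ?g))"
    unfolding rectpath_def Let_def using I[OF segs(1)] I[OF segs(2)] I[OF segs(3)] I[OF segs(4)]
    by (simp add: valid_path_join)
  also have "contour_integral (linepath (Complex x1 b) (Complex x0 b)) ?g = - contour_integral (linepath (Complex x0 b) (Complex x1 b)) ?g"
    by (rule contour_integral_reverse_linepath) (rule continuous_on_subset[OF cont segs(3)])
  also have "contour_integral (linepath (Complex x0 b) (Complex x0 a)) ?g = - contour_integral (linepath (Complex x0 a) (Complex x0 b)) ?g"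
    by (rule contour_integral_reverse_linepath) (rule continuous_on_subset[OF cont segs(4)])
  finally have A: "Im (contour_integral ?R ?g) =
     green_hor f h h' x0 x1 b - green_hor f h h' x0 x1 a + green_ver f h h' a b x1 - green_ver f h h' a b x0"
  proof -
    have s: "Complex x t \<in> U \<and> f (Complex x t) \<noteq> 0"
      if "x \<in> {x0..x1} \<and> t \<in> {a, b} \<or> x \<in> {x0, x1} \<and> t \<in> {a..b}" for x t
      using in_bd[OF that] sub bd by blast
    have "Im (contour_integral (linepath (Complex x0 t) (Complex x1 t)) ?g) =
      - green_hor f h h' x0 x1 t + (Im (h (Complex x1 t)) * ln (norm (f (Complex x1 t))) - Im (h (Complex x0 t)) * ln (norm (f (Complex x0 t))))"
      if "t \<in> {a, b}" for t
      by (rule green_edge_hor[OF U(1,3) h h' xab(1)]) (use s that in auto)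
    moreover have "Im (contour_integral (linepath (Complex x a) (Complex x b)) ?g) =
      green_ver f h h' a b x + (Im (h (Complex x b)) * ln (norm (f (Complex x b))) - Im (h (Complex x a)) * ln (norm (f (Complex x a))))"
      if "x \<in> {x0, x1}" for x
      by (rule green_edge_ver[OF U(1,3) h h' xab(2)]) (use s that in auto)
    ultimately show ?thesis if "contour_integral ?R ?g = contour_integral (linepath (Complex x0 a) (Complex x1 a)) ?g +
     (contour_integral (linepath (Complex x1 a) (Complex x1 b)) ?g +
     (- contour_integral (linepath (Complex x0 b) (Complex x1 b)) ?g +
      - contour_integral (linepath (Complex x0 a) (Complex x0 b)) ?g))"
      unfolding that by simp
  qed
  have B: "contour_integral ?R ?g = 2 * pi * \<i> * (\<Sum>p\<in>{w\<in>U. f w = 0 \<or> w \<in> {}}. winding_number ?R p * h p * zorder f p)"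
  proof (rule argument_principle)
    show "path_image ?R \<subseteq> U - {w \<in> U. f w = 0 \<or> w \<in> {}}" unfolding pi using sub bd by auto
    show "\<forall>z. z \<notin> U \<longrightarrow> winding_number ?R z = 0"
      using sub xab by (auto intro!: winding_number_rectpath_outside)
  qed (use U fin hol in auto)
  have C: "(\<Sum>p\<in>{w\<in>U. f w = 0 \<or> w \<in> {}}. winding_number ?R p * h p * zorder f p) =
     (\<Sum>p | p \<in> ?B \<and> f p = 0. h p * zorder f p)"
  proof (rule sum.mono_neutral_cong_right)
    show "finite {w \<in> U. f w = 0 \<or> w \<in> {}}" using fin by simp
    show "{p. p \<in> ?B \<and> f p = 0} \<subseteq> {w \<in> U. f w = 0 \<or> w \<in> {}}"
      using sub box_subset_cbox by blast
    show "\<forall>i\<in>{w \<in> U. f w = 0 \<or> w \<in> {}} - {p. p \<in> ?B \<and> f p = 0}. winding_number ?R i * h i * zorder f i = 0"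
    proof
      fix i assume i: "i \<in> {w \<in> U. f w = 0 \<or> w \<in> {}} - {p. p \<in> ?B \<and> f p = 0}"
      then have "i \<notin> ?C" using bd by auto
      then have "winding_number ?R i = 0"
        using xab by (intro winding_number_rectpath_outside) auto
      then show "winding_number ?R i * h i * zorder f i = 0" by simp
    qed
  qed (auto simp: winding_number_rectpath)
  have "Im (contour_integral ?R ?g) = 2 * pi * Re (\<Sum>p | p \<in> ?B \<and> f p = 0. h p * zorder f p)"
    unfolding B C by simp
  then show ?thesis unfolding A by simp
qed

section \<open>Logarithm and logarithmic derivative of the zeta function\<close>

lemma zeta_not_constant: "\<not> zeta constant_on {s. Re s > 0} - {1}"
proof
  assume "zeta constant_on {s. Re s > 0} - {1}"
  then have "zeta (of_real (1/2)) = zeta (of_real 2)"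
    unfolding constant_on_def by (auto simp: complex_eq_iff)
  then have "zetaR (1/2) = zetaR 2" unfolding zetaR_def by simp
  then show False using zeta_real_neg[of "1/2"] zetaR_ge(2)[of 2] by simp
qed

lemma finite_zeta_zeros:
  assumes "compact K" "K \<subseteq> {s. Re s > 0} - {1}"
  shows "finite {z\<in>K. zeta z = 0}"
  using holomorphic_compact_finite_zeros[OF zeta_holomorphic open_zeta_domain connected_zeta_domain assms zeta_not_constant] .

text \<open>\<open>zero_mult\<close> is a \<open>LEAST\<close>, so some derivative has to be
  nonzero. Otherwise the identity theorem would make zeta vanish on its whole connected
  domain.\<close>

lemma zorder_zeta:
  assumes "Re \<rho> > 0" "\<rho> \<noteq> 1"
  shows "zorder zeta \<rho> = int (zero_mult zeta \<rho>)"
proof -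
  have "\<exists>n. (deriv ^^ n) zeta \<rho> \<noteq> 0"
  proof (rule ccontr)
    assume "\<not> ?thesis"
    then have z: "(deriv ^^ n) zeta \<rho> = 0" for n by auto
    have "zeta w = 0" if "w \<in> {s. Re s > 0} - {1}" for w
      by (rule holomorphic_fun_eq_0_on_connected[OF zeta_holomorphic open_zeta_domain connected_zeta_domain z _ that])
        (use assms in auto)
    then show False using zeta_not_constant unfolding constant_on_def by blast
  qed
  then have "(deriv ^^ zero_mult zeta \<rho>) zeta \<rho> \<noteq> 0" unfolding zero_mult_def by (rule LeastI_ex)
  moreover have "(deriv ^^ i) zeta \<rho> = 0" if "i < zero_mult zeta \<rho>" for i
    using that not_less_Least unfolding zero_mult_def by blast
  ultimately show ?thesis
    by (intro zorder_zero_eqI'[OF zeta_analytic]) (use assms in auto)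
qed

lemma zeta_green:
  assumes "0 < x0" "x0 < x1" "a < b" "0 < a \<or> b < 0"
    and h: "\<And>z. (h has_field_derivative h' z) (at z)" and h': "continuous_on UNIV h'"
    and bd: "\<And>x t. x \<in> {x0..x1} \<Longrightarrow> t \<in> {a, b} \<Longrightarrow> zeta (Complex x t) \<noteq> 0"
      "\<And>x t. x \<in> {x0, x1} \<Longrightarrow> t \<in> {a..b} \<Longrightarrow> zeta (Complex x t) \<noteq> 0"
  shows "green_hor zeta h h' x0 x1 b - green_hor zeta h h' x0 x1 a + green_ver zeta h h' a b x1 - green_ver zeta h h' a b x0
    = 2 * pi * (\<Sum>z | z \<in> box (Complex x0 a) (Complex x1 b) \<and> zeta z = 0. Re (h z) * real (zero_mult zeta z))"
    and "finite {z. z \<in> box (Complex x0 a) (Complex x1 b) \<and> zeta z = 0}"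
proof -
  \<comment> \<open>Half the distance of the rectangle from the real axis, so that the enlarged
    rectangle still misses the pole at \<open>1\<close>.\<close>
  define d where "d = min \<bar>a\<bar> \<bar>b\<bar> / 2"
  have d: "d > 0" using assms(3,4) by (auto simp: d_def)
  define U where "U = box (Complex (x0/2) (a - d)) (Complex (x1 + 1) (b + d))"
  define K where "K = cbox (Complex (x0/2) (a - d)) (Complex (x1 + 1) (b + d))"
  have K: "K \<subseteq> {s. Re s > 0} - {1}"
    using assms by (auto simp: K_def in_cbox_complex_iff d_def min_def abs_if split: if_splits)
  have UK: "U \<subseteq> K" unfolding U_def K_def by (rule box_subset_cbox)
  have finK: "finite {z\<in>K. zeta z = 0}" by (rule finite_zeta_zeros[OF _ K]) (simp add: K_def)
  have sub: "cbox (Complex x0 a) (Complex x1 b) \<subseteq> U"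
    using assms d by (auto simp: U_def in_cbox_complex_iff in_box_complex_iff)
  have eq: "green_hor zeta h h' x0 x1 b - green_hor zeta h h' x0 x1 a + green_ver zeta h h' a b x1 - green_ver zeta h h' a b x0
    = 2 * pi * (\<Sum>z | z \<in> box (Complex x0 a) (Complex x1 b) \<and> zeta z = 0. Re (h z) * zorder zeta z)"
  proof (rule green_rectangle)
    show "open U" "connected U" unfolding U_def by (auto intro: convex_connected convex_box)
    show "zeta holomorphic_on U" using holomorphic_on_subset[OF zeta_holomorphic] UK K by blast
    show "finite {z \<in> U. zeta z = 0}" by (rule finite_subset[OF _ finK]) (use UK in auto)
    show "continuous_on U h'" using h' continuous_on_subset by blast
    fix z assume "z \<in> cbox (Complex x0 a) (Complex x1 b) - box (Complex x0 a) (Complex x1 b)"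
    then have "Re z \<in> {x0..x1} \<and> Im z \<in> {a, b} \<or> Re z \<in> {x0, x1} \<and> Im z \<in> {a..b}"
      by (auto simp: in_cbox_complex_iff in_box_complex_iff)
    then show "zeta z \<noteq> 0" using bd[of "Re z" "Im z"] by auto
  qed (use assms sub in auto)
  show "finite {z. z \<in> box (Complex x0 a) (Complex x1 b) \<and> zeta z = 0}"
    by (rule finite_subset[OF _ finK]) (use sub UK box_subset_cbox in blast)
  have "zorder zeta z = int (zero_mult zeta z)" if "z \<in> box (Complex x0 a) (Complex x1 b)" for z
    by (rule zorder_zeta) (use that sub UK K box_subset_cbox in blast)+
  then show "green_hor zeta h h' x0 x1 b - green_hor zeta h h' x0 x1 a + green_ver zeta h h' a b x1 - green_ver zeta h h' a b x0
    = 2 * pi * (\<Sum>z | z \<in> box (Complex x0 a) (Complex x1 b) \<and> zeta z = 0. Re (h z) * real (zero_mult zeta z))"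
    unfolding eq by (intro arg_cong2[of _ _ _ _ "(*)"] sum.cong refl) auto
qed

lemma deriv_zeta_cnj:
  assumes "Re s > 0" "s \<noteq> 1"
  shows "deriv zeta (cnj s) = cnj (deriv zeta s)"
proof -
  have "(zeta has_field_derivative deriv zeta s) (at s)"
    using holomorphic_derivI[OF zeta_holomorphic open_zeta_domain] assms by auto
  then have "(zeta has_field_derivative deriv zeta s) (at (cnj (cnj s)))" by simp
  from has_field_derivative_cnj_cnj[OF this]
  have "((cnj \<circ> zeta \<circ> cnj) has_field_derivative cnj (deriv zeta s)) (at (cnj s))" by simp
  then have "(zeta has_field_derivative cnj (deriv zeta s)) (at (cnj s))"
  proof (rule has_field_derivative_transform_within_open[OF _ open_zeta_domain])
    show "cnj s \<in> {s. Re s > 0} - {1}" using assms by (auto simp: complex_eq_iff)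
    fix z :: complex assume z: "z \<in> {s. Re s > 0} - {1}"
    then have "zeta (cnj z) = cnj (zeta z)" by (intro zeta_cnj) auto
    then show "(cnj \<circ> zeta \<circ> cnj) z = zeta z" by simp
  qed
  then show ?thesis by (rule DERIV_imp_deriv)
qed

definition zlog :: "real \<Rightarrow> real \<Rightarrow> real" where "zlog x t = ln (norm (zeta (Complex x t)))"
definition zquot :: "real \<Rightarrow> real \<Rightarrow> complex" where "zquot x t = deriv zeta (Complex x t) / zeta (Complex x t)"

lemma zquot_minus:
  assumes "x > 0" "t \<noteq> 0"
  shows "zquot x (- t) = cnj (zquot x t)"
proof -
  have e: "Complex x (- t) = cnj (Complex x t)" by (simp add: complex_cnj)
  show ?thesis unfolding zquot_def e
    by (subst deriv_zeta_cnj zeta_cnj; use assms in \<open>simp add: complex_eq_iff\<close>)+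
qed

section \<open>Bounds for the logarithm and the logarithmic derivative of zeta\<close>

lemma abs_zlog_le:
  assumes "x > 1"
  shows "\<bar>zlog x t\<bar> \<le> ln (zetaR x)"
proof -
  have nz: "norm (zeta (Complex x t)) > 0" using zeta_nonzero_Re_gt_1[of "Complex x t"] assms by simp
  have "norm (zeta (Complex x t)) \<le> zetaR x" using norm_zeta_le_zetaR[of "Complex x t"] assms by simp
  moreover have "1 / norm (zeta (Complex x t)) \<le> zetaR x" using norm_inverse_zeta_le[of "Complex x t"] assms by simp
  then have "ln (1 / norm (zeta (Complex x t))) \<le> ln (zetaR x)"
    using nz zetaR_ge(2)[OF assms] by (subst ln_le_cancel_iff) auto
  moreover have "ln (norm (zeta (Complex x t))) \<le> ln (zetaR x)" if "norm (zeta (Complex x t)) \<le> zetaR x"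
    using nz that zetaR_ge(2)[OF assms] by (subst ln_le_cancel_iff) auto
  ultimately show ?thesis using nz by (simp add: zlog_def ln_div abs_le_iff)
qed

text \<open>The quadratic Taylor polynomial at \<open>1.1\<close> itself stays below
  \<open>3\<close>; at \<open>1.1/16\<close>, raised to the sixteenth power, it is accurate
  enough.\<close>

lemma ln_3_le: "ln (3::real) \<le> 1.1"
proof -
  have "(3::real) \<le> (1 + 1.1/16 + (1.1/16)^2 / 2) ^ 16" by (simp add: power_divide)
  also have "\<dots> \<le> exp (1.1/16) ^ 16" by (intro power_mono exp_lower_Taylor_quadratic) auto
  also have "\<dots> = exp 1.1" by (simp flip: exp_of_nat_mult)
  finally have "ln (3::real) \<le> ln (exp 1.1)" by (subst ln_le_cancel_iff) auto
  then show ?thesis by simp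
qed

text \<open>The constant is \<open>4 * 1.1\<close>: for \<open>x \<le> 2\<close> the right-hand side
  is then at least \<open>1.1\<close>, an upper bound for \<open>ln 3\<close>, and
  \<open>zetaR x \<le> 3\<close> there.\<close>

lemma abs_zlog_le_powr:
  assumes "x \<ge> 3/2"
  shows "\<bar>zlog x t\<bar> \<le> 4.4 * 2 powr (- x)"
proof (cases "x \<ge> 2")
  case True
  have "\<bar>zlog x t\<bar> \<le> ln (zetaR x)" using abs_zlog_le True by simp
  also have "\<dots> \<le> zetaR x - 1" using zetaR_ge(2)[of x] True by (intro ln_le_minus_one) auto
  also have "\<dots> \<le> 3 * 2 powr (- x)" by (rule zetaR_minus_1_le[OF True])
  finally show ?thesis by (rule order_trans) simp
next
  case False
  have "\<bar>zlog x t\<bar> \<le> ln (zetaR x)" using abs_zlog_le assms by simp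
  also have "\<dots> \<le> ln 3"
  proof (subst ln_le_cancel_iff)
    show "zetaR x > 0" using zetaR_ge(2)[of x] assms by simp
    have "zetaR x \<le> x / (x - 1)" using zetaR_le assms by simp
    also have "\<dots> \<le> 3" using assms by (simp add: field_simps)
    finally show "zetaR x \<le> 3" .
  qed simp
  also note ln_3_le
  also have "1.1 \<le> 4.4 * 2 powr (- (2::real))" by (simp add: powr_minus powr_numeral)
  also have "\<dots> \<le> 4.4 * 2 powr (- x)" using False by (intro mult_left_mono powr_mono) auto
  finally show ?thesis .
qed

text \<open>Cauchy's inequality on a disc of radius \<open>r\<close>. The constant \<open>w\<close>
  does not change the derivative: \<open>w = 1\<close> gives exponential decay far to the right, and
  \<open>w = 0\<close> is used near \<open>3/2\<close>.\<close>

lemma norm_deriv_zeta_le: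
  assumes "0 < r" "r < x" and B: "\<And>z. x - r \<le> Re z \<Longrightarrow> z \<noteq> 1 \<and> norm (zeta z - w) \<le> B"
  shows "norm (deriv zeta (Complex x t)) \<le> B / r"
proof -
  have re: "x - r \<le> Re z" if "norm (Complex x t - z) \<le> r" for z
    using abs_Re_le_cmod[of "Complex x t - z"] that by simp
  have dom: "cball (Complex x t) r \<subseteq> {s. Re s > 0} - {1}"
  proof
    fix z assume "z \<in> cball (Complex x t) r"
    then have "x - r \<le> Re z" by (intro re) (simp add: dist_norm)
    with B[OF this] assms(2) show "z \<in> {s. Re s > 0} - {1}" by simp
  qed
  have "norm ((deriv ^^ 1) (\<lambda>z. zeta z - w) (Complex x t)) \<le> fact 1 * B / r ^ 1"
  proof (rule Cauchy_inequality)
    show "(\<lambda>z. zeta z - w) holomorphic_on ball (Complex x t) r"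
      using holomorphic_on_subset[OF zeta_holomorphic] dom ball_subset_cball
      by (intro holomorphic_intros) blast
    show "continuous_on (cball (Complex x t) r) (\<lambda>z. zeta z - w)"
      using holomorphic_on_imp_continuous_on[OF zeta_holomorphic] continuous_on_subset dom
      by (intro continuous_intros) blast
    show "norm (zeta z - w) \<le> B" if "norm (Complex x t - z) = r" for z
      using B[OF re[of z]] that by simp
  qed (rule assms(1))
  moreover have "deriv (\<lambda>z. zeta z - w) (Complex x t) = deriv zeta (Complex x t)"
  proof (rule DERIV_imp_deriv)
    have "Complex x t \<in> {s. Re s > 0} - {1}" by (rule subsetD[OF dom]) (use assms(1) in simp)
    then have "(zeta has_field_derivative deriv zeta (Complex x t)) (at (Complex x t))"
      by (rule holomorphic_derivI[OF zeta_holomorphic open_zeta_domain])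
    then show "((\<lambda>z. zeta z - w) has_field_derivative deriv zeta (Complex x t)) (at (Complex x t))"
      by (auto intro!: derivative_eq_intros)
  qed
  ultimately show ?thesis by simp
qed

lemma norm_deriv_zeta_le_powr:
  assumes "x \<ge> 3"
  shows "norm (deriv zeta (Complex x t)) \<le> 6 * 2 powr (- x)"
proof -
  have "norm (deriv zeta (Complex x t)) \<le> 3 * 2 powr (- (x - 1)) / 1"
  proof (rule norm_deriv_zeta_le[where w = 1])
    fix z :: complex assume z: "x - 1 \<le> Re z"
    have "norm (zeta z - 1) \<le> zetaR (Re z) - 1" using z assms by (intro norm_zeta_minus_1_le) auto
    also have "\<dots> \<le> 3 * 2 powr (- Re z)" using z assms by (intro zetaR_minus_1_le) auto
    also have "\<dots> \<le> 3 * 2 powr (- (x - 1))" using z by (intro mult_left_mono powr_mono) auto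
    finally show "z \<noteq> 1 \<and> norm (zeta z - 1) \<le> 3 * 2 powr (- (x - 1))" using z assms by auto
  qed (use assms in auto)
  also have "\<dots> = 6 * 2 powr (- x)" by (simp add: powr_diff powr_minus field_simps)
  finally show ?thesis .
qed

lemma norm_zquot_le_powr:
  assumes "x \<ge> 3"
  shows "norm (zquot x t) \<le> 9 * 2 powr (- x)"
proof -
  have "1 / norm (zeta (Complex x t)) \<le> x / (x - 1)"
    using norm_inverse_zeta_le[of "Complex x t"] zetaR_le[of x] assms by simp
  also have "\<dots> \<le> 3 / 2" using assms by (simp add: field_simps)
  finally have "norm (deriv zeta (Complex x t)) * (1 / norm (zeta (Complex x t))) \<le> 6 * 2 powr (- x) * (3/2)"
    using norm_deriv_zeta_le_powr[OF assms] by (intro mult_mono) auto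
  then show ?thesis by (simp add: zquot_def norm_divide)
qed

text \<open>On the disc of radius \<open>3/10\<close> one has \<open>Re z \<ge> 6/5\<close> and
  hence a bound \<open>6\<close> for zeta. Cauchy's inequality gives \<open>20\<close>, and the
  reciprocal of zeta costs a factor \<open>3\<close>.\<close>

lemma norm_zquot_three_halves: "norm (zquot (3/2) t) \<le> 60"
proof -
  have "1 / norm (zeta (Complex (3/2) t)) \<le> 3"
    using norm_inverse_zeta_le[of "Complex (3/2) t"] zetaR_le[of "3/2"] by simp
  moreover have "norm (deriv zeta (Complex (3/2) t)) \<le> 20"
  proof -
    have "norm (deriv zeta (Complex (3/2) t)) \<le> 6 / (3/10)"
    proof (rule norm_deriv_zeta_le[where w = 0])
      fix z :: complex assume z: "3/2 - 3/10 \<le> Re z"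
      have "norm (zeta z) \<le> Re z / (Re z - 1)" using z by (intro norm_zeta_le) auto
      also have "\<dots> \<le> 6" using z by (simp add: divide_le_eq)
      finally show "z \<noteq> 1 \<and> norm (zeta z - 0) \<le> 6" using z by auto
    qed auto
    then show ?thesis by simp
  qed
  ultimately have "norm (deriv zeta (Complex (3/2) t)) * (1 / norm (zeta (Complex (3/2) t))) \<le> 20 * 3"
    by (intro mult_mono) auto
  then show ?thesis by (simp add: zquot_def norm_divide)
qed

lemma zlog_le_sqrt:
  assumes "\<bar>t\<bar> \<ge> 990" "\<bar>t\<bar> \<le> M" "1/2 \<le> x" "x \<le> 3/2"
  shows "zlog x t \<le> ln 2 + ln M / 2"
proof (cases "zeta (Complex x t) = 0")
  case True
  \<comment> \<open>At a zero \<open>zlog\<close> has the value \<open>ln 0 = 0\<close>, so the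
    bound must be nonnegative.\<close>
  have "0 \<le> ln 2 + ln M / 2" using assms by simp
  then show ?thesis using True by (simp add: zlog_def)
next
  case False
  have "zlog x t \<le> ln (2 * sqrt \<bar>t\<bar>)"
    unfolding zlog_def using norm_zeta_le_sqrt[of t x] assms False by (subst ln_le_cancel_iff) auto
  also have "\<dots> \<le> ln (2 * sqrt M)" using assms by (subst ln_le_cancel_iff) auto
  also have "\<dots> = ln 2 + ln M / 2" using assms by (simp add: ln_mult ln_sqrt)
  finally show ?thesis .
qed

lemma zlog_le_powr:
  assumes "\<bar>t\<bar> \<ge> 990" "\<bar>t\<bar> \<le> M" "1/2 \<le> x" "x < 1"
  shows "zlog x t \<le> (1 - x) * ln M + ln (1 / (1 - x))"
proof (cases "zeta (Complex x t) = 0")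
  case True
  have "0 \<le> (1 - x) * ln M + ln (1 / (1 - x))" using assms by (intro add_nonneg_nonneg mult_nonneg_nonneg ln_ge_zero) auto
  then show ?thesis using True by (simp add: zlog_def)
next
  case False
  have "zlog x t \<le> ln (\<bar>t\<bar> powr (1 - x) / (1 - x))"
    unfolding zlog_def using norm_zeta_le_powr[of t x] assms False by (subst ln_le_cancel_iff) auto
  also have "\<dots> \<le> ln (M powr (1 - x) * (1 / (1 - x)))"
    using assms by (subst ln_le_cancel_iff) (auto intro!: divide_right_mono powr_mono2)
  also have "\<dots> = (1 - x) * ln M + ln (1 / (1 - x))" using assms by (subst ln_mult) (auto simp: ln_powr)
  finally show ?thesis .
qed

text \<open>\<open>1.54\<close> is an upper bound for \<open>pi/2 * (3/2 - r)\<close> when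
  \<open>r \<ge> 0.52\<close>, the largest argument at which the hyperbolic weight is
  evaluated.\<close>

lemma exp_154_le: "exp (1.54::real) \<le> 4.74"
proof -
  have "exp (1.54::real) = exp 1 * exp 0.054 ^ 10" by (simp flip: exp_of_nat_mult exp_add)
  also have "\<dots> \<le> 2.72 * (1 + 0.054 + 0.054^2) ^ 10"
    using e_less_272 by (intro mult_mono power_mono exp_bound) auto
  also have "\<dots> \<le> 4.74" by (simp add: power_divide)
  finally show ?thesis .
qed

lemma cosh_le:
  assumes "0 \<le> z" "z \<le> (1.54::real)"
  shows "cosh z \<le> 2.6"
proof -
  have "cosh z \<le> cosh 1.54" using assms by (subst cosh_real_nonneg_le_iff) auto
  also have "\<dots> \<le> (4.74 + 0.4) / 2"
  proof -
    have "exp (-1.54::real) \<le> 1/2.7"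
      using exp_lower_Taylor_quadratic[of "1.54::real"] by (simp add: exp_minus field_simps power2_eq_square)
    then show ?thesis unfolding cosh_def using exp_154_le by simp
  qed
  finally show ?thesis by simp
qed

text \<open>By convexity the graph lies below its chord from \<open>0\<close> to
  \<open>1.54\<close>, whose slope is less than \<open>1.5\<close>.\<close>

lemma sinh_le:
  assumes "0 \<le> z" "z \<le> (1.54::real)"
  shows "sinh z \<le> 1.5 * z"
proof -
  have "convex_on {0..1.54} (sinh :: real \<Rightarrow> real)"
    by (rule convex_on_realI[of _ _ cosh]) (auto intro!: derivative_eq_intros simp: cosh_real_nonneg_le_iff)
  from convex_onD[OF this, of "z / 1.54" 0 "1.54"] assms
  have "sinh z \<le> z / 1.54 * sinh 1.54" by simp
  also have "z / 1.54 * sinh 1.54 \<le> z / 1.54 * (4.74 / 2 - 0.1)"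
  proof (intro mult_left_mono)
    have "exp (-1.54::real) \<ge> 1/4.74" using exp_154_le by (simp add: exp_minus field_simps)
    then show "sinh (1.54::real) \<le> 4.74 / 2 - 0.1" unfolding sinh_def using exp_154_le by simp
  qed (use assms in auto)
  also have "z / 1.54 * (4.74 / 2 - 0.1) \<le> 1.5 * z" using assms by simp
  finally show ?thesis .
qed

lemma zeta_path_cont:
  assumes "continuous_on S \<gamma>" "\<And>u. u \<in> S \<Longrightarrow> Re (\<gamma> u) > 0 \<and> \<gamma> u \<noteq> 1 \<and> zeta (\<gamma> u) \<noteq> 0"
  shows "continuous_on S (\<lambda>u. ln (norm (zeta (\<gamma> u))))" "continuous_on S (\<lambda>u. deriv zeta (\<gamma> u) / zeta (\<gamma> u))"
proof -
  have im: "\<gamma> ` S \<subseteq> {s. Re s > 0} - {1}" using assms by auto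
  note c = continuous_on_compose2[OF holomorphic_on_imp_continuous_on assms(1) im]
  show "continuous_on S (\<lambda>u. ln (norm (zeta (\<gamma> u))))"
    by (intro continuous_intros c[OF zeta_holomorphic]) (use assms in auto)
  show "continuous_on S (\<lambda>u. deriv zeta (\<gamma> u) / zeta (\<gamma> u))"
    by (intro continuous_intros c[OF zeta_holomorphic] c[OF holomorphic_deriv[OF zeta_holomorphic open_zeta_domain]])
      (use assms in auto)
qed

lemma zeta_segment_cont:
  assumes "\<And>x. x \<in> {a..b} \<Longrightarrow> x > 0 \<and> zeta (Complex x t) \<noteq> 0" "t \<noteq> 0"
  shows "continuous_on {a..b} (\<lambda>x. zlog x t)" "continuous_on {a..b} (\<lambda>x. zquot x t)"
  unfolding zlog_def zquot_def
  by (intro zeta_path_cont continuous_intros; use assms in \<open>auto simp: complex_eq_iff\<close>)+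

lemma zeta_vsegment_cont:
  assumes "\<And>t. t \<in> {a..b} \<Longrightarrow> t \<noteq> 0 \<and> zeta (Complex x t) \<noteq> 0" "x > 0"
  shows "continuous_on {a..b} (\<lambda>t. zlog x t)" "continuous_on {a..b} (\<lambda>t. zquot x t)"
  unfolding zlog_def zquot_def
  by (intro zeta_path_cont continuous_intros; use assms in \<open>auto simp: complex_eq_iff\<close>)+

text \<open>To the right of \<open>3/2\<close> the absolute value of the logarithm is integrable
  against the linear weight, so there the signs of the coefficients are irrelevant. \<open>F\<close>
  is the primitive of \<open>x * 2 powr (- x)\<close> that vanishes at infinity.\<close>

lemma zlog_tail:
  assumes "X \<ge> 3/2" "t \<noteq> 0"
  shows "integral {3/2..X} (\<lambda>x. x * \<bar>zlog x t\<bar>) \<le> 7.1"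
proof -
  define F where "F = (\<lambda>x::real. - (x / ln 2 + 1 / (ln 2)^2) * 2 powr (- x))"
  have l2: "ln (2::real) > 0" by simp
  have I: "((\<lambda>x. 4.4 * (x * 2 powr (- x))) has_integral (4.4 * (F X - F (3/2)))) {3/2..X}"
  proof (rule has_integral_mult_right, rule fundamental_theorem_of_calculus[OF assms(1)])
    fix x :: real
    have "(F has_real_derivative (- (1 / ln 2) * 2 powr (- x) + - (x / ln 2 + 1 / (ln 2)^2) * (2 powr (- x) * (- ln 2)))) (at x)"
      unfolding F_def by (auto intro!: derivative_eq_intros)
    also have "(- (1 / ln 2) * 2 powr (- x) + - (x / ln 2 + 1 / (ln 2)^2) * (2 powr (- x) * (- ln 2))) = x * 2 powr (- x)"
      using l2 by (simp add: field_simps power2_eq_square)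
    finally show "(F has_vector_derivative x * 2 powr (- x)) (at x within {3/2..X})"
      by (simp add: has_real_derivative_iff_has_vector_derivative has_vector_derivative_at_within)
  qed
  have nz: "zeta (Complex x t) \<noteq> 0" if "x \<ge> 3/2" for x using zeta_nonzero_Re_gt_1[of "Complex x t"] that by simp
  have "integral {3/2..X} (\<lambda>x. x * \<bar>zlog x t\<bar>) \<le> 4.4 * (F X - F (3/2))"
  proof (rule has_integral_le[OF integrable_integral I])
    show "(\<lambda>x. x * \<bar>zlog x t\<bar>) integrable_on {3/2..X}"
      by (intro integrable_continuous_real continuous_intros zeta_segment_cont) (use nz assms in auto)
    fix x assume "x \<in> {3/2..X}"
    then have "x \<ge> 3/2" by auto
    then show "x * \<bar>zlog x t\<bar> \<le> 4.4 * (x * 2 powr (- x))"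
      using mult_left_mono[OF abs_zlog_le_powr[of x t], of x] by simp
  qed
  also have "\<dots> \<le> 4.4 * (- F (3/2))"
  proof -
    have "(X / ln 2 + 1 / (ln 2)^2) * 2 powr (- X) \<ge> 0" using assms l2 by (intro mult_nonneg_nonneg add_nonneg_nonneg) auto
    then have "F X \<le> 0" unfolding F_def mult_minus_left by linarith
    then show ?thesis by simp
  qed
  also have "- F (3/2) \<le> (3/2 * 1.5 + 1.5^2) * 0.3536"
  proof -
    have "1 / ln (2::real) \<le> 1.5" using ln2_ge_two_thirds by (simp add: field_simps)
    then have a: "3/2 / ln 2 + 1 / (ln (2::real))^2 \<le> 3/2 * 1.5 + 1.5^2"
      using power_mono[of "1 / ln (2::real)" "1.5" 2] by (simp add: power_divide)
    have "(2::real) powr (- (3/2)) = 1 / (2 * sqrt 2)"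
      by (simp add: powr_minus powr_half_sqrt powr_add[of 2 1 "1/2", simplified] inverse_eq_divide)
    also have "\<dots> \<le> 0.3536"
    proof -
      \<comment> \<open>A rational just below the root, sharp enough for
        \<open>1 / (2 * sqrt 2) \<le> 0.3536\<close>.\<close>
      have "1.4143 / 1.00007 \<le> sqrt (2::real)" by (rule real_le_rsqrt) (simp add: power_divide)
      then show ?thesis by (simp add: field_simps)
    qed
    finally have b: "(2::real) powr (- (3/2)) \<le> 0.3536" .
    have "- F (3/2) = (3/2 / ln 2 + 1 / (ln 2)^2) * 2 powr (- (3/2))"
      by (simp only: F_def mult_minus_left minus_minus)
    also have "\<dots> \<le> (3/2 * 1.5 + 1.5^2) * 0.3536" by (rule mult_mono[OF a b]) auto
    finally show ?thesis .
  qed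
  finally show ?thesis by (simp add: power2_eq_square)
qed

section \<open>Horizontal edges\<close>

text \<open>This is \<open>green_hor\<close> at height \<open>c\<close> for the weight
  \<open>Re z - r\<close>. The derivative of \<open>z - r\<close> is real, so no logarithm
  appears.\<close>

definition edge_int :: "real \<Rightarrow> real \<Rightarrow> real \<Rightarrow> real" where
  "edge_int r X c = integral {r..X} (\<lambda>x. - (x - r) * Im (zquot x c))"

text \<open>A polynomial whose real part is the product of \<open>x - r\<close> and
  \<open>1 - (t - c)/2\<close>; a product of a function linear in \<open>x\<close> and one linear in
  \<open>t\<close> is harmonic. The coefficient \<open>\<i> / 4\<close> puts its zero at
  \<open>t = c + 2\<close>.\<close>

definition ramp :: "real \<Rightarrow> real \<Rightarrow> complex \<Rightarrow> complex" where
  "ramp r c z = (z - Complex r c) + \<i> / 4 * (z - Complex r c)^2"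
definition ramp' :: "real \<Rightarrow> real \<Rightarrow> complex \<Rightarrow> complex" where
  "ramp' r c z = 1 + \<i> / 2 * (z - Complex r c)"

lemma ramp_deriv: "(ramp r c has_field_derivative ramp' r c z) (at z)"
  unfolding ramp_def[abs_def] ramp'_def by (auto intro!: derivative_eq_intros)

lemma ramp_simps:
  "Re (ramp r c (Complex x t)) = (x - r) * (1 - (t - c) / 2)"
  "Re (ramp' r c (Complex x t)) = 1 - (t - c) / 2"
  "Im (ramp' r c (Complex x t)) = (x - r) / 2"
  by (simp_all add: ramp_def ramp'_def power2_eq_square field_simps)

text \<open>This is \<open>- \<i> * (2 / pi^2) * cosh\<close>, and its real part vanishes on both
  horizontal sides of the strip. The factor \<open>2 / pi^2\<close> is the least for which, by
  \<open>sinh z \<ge> z\<close>, its coefficient of \<open>ln \<bar>\<zeta>\<bar>\<close> there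
  dominates the \<open>(x - r)/2\<close> coming from \<open>ramp\<close>.\<close>

definition bump :: "real \<Rightarrow> real \<Rightarrow> complex \<Rightarrow> complex" where
  "bump r c z = - \<i> * (of_real (2 / pi^2) * ((exp (of_real (pi/2) * (z - Complex r c)) + exp (- (of_real (pi/2) * (z - Complex r c)))) / 2))"
definition bump' :: "real \<Rightarrow> real \<Rightarrow> complex \<Rightarrow> complex" where
  "bump' r c z = - \<i> * (of_real (1 / pi) * ((exp (of_real (pi/2) * (z - Complex r c)) - exp (- (of_real (pi/2) * (z - Complex r c)))) / 2))"

lemma bump_deriv: "(bump r c has_field_derivative bump' r c z) (at z)"
proof -
  have "((\<lambda>z. - \<i> * (k * ((exp (p * (z - w)) + exp (- (p * (z - w)))) / 2))) has_field_derivative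
      - \<i> * (k * ((exp (p * (z - w)) * p - exp (- (p * (z - w))) * p) / 2))) (at z)" for k p w :: complex
    by (auto intro!: derivative_eq_intros)
  then have "(bump r c has_field_derivative - \<i> * (of_real (2 / pi^2) * ((exp (of_real (pi/2) * (z - Complex r c)) * of_real (pi/2)
     - exp (- (of_real (pi/2) * (z - Complex r c))) * of_real (pi/2)) / 2))) (at z)"
    unfolding bump_def[abs_def] .
  also have "- \<i> * (of_real (2 / pi^2) * ((exp (of_real (pi/2) * (z - Complex r c)) * of_real (pi/2)
     - exp (- (of_real (pi/2) * (z - Complex r c))) * of_real (pi/2)) / 2)) = bump' r c z"
  proof -
    have g: "- \<i> * (k * ((E * p - F * p) / 2)) = - \<i> * (k * p * ((E - F) / 2))" for k p E F :: complex
      by (simp add: algebra_simps)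
    have "of_real (2 / pi^2) * of_real (pi/2) = (of_real (1 / pi) :: complex)"
      unfolding of_real_mult[symmetric] by (simp add: power2_eq_square)
    then show ?thesis unfolding g bump'_def by (simp only:)
  qed
  finally show ?thesis .
qed

lemma bump_simps:
  "Re (bump r c (Complex x t)) = 2 / pi^2 * (sinh (pi/2 * (x - r)) * sin (pi/2 * (t - c)))"
  "Re (bump' r c (Complex x t)) = 1 / pi * (cosh (pi/2 * (x - r)) * sin (pi/2 * (t - c)))"
  "Im (bump' r c (Complex x t)) = - (1 / pi * (sinh (pi/2 * (x - r)) * cos (pi/2 * (t - c))))"
proof -
  have e: "of_real (pi/2) * (Complex x t - Complex r c) = Complex (pi/2 * (x - r)) (pi/2 * (t - c))"
    by (simp add: complex_eq_iff)
  have g: "Re (- \<i> * (of_real k * ((exp (Complex a b) + exp (- Complex a b)) / 2))) = k * (sinh a * sin b)"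
    "Re (- \<i> * (of_real k * ((exp (Complex a b) - exp (- Complex a b)) / 2))) = k * (cosh a * sin b)"
    "Im (- \<i> * (of_real k * ((exp (Complex a b) - exp (- Complex a b)) / 2))) = - (k * (sinh a * cos b))" for k a b
    by (simp_all add: Re_exp Im_exp sinh_def cosh_def field_simps)
  show "Re (bump r c (Complex x t)) = 2 / pi^2 * (sinh (pi/2 * (x - r)) * sin (pi/2 * (t - c)))"
    "Re (bump' r c (Complex x t)) = 1 / pi * (cosh (pi/2 * (x - r)) * sin (pi/2 * (t - c)))"
    "Im (bump' r c (Complex x t)) = - (1 / pi * (sinh (pi/2 * (x - r)) * cos (pi/2 * (t - c))))"
    unfolding bump_def bump'_def e g by (rule refl)+
qed

lemma sinh_ge_self:
  assumes "0 \<le> (z::real)"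
  shows "z \<le> sinh z"
proof -
  have "sinh 0 - 0 \<le> sinh z - z"
    by (rule DERIV_nonneg_imp_nondecreasing[OF assms])
      (auto intro!: exI derivative_eq_intros simp: cosh_real_ge_1)
  then show ?thesis by simp
qed

section \<open>Integrals of the weights\<close>

lemma integral_add_real:
  fixes f g :: "real \<Rightarrow> real"
  assumes "continuous_on {a..b} f" "continuous_on {a..b} g"
  shows "integral {a..b} (\<lambda>x. f x + g x) = integral {a..b} f + integral {a..b} g"
  by (intro Henstock_Kurzweil_Integration.integral_add integrable_continuous_real assms)

lemma integral_diff_real:
  fixes f g :: "real \<Rightarrow> real"
  assumes "continuous_on {a..b} f" "continuous_on {a..b} g"
  shows "integral {a..b} (\<lambda>x. f x - g x) = integral {a..b} f - integral {a..b} g"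
  by (intro Henstock_Kurzweil_Integration.integral_diff integrable_continuous_real assms)

lemma integral_mono_real:
  fixes f g :: "real \<Rightarrow> real"
  assumes "continuous_on {a..b} f" "continuous_on {a..b} g" "\<And>x. x \<in> {a..b} \<Longrightarrow> f x \<le> g x"
  shows "integral {a..b} f \<le> integral {a..b} g"
  by (intro integral_le integrable_continuous_real assms)

lemma integral_linear_real: "a \<le> b \<Longrightarrow> integral {a..b} (\<lambda>x. C * (x - a)) = C * (b - a)^2 / 2" for a b C :: real
proof -
  assume "a \<le> b"
  then have "((\<lambda>x. C * (x - a)) has_integral (C * (b - a)^2 / 2 - C * (a - a)^2 / 2)) {a..b}"
    by (intro fundamental_theorem_of_calculus)
      (auto intro!: derivative_eq_intros simp: has_real_derivative_iff_has_vector_derivative[symmetric])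
  then show ?thesis by (rule trans[OF integral_unique]) simp
qed

lemma integral_sin_half: "integral {c..c+2} (\<lambda>t. sin (pi/2 * (t - c))) = 4 / pi"
proof -
  have "((\<lambda>t. sin (pi/2 * (t - c))) has_integral (- (2/pi) * cos (pi/2 * (c + 2 - c)) - (- (2/pi) * cos (pi/2 * (c - c))))) {c..c+2}"
    by (intro fundamental_theorem_of_calculus)
      (auto intro!: derivative_eq_intros simp: has_real_derivative_iff_has_vector_derivative[symmetric])
  then show ?thesis by (simp add: integral_unique)
qed

lemma integral_ramp: "integral {c..c+2} (\<lambda>t. 1 - (t - c) / 2) = (1::real)"
proof -
  have "((\<lambda>t. 1 - (t - c) / 2) has_integral ((c + 2) - (c + 2 - c)^2 / 4 - (c - (c - c)^2 / 4))) {c..c+2}"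
    by (intro fundamental_theorem_of_calculus)
      (auto intro!: derivative_eq_intros simp: has_real_derivative_iff_has_vector_derivative[symmetric])
  then show ?thesis by (simp add: integral_unique)
qed

text \<open>Applied above the top side, and below the bottom side after reflection in the real axis.
  In the second case \<open>c\<close> is negative, so the height is controlled through
  \<open>\<bar>t\<bar>\<close>.\<close>

locale zeta_strip =
  fixes r c X M :: real
  assumes r: "0.52 \<le> r" "r \<le> 0.9723" and X: "X \<ge> 12" and X2: "X * 2 powr (- X) \<le> 1/50"
    and c: "\<And>t. t \<in> {c..c+2} \<Longrightarrow> \<bar>t\<bar> \<ge> 990 \<and> \<bar>t\<bar> \<le> M"
    and nz_hor: "\<And>x t. x \<in> {r..X} \<Longrightarrow> t \<in> {c, c + 2} \<Longrightarrow> zeta (Complex x t) \<noteq> 0"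
    and nz_ver: "\<And>t. t \<in> {c..c+2} \<Longrightarrow> zeta (Complex r t) \<noteq> 0"
begin

lemma sgn_c: "0 < c \<or> c + 2 < 0"
proof (rule ccontr)
  assume "\<not> ?thesis"
  then have "0 \<in> {c..c+2}" by auto
  from c[OF this] show False by simp
qed

lemma nz_ver': "t \<in> {c..c+2} \<Longrightarrow> x \<in> {r} \<union> {3/2..} \<Longrightarrow> zeta (Complex x t) \<noteq> 0"
  using nz_ver zeta_nonzero_Re_gt_1[of "Complex x t"] by auto

lemma M: "M \<ge> 990" using c[of c] by auto

lemma cont_hor:
  assumes "t \<in> {c, c+2}" "r \<le> a" "b \<le> X"
  shows "continuous_on {a..b} (\<lambda>x. zlog x t)" "continuous_on {a..b} (\<lambda>x. zquot x t)"
  using assms r sgn_c by (intro zeta_segment_cont; use nz_hor in force)+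

lemma cont_ver:
  assumes "x \<in> {r} \<union> {3/2..}"
  shows "continuous_on {c..c+2} (\<lambda>t. zlog x t)" "continuous_on {c..c+2} (\<lambda>t. zquot x t)"
  using assms r sgn_c by (intro zeta_vsegment_cont; use nz_ver' in force)+

text \<open>The weight vanishes on the left and far sides, so these keep only logarithms, and the
  zeros contribute with the favourable sign. The integral of \<open>zlog x c\<close> appears
  negatively and would require a lower bound for zeta; \<open>bump_ineq\<close> repairs
  this.\<close>

lemma ramp_ineq:
  "edge_int r X c \<le> integral {r..X} (\<lambda>x. (x - r) / 2 * zlog x (c + 2)) - integral {r..X} (\<lambda>x. (x - r) / 2 * zlog x c)
     + integral {c..c+2} (\<lambda>t. (1 - (t - c) / 2) * zlog r t) + green_ver zeta (ramp r c) (ramp' r c) c (c+2) X"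
proof -
  have "green_hor zeta (ramp r c) (ramp' r c) r X (c+2) - green_hor zeta (ramp r c) (ramp' r c) r X c
      + green_ver zeta (ramp r c) (ramp' r c) c (c+2) X - green_ver zeta (ramp r c) (ramp' r c) c (c+2) r
    = 2 * pi * (\<Sum>z | z \<in> box (Complex r c) (Complex X (c+2)) \<and> zeta z = 0. Re (ramp r c z) * real (zero_mult zeta z))"
  proof (rule zeta_green(1)[OF _ _ _ sgn_c ramp_deriv])
    show "continuous_on UNIV (ramp' r c)" unfolding ramp'_def[abs_def] by (intro continuous_intros)
    show "zeta (Complex x t) \<noteq> 0" if "x \<in> {r, X}" "t \<in> {c..c+2}" for x t
      using nz_ver'[of t x] that X by auto
  qed (use r X nz_hor in auto)
  moreover have "(\<Sum>z | z \<in> box (Complex r c) (Complex X (c+2)) \<and> zeta z = 0. Re (ramp r c z) * real (zero_mult zeta z)) \<ge> 0"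
  proof (intro sum_nonneg mult_nonneg_nonneg)
    fix z assume "z \<in> {z. z \<in> box (Complex r c) (Complex X (c+2)) \<and> zeta z = 0}"
    then have "r < Re z" "Im z < c + 2" by (auto simp: in_box_complex_iff)
    then show "0 \<le> Re (ramp r c z)" using ramp_simps(1)[of r c "Re z" "Im z"] by simp
  qed auto
  moreover have "green_hor zeta (ramp r c) (ramp' r c) r X (c+2) = integral {r..X} (\<lambda>x. (x - r) / 2 * zlog x (c + 2))"
    unfolding green_hor_def ramp_simps zlog_def by simp
  moreover have "green_hor zeta (ramp r c) (ramp' r c) r X c = edge_int r X c + integral {r..X} (\<lambda>x. (x - r) / 2 * zlog x c)"
  proof -
    have "green_hor zeta (ramp r c) (ramp' r c) r X c =
        integral {r..X} (\<lambda>x. - (x - r) * Im (zquot x c) + (x - r) / 2 * zlog x c)"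
      unfolding green_hor_def ramp_simps zlog_def zquot_def by simp
    also have "\<dots> = edge_int r X c + integral {r..X} (\<lambda>x. (x - r) / 2 * zlog x c)"
      unfolding edge_int_def by (intro integral_add_real continuous_intros cont_hor) auto
    finally show ?thesis .
  qed
  moreover have "green_ver zeta (ramp r c) (ramp' r c) c (c+2) r = - integral {c..c+2} (\<lambda>t. (1 - (t - c) / 2) * zlog r t)"
    unfolding green_ver_def ramp_simps zlog_def by simp
  ultimately show ?thesis using pi_gt_zero by (smt (verit) mult_nonneg_nonneg)
qed

text \<open>The rectangle stops at \<open>3/2\<close> because \<open>sinh (pi/2 * (x - r))\<close>
  grows faster than \<open>ln \<bar>\<zeta>\<bar>\<close>, of order \<open>2 powr (- x)\<close>,
  decays. Both horizontal sides lose the logarithmic derivative and get the same positive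
  coefficient.\<close>

lemma bump_ineq:
  "0 \<le> integral {r..3/2} (\<lambda>x. 1 / pi * sinh (pi/2 * (x - r)) * zlog x (c + 2)) + integral {r..3/2} (\<lambda>x. 1 / pi * sinh (pi/2 * (x - r)) * zlog x c)
     + integral {c..c+2} (\<lambda>t. 1 / pi * sin (pi/2 * (t - c)) * zlog r t) + green_ver zeta (bump r c) (bump' r c) c (c+2) (3/2)"
proof -
  have "green_hor zeta (bump r c) (bump' r c) r (3/2) (c+2) - green_hor zeta (bump r c) (bump' r c) r (3/2) c
      + green_ver zeta (bump r c) (bump' r c) c (c+2) (3/2) - green_ver zeta (bump r c) (bump' r c) c (c+2) r
    = 2 * pi * (\<Sum>z | z \<in> box (Complex r c) (Complex (3/2) (c+2)) \<and> zeta z = 0. Re (bump r c z) * real (zero_mult zeta z))"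
  proof (rule zeta_green(1)[OF _ _ _ sgn_c bump_deriv])
    show "continuous_on UNIV (bump' r c)" unfolding bump'_def[abs_def] by (intro continuous_intros) auto
    show "zeta (Complex x t) \<noteq> 0" if "x \<in> {r, 3/2}" "t \<in> {c..c+2}" for x t
      using nz_ver'[of t x] that by auto
  qed (use r X nz_hor in auto)
  moreover have "(\<Sum>z | z \<in> box (Complex r c) (Complex (3/2) (c+2)) \<and> zeta z = 0. Re (bump r c z) * real (zero_mult zeta z)) \<ge> 0"
  proof (intro sum_nonneg mult_nonneg_nonneg)
    fix z assume "z \<in> {z. z \<in> box (Complex r c) (Complex (3/2) (c+2)) \<and> zeta z = 0}"
    then have z: "r < Re z" "c < Im z" "Im z < c + 2" by (auto simp: in_box_complex_iff)
    have "pi/2 * (Im z - c) \<le> pi/2 * 2" using z by (intro mult_left_mono) auto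
    then have "0 \<le> sin (pi/2 * (Im z - c))" using z by (intro sin_ge_zero) auto
    then show "0 \<le> Re (bump r c z)" using bump_simps(1)[of r c "Re z" "Im z"] z by simp
  qed auto
  moreover have "green_hor zeta (bump r c) (bump' r c) r (3/2) (c+2) = integral {r..3/2} (\<lambda>x. 1 / pi * sinh (pi/2 * (x - r)) * zlog x (c + 2))"
    unfolding green_hor_def bump_simps zlog_def by simp
  moreover have "green_hor zeta (bump r c) (bump' r c) r (3/2) c = - integral {r..3/2} (\<lambda>x. 1 / pi * sinh (pi/2 * (x - r)) * zlog x c)"
    unfolding green_hor_def bump_simps zlog_def by simp
  moreover have "green_ver zeta (bump r c) (bump' r c) c (c+2) r = - integral {c..c+2} (\<lambda>t. 1 / pi * sin (pi/2 * (t - c)) * zlog r t)"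
    unfolding green_ver_def bump_simps zlog_def by simp
  ultimately show ?thesis using pi_gt_zero by (smt (verit) mult_nonneg_nonneg)
qed

text \<open>\<open>L\<close> bounds \<open>zlog\<close> on the horizontal sides up to
  \<open>3/2\<close>; \<open>B\<close> bounds it on the left side \<open>Re z = r\<close>.\<close>

definition "L = ln 2 + ln M / 2"
definition "B = (1 - r) * ln M + ln (1 / (1 - r))"

lemma L: "L \<ge> 0" and B: "B \<ge> 0"
  using M r unfolding L_def B_def by (auto intro!: add_nonneg_nonneg mult_nonneg_nonneg ln_ge_zero)

lemma sinh_weight:
  assumes "x \<in> {r..3/2}"
  shows "1 / pi * sinh (pi/2 * (x - r)) \<le> 3/4 * (x - r)" "(x - r) / 2 \<le> 1 / pi * sinh (pi/2 * (x - r))"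
proof -
  have z: "0 \<le> pi/2 * (x - r)" using assms by auto
  have "pi/2 * (x - r) \<le> 3.1416/2 * 0.98" using assms r pi_approx by (intro mult_mono) auto
  then have "sinh (pi/2 * (x - r)) \<le> 1.5 * (pi/2 * (x - r))" by (intro sinh_le z) simp
  then have "1 / pi * sinh (pi/2 * (x - r)) \<le> 1 / pi * (1.5 * (pi/2 * (x - r)))" by (intro mult_left_mono) auto
  then show "1 / pi * sinh (pi/2 * (x - r)) \<le> 3/4 * (x - r)" by simp
  have "1 / pi * (pi/2 * (x - r)) \<le> 1 / pi * sinh (pi/2 * (x - r))"
    using sinh_ge_self[OF z] by (intro mult_left_mono) auto
  then show "(x - r) / 2 \<le> 1 / pi * sinh (pi/2 * (x - r))" by simp
qed

text \<open>After adding the two identities both coefficients are nonnegative, by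
  \<open>sinh z \<ge> z\<close>, so upper bounds for \<open>zlog\<close> suffice. They are at most
  \<open>5/4 (x - r)\<close> on the far side and \<open>1/4 (x - r)\<close> on the near
  side.\<close>

lemma hor_part:
  "integral {r..3/2} (\<lambda>x. (1 / pi * sinh (pi/2 * (x - r)) + (x - r) / 2) * zlog x (c + 2)) +
   integral {r..3/2} (\<lambda>x. (1 / pi * sinh (pi/2 * (x - r)) - (x - r) / 2) * zlog x c) \<le> 3/4 * (3/2 - r)^2 * L"
proof -
  have zl: "zlog x t \<le> L" if "x \<in> {r..3/2}" "t \<in> {c, c+2}" for x t
    unfolding L_def by (rule zlog_le_sqrt) (use c[of t] that r in auto)
  have "integral {r..3/2} (\<lambda>x. (1 / pi * sinh (pi/2 * (x - r)) + (x - r) / 2) * zlog x (c + 2)) \<le>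
     integral {r..3/2} (\<lambda>x. (5/4 * L) * (x - r))"
  proof (rule integral_mono_real)
    fix x assume x: "x \<in> {r..3/2}"
    have "(1 / pi * sinh (pi/2 * (x - r)) + (x - r) / 2) * zlog x (c + 2) \<le> (1 / pi * sinh (pi/2 * (x - r)) + (x - r) / 2) * L"
      using zl[OF x] sinh_weight[OF x] x by (intro mult_left_mono) auto
    also have "\<dots> \<le> (5/4 * (x - r)) * L" by (intro mult_right_mono L) (use sinh_weight(1)[OF x] in linarith)
    finally show "(1 / pi * sinh (pi/2 * (x - r)) + (x - r) / 2) * zlog x (c + 2) \<le> (5/4 * L) * (x - r)" by (simp add: mult_ac)
  qed (use X in \<open>auto intro!: continuous_intros cont_hor\<close>)
  moreover have "integral {r..3/2} (\<lambda>x. (1 / pi * sinh (pi/2 * (x - r)) - (x - r) / 2) * zlog x c) \<le>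
     integral {r..3/2} (\<lambda>x. (1/4 * L) * (x - r))"
  proof (rule integral_mono_real)
    fix x assume x: "x \<in> {r..3/2}"
    have "(1 / pi * sinh (pi/2 * (x - r)) - (x - r) / 2) * zlog x c \<le> (1 / pi * sinh (pi/2 * (x - r)) - (x - r) / 2) * L"
      using zl[OF x] sinh_weight[OF x] x by (intro mult_left_mono) auto
    also have "\<dots> \<le> (1/4 * (x - r)) * L" by (intro mult_right_mono L) (use sinh_weight(1)[OF x] in linarith)
    finally show "(1 / pi * sinh (pi/2 * (x - r)) - (x - r) / 2) * zlog x c \<le> (1/4 * L) * (x - r)" by (simp add: mult_ac)
  qed (use X in \<open>auto intro!: continuous_intros cont_hor\<close>)
  moreover have "integral {r..3/2} (\<lambda>x. (5/4 * L) * (x - r)) = (5/4 * L) * (3/2 - r)^2 / 2"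
    "integral {r..3/2} (\<lambda>x. (1/4 * L) * (x - r)) = (1/4 * L) * (3/2 - r)^2 / 2"
    by (rule integral_linear_real, use r in simp)+
  ultimately show ?thesis by (simp add: algebra_simps)
qed

text \<open>The two weights on the left side have integrals \<open>1\<close> and
  \<open>4 / pi^2\<close>, together below \<open>1.41\<close>.\<close>

lemma ver_part:
  "integral {c..c+2} (\<lambda>t. (1 - (t - c) / 2) * zlog r t) + integral {c..c+2} (\<lambda>t. 1 / pi * sin (pi/2 * (t - c)) * zlog r t)
     \<le> 1.41 * B"
proof -
  have zl: "zlog r t \<le> B" if "t \<in> {c..c+2}" for t
    unfolding B_def by (rule zlog_le_powr) (use c[of t] that r in auto)
  have s: "0 \<le> sin (pi/2 * (t - c))" if "t \<in> {c..c+2}" for t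
  proof -
    have "pi/2 * (t - c) \<le> pi/2 * 2" using that by (intro mult_left_mono) auto
    then show ?thesis using that by (intro sin_ge_zero) auto
  qed
  have "integral {c..c+2} (\<lambda>t. (1 - (t - c) / 2) * zlog r t) \<le> integral {c..c+2} (\<lambda>t. B * (1 - (t - c) / 2))"
  proof (rule integral_mono_real)
    fix t assume t: "t \<in> {c..c+2}"
    show "(1 - (t - c) / 2) * zlog r t \<le> B * (1 - (t - c) / 2)"
      using mult_left_mono[OF zl[OF t], of "1 - (t - c) / 2"] t by (simp add: mult.commute)
  qed (auto intro!: continuous_intros cont_ver)
  moreover have "integral {c..c+2} (\<lambda>t. 1 / pi * sin (pi/2 * (t - c)) * zlog r t) \<le>
      integral {c..c+2} (\<lambda>t. (B / pi) * sin (pi/2 * (t - c)))"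
  proof (rule integral_mono_real)
    fix t assume t: "t \<in> {c..c+2}"
    show "1 / pi * sin (pi/2 * (t - c)) * zlog r t \<le> (B / pi) * sin (pi/2 * (t - c))"
      using mult_left_mono[OF zl[OF t], of "1 / pi * sin (pi/2 * (t - c))"] s[OF t] by (simp add: mult_ac)
  qed (auto intro!: continuous_intros cont_ver)
  ultimately have "integral {c..c+2} (\<lambda>t. (1 - (t - c) / 2) * zlog r t) + integral {c..c+2} (\<lambda>t. 1 / pi * sin (pi/2 * (t - c)) * zlog r t)
     \<le> B * 1 + (B / pi) * (4 / pi)"
    unfolding Henstock_Kurzweil_Integration.integral_mult_right integral_ramp integral_sin_half by linarith
  also have "\<dots> = B * (1 + 4 / pi^2)" by (simp add: algebra_simps power2_eq_square)
  also have "\<dots> \<le> B * 1.41"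
  proof (intro mult_left_mono B)
    have "4 / 0.41 \<le> (3.1416 - 0.0001 :: real)^2" by (simp add: power2_eq_square)
    also have "\<dots> \<le> pi^2" using pi_approx by (intro power_mono) auto
    finally show "1 + 4 / pi^2 \<le> (1.41::real)" by (simp add: field_simps)
  qed
  finally show ?thesis by simp
qed

text \<open>The line \<open>Re z = 3/2\<close> is too close to the pole for any decay, and the
  quotient is only bounded by \<open>60\<close>. This side accounts for more than half of the
  \<open>70\<close> in \<open>edge_bound\<close>.\<close>

lemma bump_ver: "green_ver zeta (bump r c) (bump' r c) c (c+2) (3/2) \<le> 0.41 * (90 * (3/2 - r) + 3)"
proof -
  define Y where "Y = 3/2 - r"
  have Y: "0 \<le> pi/2 * Y" using r by (simp add: Y_def)
  have "pi/2 * Y \<le> 3.1416/2 * 0.98" using r pi_approx unfolding Y_def by (intro mult_mono) auto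
  then have Y2: "pi/2 * Y \<le> 1.54" by simp
  have sh: "sinh (pi/2 * Y) \<le> 1.5 * (pi/2 * Y)" "0 \<le> sinh (pi/2 * Y)" using sinh_le[OF Y Y2] Y by auto
  have ch: "cosh (pi/2 * Y) \<le> 2.6" "0 \<le> cosh (pi/2 * Y)" using cosh_le[OF Y Y2] cosh_real_nonneg by auto
  define C where "C = 2 / pi^2 * (1.5 * (pi/2 * Y)) * 60 + 1 / pi * 2.6 * 1.1"
  have "green_ver zeta (bump r c) (bump' r c) c (c+2) (3/2) = integral {c..c+2} (\<lambda>t.
     2 / pi^2 * (sinh (pi/2 * Y) * sin (pi/2 * (t - c))) * Re (zquot (3/2) t)
     - 1 / pi * (cosh (pi/2 * Y) * sin (pi/2 * (t - c))) * zlog (3/2) t)"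
    unfolding green_ver_def bump_simps zlog_def zquot_def Y_def by simp
  also have "\<dots> \<le> integral {c..c+2} (\<lambda>t. C * sin (pi/2 * (t - c)))"
  proof (rule integral_mono_real)
    fix t assume t: "t \<in> {c..c+2}"
    have "pi/2 * (t - c) \<le> pi/2 * 2" using t by (intro mult_left_mono) auto
    then have s: "0 \<le> sin (pi/2 * (t - c))" using t by (intro sin_ge_zero) auto
    have q: "\<bar>Re (zquot (3/2) t)\<bar> \<le> 60" using norm_zquot_three_halves abs_Re_le_cmod order_trans by blast
    have l: "\<bar>zlog (3/2) t\<bar> \<le> ln 3"
    proof -
      have "zetaR (3/2) \<le> 3" using zetaR_le[of "3/2"] by simp
      then have "ln (zetaR (3/2)) \<le> ln 3" using zetaR_ge(2)[of "3/2"] by (subst ln_le_cancel_iff) auto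
      then show ?thesis using abs_zlog_le[of "3/2" t] by simp
    qed
    then have l: "\<bar>zlog (3/2) t\<bar> \<le> 1.1" using ln_3_le by linarith
    have a: "2 / pi^2 * sinh (pi/2 * Y) * Re (zquot (3/2) t) \<le> 2 / pi^2 * (1.5 * (pi/2 * Y)) * 60"
    proof -
      have "2 / pi^2 * sinh (pi/2 * Y) * Re (zquot (3/2) t) \<le> 2 / pi^2 * sinh (pi/2 * Y) * 60"
        using q sh by (intro mult_left_mono) auto
      also have "\<dots> \<le> 2 / pi^2 * (1.5 * (pi/2 * Y)) * 60" using sh by (intro mult_right_mono mult_left_mono) auto
      finally show ?thesis .
    qed
    have b: "1 / pi * cosh (pi/2 * Y) * (- zlog (3/2) t) \<le> 1 / pi * 2.6 * 1.1"
    proof -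
      have "1 / pi * cosh (pi/2 * Y) * (- zlog (3/2) t) \<le> 1 / pi * cosh (pi/2 * Y) * 1.1"
        using l ch by (intro mult_left_mono) auto
      also have "\<dots> \<le> 1 / pi * 2.6 * 1.1" using ch by (intro mult_right_mono mult_left_mono) auto
      finally show ?thesis .
    qed
    have "2 / pi^2 * (sinh (pi/2 * Y) * sin (pi/2 * (t - c))) * Re (zquot (3/2) t)
     - 1 / pi * (cosh (pi/2 * Y) * sin (pi/2 * (t - c))) * zlog (3/2) t =
      (2 / pi^2 * sinh (pi/2 * Y) * Re (zquot (3/2) t) + 1 / pi * cosh (pi/2 * Y) * (- zlog (3/2) t)) * sin (pi/2 * (t - c))"
      by (simp add: algebra_simps)
    also have "\<dots> \<le> C * sin (pi/2 * (t - c))" unfolding C_def by (intro mult_right_mono add_mono a b s)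
    finally show "2 / pi^2 * (sinh (pi/2 * Y) * sin (pi/2 * (t - c))) * Re (zquot (3/2) t)
     - 1 / pi * (cosh (pi/2 * Y) * sin (pi/2 * (t - c))) * zlog (3/2) t \<le> C * sin (pi/2 * (t - c))" .
  qed (auto intro!: continuous_intros cont_ver)
  also have "\<dots> = C * (4 / pi)" by (simp only: Henstock_Kurzweil_Integration.integral_mult_right integral_sin_half)
  also have "\<dots> = 4 / pi^2 * (90 * Y + 2.86)" by (simp add: C_def power2_eq_square field_simps)
  also have "\<dots> \<le> 0.41 * (90 * Y + 3)"
  proof (intro mult_mono)
    have "4 / 0.41 \<le> (3.1416 - 0.0001 :: real)^2" by (simp add: power2_eq_square)
    also have "\<dots> \<le> pi^2" using pi_approx by (intro power_mono) auto
    finally show "4 / pi^2 \<le> (0.41::real)" by (simp add: field_simps)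
  qed (use r in \<open>auto simp: Y_def\<close>)
  finally show ?thesis by (simp add: Y_def)
qed

lemma ramp_ver: "green_ver zeta (ramp r c) (ramp' r c) c (c+2) X \<le> 1"
proof -
  have "green_ver zeta (ramp r c) (ramp' r c) c (c+2) X = integral {c..c+2} (\<lambda>t.
     (X - r) * (1 - (t - c) / 2) * Re (zquot X t) - (1 - (t - c) / 2) * zlog X t)"
    unfolding green_ver_def ramp_simps zlog_def zquot_def by simp
  also have "\<dots> \<le> integral {c..c+2} (\<lambda>t. 1/2)"
  proof (rule integral_mono_real)
    fix t assume t: "t \<in> {c..c+2}"
    have p: "2 powr (- X) \<le> X * 2 powr (- X)" using X by simp
    have q: "\<bar>Re (zquot X t)\<bar> \<le> 9 * 2 powr (- X)"
      using norm_zquot_le_powr[of X t] abs_Re_le_cmod[of "zquot X t"] X by linarith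
    have l: "\<bar>zlog X t\<bar> \<le> 4.4 * 2 powr (- X)" using abs_zlog_le_powr X by simp
    have "(X - r) * Re (zquot X t) \<le> (X - r) * (9 * 2 powr (- X))" using q X r by (intro mult_left_mono) auto
    also have "\<dots> \<le> X * (9 * 2 powr (- X))" using r by (intro mult_right_mono) auto
    finally have "(X - r) * Re (zquot X t) - zlog X t \<le> 9 * (X * 2 powr (- X)) + 4.4 * 2 powr (- X)" using l by (simp add: abs_le_iff)
    also have "\<dots> \<le> 9 * (1/50) + 4.4 * (1/50)" using X2 p by (intro add_mono mult_left_mono order_trans[OF p X2]) auto
    also have "\<dots> \<le> 1/2" by simp
    finally have b: "(X - r) * Re (zquot X t) - zlog X t \<le> 1/2" .
    have "(X - r) * (1 - (t - c) / 2) * Re (zquot X t) - (1 - (t - c) / 2) * zlog X t =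
      (1 - (t - c) / 2) * ((X - r) * Re (zquot X t) - zlog X t)"
    proof -
      have "u * k * q - k * l = k * (u * q - l)" for u k q l :: real by (simp add: algebra_simps)
      then show ?thesis .
    qed
    also have "\<dots> \<le> (1 - (t - c) / 2) * (1/2)" using b t by (intro mult_left_mono) auto
    also have "\<dots> \<le> 1/2" using t by simp
    finally show "(X - r) * (1 - (t - c) / 2) * Re (zquot X t) - (1 - (t - c) / 2) * zlog X t \<le> 1/2" .
  qed (use X in \<open>auto intro!: continuous_intros cont_ver\<close>)
  also have "\<dots> = 1" by simp
  finally show ?thesis .
qed

lemma tail_part:
  assumes "t \<in> {c, c+2}"
  shows "\<bar>integral {3/2..X} (\<lambda>x. (x - r) / 2 * zlog x t)\<bar> \<le> 3.55"
proof -
  have t0: "t \<noteq> 0" using assms sgn_c by auto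
  have "norm (integral {3/2..X} (\<lambda>x. (x - r) / 2 * zlog x t)) \<le> integral {3/2..X} (\<lambda>x. x * \<bar>zlog x t\<bar> * (1/2))"
  proof (rule integral_norm_bound_integral)
    fix x assume x: "x \<in> {3/2..X}"
    then have "\<bar>x - r\<bar> * \<bar>zlog x t\<bar> \<le> x * \<bar>zlog x t\<bar>" using r by (intro mult_right_mono) auto
    then show "norm ((x - r) / 2 * zlog x t) \<le> x * \<bar>zlog x t\<bar> * (1/2)" by (simp add: abs_mult)
  qed (use r assms in \<open>auto intro!: integrable_continuous_real continuous_intros cont_hor\<close>)
  also have "\<dots> = integral {3/2..X} (\<lambda>x. x * \<bar>zlog x t\<bar>) * (1/2)"
    by (rule Henstock_Kurzweil_Integration.integral_mult_left)
  also have "\<dots> \<le> 7.1 * (1/2)" using zlog_tail[of X t] X t0 by (intro mult_right_mono) auto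
  finally show ?thesis by simp
qed

text \<open>The sum of \<open>ramp_ineq\<close> and \<open>bump_ineq\<close>. The constant
  \<open>8.1\<close> collects the two tails beyond \<open>3/2\<close>, each \<open>3.55\<close>, and
  the right side of the ramp rectangle, at most \<open>1\<close>.\<close>

lemma edge_bound_weights:
  "edge_int r X c \<le> 3/4 * (3/2 - r)^2 * L + 1.41 * B + 0.41 * (90 * (3/2 - r) + 3) + 8.1"
proof -
  define I where "I = (\<lambda>a b t. integral {a..b} (\<lambda>x. (x - r) / 2 * zlog x t))"
  define S where "S = (\<lambda>t. integral {r..3/2} (\<lambda>x. 1 / pi * sinh (pi/2 * (x - r)) * zlog x t))"
  have split: "I r X t = I r (3/2) t + I (3/2) X t" if "t \<in> {c, c+2}" for t
    unfolding I_def
    by (rule Henstock_Kurzweil_Integration.integral_combine[symmetric])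
      (use that X r in \<open>auto intro!: integrable_continuous_real continuous_intros cont_hor\<close>)
  have 1: "integral {r..3/2} (\<lambda>x. (1 / pi * sinh (pi/2 * (x - r)) + (x - r) / 2) * zlog x (c + 2)) = S (c+2) + I r (3/2) (c+2)"
    unfolding S_def I_def
    by (subst integral_add_real[symmetric]) (use X in \<open>auto intro!: continuous_intros cont_hor simp: distrib_right\<close>)
  have 2: "integral {r..3/2} (\<lambda>x. (1 / pi * sinh (pi/2 * (x - r)) - (x - r) / 2) * zlog x c) = S c - I r (3/2) c"
    unfolding S_def I_def
    by (subst integral_diff_real[symmetric]) (use X in \<open>auto intro!: continuous_intros cont_hor simp: left_diff_distrib\<close>)
  have "\<bar>I (3/2) X c\<bar> \<le> 3.55" "\<bar>I (3/2) X (c+2)\<bar> \<le> 3.55" unfolding I_def by (rule tail_part, simp)+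
  moreover define V1 where "V1 = integral {c..c+2} (\<lambda>t. (1 - (t - c) / 2) * zlog r t)"
  moreover define V2 where "V2 = integral {c..c+2} (\<lambda>t. 1 / pi * sin (pi/2 * (t - c)) * zlog r t)"
  moreover have "edge_int r X c \<le> I r X (c+2) - I r X c + V1 + green_ver zeta (ramp r c) (ramp' r c) c (c+2) X"
    unfolding I_def V1_def by (rule ramp_ineq)
  moreover have "0 \<le> S (c+2) + S c + V2 + green_ver zeta (bump r c) (bump' r c) c (c+2) (3/2)"
    unfolding S_def V2_def by (rule bump_ineq)
  moreover have "(S (c+2) + I r (3/2) (c+2)) + (S c - I r (3/2) c) \<le> 3/4 * (3/2 - r)^2 * L"
    using hor_part unfolding 1 2 .
  moreover have "V1 + V2 \<le> 1.41 * B" unfolding V1_def V2_def by (rule ver_part)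
  ultimately show ?thesis
    using bump_ver ramp_ver split[of c] split[of "c+2"] by (simp del: times_divide_eq_left)
qed

text \<open>With \<open>Y = 3/2 - r\<close>, the exponent \<open>1 - r = Y - 1/2\<close> in
  \<open>B\<close> saves \<open>0.705 ln M\<close>. As \<open>Y \<le> 0.98\<close>, this lowers the
  coefficient of \<open>Y ln M\<close> from about \<open>1.78\<close> to \<open>1.13\<close>, which
  is what \<open>E3\<close> can pay.\<close>

lemma edge_bound: "edge_int r X c \<le> 1.13 * (3/2 - r) * ln M + 70 * (3/2 - r)"
proof -
  define Y where "Y = 3/2 - r"
  define m where "m = ln M"
  have Y: "0.5277 \<le> Y" "Y \<le> 0.98" using r by (auto simp: Y_def)
  have m: "m \<ge> 0" using M by (simp add: m_def)
  have l: "ln (1 / (1 - r)) \<le> 3.7"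
  proof -
    have "1 / (1 - r) \<le> 37" using r by (simp add: field_simps)
    also have "(37::real) \<le> (1 + 3.7/16 + (3.7/16)^2 / 2) ^ 16" by (simp add: power_divide)
    also have "\<dots> \<le> exp (3.7/16) ^ 16" by (intro power_mono exp_lower_Taylor_quadratic) auto
    also have "\<dots> = exp 3.7" by (simp flip: exp_of_nat_mult)
    finally have "ln (1 / (1 - r)) \<le> ln (exp 3.7)" using r by (subst ln_le_cancel_iff) auto
    then show ?thesis by simp
  qed
  have Y2: "Y^2 \<le> 0.98 * Y" using Y by (simp add: power2_eq_square)
  have f1: "3/4 * Y^2 * L \<le> 0.735 * Y + 0.3675 * (Y * m)"
  proof -
    have "L \<le> 1 + m / 2" using ln_2_less_1 by (simp add: L_def m_def)
    then have "3/4 * Y^2 * L \<le> 3/4 * (0.98 * Y) * (1 + m / 2)" using Y2 Y L by (intro mult_mono) auto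
    also have "\<dots> = 0.735 * Y + 0.3675 * (Y * m)" by (simp add: field_simps)
    finally show ?thesis .
  qed
  have "B = Y * m - m / 2 + ln (1 / (1 - r))" by (simp add: B_def m_def Y_def field_simps)
  then have f2: "1.41 * B \<le> 1.41 * (Y * m) - 0.705 * m + 5.217" using l by simp
  have f3: "0.3675 * (Y * m) + 1.41 * (Y * m) - 0.705 * m \<le> 1.13 * (Y * m)"
  proof -
    have "(0.3675 * Y + 1.41 * Y - 0.705) * m \<le> (1.13 * Y) * m" using Y by (intro mult_right_mono m) simp
    then show ?thesis by (simp add: algebra_simps)
  qed
  have "3/4 * Y^2 * L + 1.41 * B + 0.41 * (90 * Y + 3) + 8.1 \<le> 1.13 * (Y * m) + 70 * Y"
  proof -
    have *: "a + b + 0.41 * (90 * Y + 3) + 8.1 \<le> 1.13 * w + 70 * Y"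
      if "a \<le> 0.735 * Y + 0.3675 * w" "b \<le> 1.41 * w - 0.705 * m + 5.217"
        "0.3675 * w + 1.41 * w - 0.705 * m \<le> 1.13 * w" for a b w
      using that Y by (simp add: field_simps)
    show ?thesis by (rule *[OF f1 f2 f3])
  qed
  then show ?thesis using edge_bound_weights unfolding Y_def m_def mult.assoc by linarith
qed
end

section \<open>Mean square\<close>

definition dpoly :: "real \<Rightarrow> real \<Rightarrow> complex" where
  "dpoly x t = (\<Sum>n=1..nat \<lfloor>t\<rfloor>. of_nat n powr (- Complex x t))"

text \<open>The length of \<open>dpoly\<close> grows with \<open>t\<close>. Recording this as the
  condition that \<open>t\<close> has reached \<open>max m n\<close> turns the square into a double
  sum over a fixed range, which can be integrated term by term.\<close>

lemma norm_dpoly_sq: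
  assumes "0 \<le> t" "t \<le> T"
  shows "(norm (dpoly x t))^2 = (\<Sum>m=1..nat \<lfloor>T\<rfloor>. \<Sum>n=1..nat \<lfloor>T\<rfloor>.
     if t \<in> {max (real m) (real n)..} then real m powr (- x) * real n powr (- x) * cos (t * (ln m - ln n)) else 0)"
proof -
  let ?W = "{1..nat \<lfloor>T\<rfloor>}"
  define b where "b = (\<lambda>n. if real n \<le> t then real n powr (- x) else 0)"
  define \<theta> where "\<theta> = (\<lambda>n. - t * ln (real n))"
  have sub: "{n\<in>?W. real n \<le> t} = {1..nat \<lfloor>t\<rfloor>}"
  proof -
    have A: "real n \<le> t \<longleftrightarrow> n \<le> nat \<lfloor>t\<rfloor>" for n using assms by (simp add: le_nat_iff le_floor_iff)
    have "{n\<in>?W. real n \<le> t} = {n\<in>?W. n \<le> nat \<lfloor>t\<rfloor>}" by (simp only: A)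
    moreover have "nat \<lfloor>t\<rfloor> \<le> nat \<lfloor>T\<rfloor>" using assms by (intro nat_mono floor_mono)
    moreover have "{n\<in>{1..k}. n \<le> j} = {1..j}" if "j \<le> k" for j k :: nat using that by auto
    ultimately show ?thesis by metis
  qed
  have "dpoly x t = (\<Sum>n\<in>{n\<in>?W. real n \<le> t}. of_nat n powr (- Complex x t))" unfolding sub dpoly_def ..
  also have "\<dots> = (\<Sum>n\<in>?W. if real n \<le> t then of_nat n powr (- Complex x t) else 0)"
    by (rule sum.inter_filter) simp
  also have "\<dots> = (\<Sum>n\<in>?W. of_real (b n) * cis (\<theta> n))"
    by (intro sum.cong refl) (auto simp: b_def \<theta>_def of_nat_powr_Complex)
  finally have D: "dpoly x t = (\<Sum>n\<in>?W. of_real (b n) * cis (\<theta> n))" .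
  have "complex_of_real ((norm (dpoly x t))^2) = dpoly x t * cnj (dpoly x t)" by (rule complex_norm_square)
  also have "\<dots> = (\<Sum>m\<in>?W. \<Sum>n\<in>?W. of_real (b m * b n) * cis (\<theta> m - \<theta> n))"
  proof -
    have "of_real A * cis u * cnj (of_real B * cis v) = of_real (A * B) * cis (u - v)" for A B u v
    proof -
      have "of_real A * cis u * cnj (of_real B * cis v) = of_real (A * B) * (cis u * cis (- v))" by (simp add: cis_cnj)
      then show ?thesis by (simp only: cis_mult) simp
    qed
    then show ?thesis unfolding D cnj_sum sum_product by (intro sum.cong refl)
  qed
  finally have "(norm (dpoly x t))^2 = Re (\<Sum>m\<in>?W. \<Sum>n\<in>?W. of_real (b m * b n) * cis (\<theta> m - \<theta> n))"
    by (metis Re_complex_of_real)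
  also have "\<dots> = (\<Sum>m\<in>?W. \<Sum>n\<in>?W. b m * b n * cos (\<theta> m - \<theta> n))" by simp
  also have "\<dots> = (\<Sum>m=1..nat \<lfloor>T\<rfloor>. \<Sum>n=1..nat \<lfloor>T\<rfloor>.
     if t \<in> {max (real m) (real n)..} then real m powr (- x) * real n powr (- x) * cos (t * (ln m - ln n)) else 0)"
  proof (intro sum.cong refl)
    fix m n :: nat
    have "cos (\<theta> m - \<theta> n) = cos (- (t * (ln m - ln n)))" by (simp add: \<theta>_def algebra_simps)
    also have "\<dots> = cos (t * (ln m - ln n))" by (rule cos_minus)
    finally show "b m * b n * cos (\<theta> m - \<theta> n) = (if t \<in> {max (real m) (real n)..} then real m powr (- x) * real n powr (- x) * cos (t * (ln m - ln n)) else 0)"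
      by (auto simp: b_def)
  qed
  finally show ?thesis .
qed

definition off_diagonal :: "real \<Rightarrow> real \<Rightarrow> real" where
  "off_diagonal x T = (\<Sum>n=1..nat \<lfloor>T\<rfloor>. \<Sum>m=1..<n. real m powr (- x) * real n powr (- x) / ln (real n / real m))"

text \<open>The factor \<open>4\<close>: a pair \<open>m \<noteq> n\<close> occurs in both orders, each bounded by \<open>\<bar>sin u - sin v\<bar> \<le> 2\<close>.\<close>
lemma dpoly_mean_square:
  assumes "0 \<le> H" "H \<le> T"
  shows "(\<lambda>t. (norm (dpoly x t))^2) integrable_on {H..T}"
    and "integral {H..T} (\<lambda>t. (norm (dpoly x t))^2) \<le> (T - H) * (\<Sum>n=1..nat \<lfloor>T\<rfloor>. real n powr (- 2 * x))
      + 4 * off_diagonal x T"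
proof -
  let ?W = "{1..nat \<lfloor>T\<rfloor>}"
  define a where "a = (\<lambda>n::nat. real n powr (- x))"
  \<comment> \<open>The height at which the pair \<open>(m, n)\<close> starts to contribute.\<close>
  define K where "K = (\<lambda>m n::nat. max H (max (real m) (real n)))"
  define g where "g = (\<lambda>m n::nat. a m * a n * (if m = n then T - K m n else (sin (T * (ln m - ln n)) - sin (K m n * (ln m - ln n))) / (ln m - ln n)))"
  have WT: "real n \<le> T" if "n \<in> ?W" for n using that assms by (auto simp: le_nat_iff le_floor_iff)
  have lnm: "ln (real m) - ln (real n) \<noteq> 0" if "m \<in> ?W" "n \<in> ?W" "m \<noteq> n" for m n using that by auto
  have int: "((\<lambda>t. if t \<in> {max (real m) (real n)..} then a m * a n * cos (t * (ln m - ln n)) else 0) has_integral g m n) {H..T}"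
    if mn: "m \<in> ?W" "n \<in> ?W" for m n
  proof -
    have KT: "K m n \<le> T" using WT mn assms by (auto simp: K_def)
    have "((\<lambda>t. cos (t * (ln m - ln n))) has_integral (if m = n then T - K m n else (sin (T * (ln m - ln n)) - sin (K m n * (ln m - ln n))) / (ln m - ln n))) {K m n..T}"
    proof (cases "m = n")
      case True
      then show ?thesis using has_integral_const_real[of "1::real" "K m n" T] KT by simp
    next
      case False
      define \<theta> where "\<theta> = ln (real m) - ln (real n)"
      have \<theta>: "\<theta> \<noteq> 0" using lnm[OF mn False] by (simp add: \<theta>_def)
      have "((\<lambda>t. cos (t * \<theta>)) has_integral (sin (T * \<theta>) / \<theta> - sin (K m n * \<theta>) / \<theta>)) {K m n..T}"
        by (rule fundamental_theorem_of_calculus[OF KT])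
          (use \<theta> in \<open>auto intro!: derivative_eq_intros simp: has_real_derivative_iff_has_vector_derivative[symmetric]\<close>)
      then show ?thesis using False by (simp add: \<theta>_def diff_divide_distrib)
    qed
    then have "((\<lambda>t. a m * a n * cos (t * (ln m - ln n))) has_integral g m n) {K m n..T}"
      unfolding g_def by (rule has_integral_mult_right)
    then have "((\<lambda>t. if t \<in> {K m n..T} then a m * a n * cos (t * (ln m - ln n)) else 0) has_integral g m n) {H..T}"
      by (subst has_integral_restrict) (auto simp: K_def)
    then show ?thesis by (rule has_integral_eq[rotated]) (auto simp: K_def)
  qed
  have "((\<lambda>t. \<Sum>m\<in>?W. \<Sum>n\<in>?W. if t \<in> {max (real m) (real n)..} then a m * a n * cos (t * (ln m - ln n)) else 0)
      has_integral (\<Sum>m\<in>?W. \<Sum>n\<in>?W. g m n)) {H..T}"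
    by (intro has_integral_sum int) auto
  then have I: "((\<lambda>t. (norm (dpoly x t))^2) has_integral (\<Sum>m\<in>?W. \<Sum>n\<in>?W. g m n)) {H..T}"
  proof (rule has_integral_eq[rotated])
    fix t assume "t \<in> {H..T}"
    then show "(\<Sum>m\<in>?W. \<Sum>n\<in>?W. if t \<in> {max (real m) (real n)..} then a m * a n * cos (t * (ln m - ln n)) else 0) = (norm (dpoly x t))^2"
      unfolding a_def by (intro norm_dpoly_sq[symmetric]) (use assms in auto)
  qed
  then show "(\<lambda>t. (norm (dpoly x t))^2) integrable_on {H..T}" by blast
  define o' where "o' = (\<lambda>m n::nat. a m * a n / ln (real n / real m))"
  have off: "g m n \<le> 2 * o' m n" "g n m \<le> 2 * o' m n" if "n \<in> ?W" "m \<in> {1..<n}" for m n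
  proof -
    have mW: "m \<in> ?W" using that by auto
    define \<theta> where "\<theta> = ln (real n / real m)"
    have \<theta>: "\<theta> > 0" using that by (simp add: \<theta>_def)
    have e: "ln (real m) - ln (real n) = - \<theta>" "ln (real n) - ln (real m) = \<theta>" using that by (auto simp: \<theta>_def ln_div)
    have nn: "m \<noteq> n" "n \<noteq> m" using that by auto
    have *: "(sin A - sin B) / \<theta> \<le> 2 / \<theta>" "(sin A - sin B) / - \<theta> \<le> 2 / \<theta>" for A B
    proof -
      have "\<bar>sin A - sin B\<bar> \<le> 2" using sin_le_one[of A] sin_le_one[of B] sin_ge_minus_one[of A] sin_ge_minus_one[of B] by linarith
      then have "(sin A - sin B) / \<theta> \<le> 2 / \<theta>" "(sin B - sin A) / \<theta> \<le> 2 / \<theta>"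
        using \<theta> by (intro divide_right_mono; simp)+
      moreover have "(sin A - sin B) / - \<theta> = (sin B - sin A) / \<theta>" by (metis minus_diff_eq minus_divide_divide minus_minus)
      ultimately show "(sin A - sin B) / \<theta> \<le> 2 / \<theta>" "(sin A - sin B) / - \<theta> \<le> 2 / \<theta>" by simp_all
    qed
    have a0: "a m * a n \<ge> 0" by (simp add: a_def)
    show "g m n \<le> 2 * o' m n"
      using mult_left_mono[OF *(2) a0] nn unfolding g_def o'_def e \<theta>_def[symmetric] by (simp add: mult_ac)
    show "g n m \<le> 2 * o' m n"
      using mult_left_mono[OF *(1) a0] nn unfolding g_def o'_def e \<theta>_def[symmetric] by (simp add: mult_ac)
  qed
  have "(\<Sum>m\<in>?W. \<Sum>n\<in>?W. g m n) = (\<Sum>n\<in>?W. g n n) + (\<Sum>n\<in>?W. \<Sum>m=1..<n. g m n + g n m)"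
  proof -
    have "(\<Sum>m=1..N. \<Sum>n=1..N. g m n) = (\<Sum>n=1..N. g n n) + (\<Sum>n=1..N. \<Sum>m=1..<n. g m n + g n m)" for N
    proof (induction N)
      case (Suc N)
      have "(\<Sum>m=1..Suc N. \<Sum>n=1..Suc N. g m n) = (\<Sum>m=1..N. \<Sum>n=1..N. g m n) + (\<Sum>m=1..N. g m (Suc N)) + ((\<Sum>n=1..N. g (Suc N) n) + g (Suc N) (Suc N))"
        by (simp add: sum.distrib)
      moreover have "{1..<Suc N} = {1..N}" by auto
      ultimately show ?case unfolding Suc.IH by (simp add: sum.distrib)
    qed simp
    then show ?thesis .
  qed
  also have "\<dots> \<le> (\<Sum>n\<in>?W. (T - H) * real n powr (- 2 * x)) + (\<Sum>n\<in>?W. \<Sum>m=1..<n. 4 * o' m n)"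
  proof (intro add_mono sum_mono)
    fix n assume n: "n \<in> ?W"
    have "g n n = a n * a n * (T - K n n)" by (simp add: g_def)
    also have "\<dots> \<le> a n * a n * (T - H)" by (intro mult_left_mono) (auto simp: K_def a_def)
    also have "a n * a n = real n powr (- 2 * x)" by (simp add: a_def powr_add[symmetric])
    finally show "g n n \<le> (T - H) * real n powr (- 2 * x)" by (simp add: mult.commute)
    show "g m n + g n m \<le> 4 * o' m n" if "m \<in> {1..<n}" for m using off[OF n that] by linarith
  qed
  finally show "integral {H..T} (\<lambda>t. (norm (dpoly x t))^2) \<le> (T - H) * (\<Sum>n=1..nat \<lfloor>T\<rfloor>. real n powr (- 2 * x))
      + 4 * off_diagonal x T"
    using integral_unique[OF I] by (simp add: off_diagonal_def sum_distrib_left o'_def a_def)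
qed

section \<open>Bounds for the off-diagonal sum\<close>

lemma sum_norm_zeta_tail:
  fixes T a :: real
  assumes "a > 1" "T \<ge> 1"
  shows "zetaR a - (\<Sum>n=1..nat \<lfloor>T\<rfloor>. real n powr (- a)) \<le> T powr (1 - a) / (a - 1) + T powr (- a)"
proof -
  define N where "N = nat \<lfloor>T\<rfloor>"
  have N: "T < real N + 1" "1 \<le> N"
    using assms real_of_int_floor_add_one_gt[of T] by (auto simp: N_def le_nat_iff)
  have "(\<lambda>M. (\<Sum>n<M. real (Suc n) powr (- a)) - (\<Sum>n=1..N. real n powr (- a))) \<longlonglongrightarrow> zetaR a - (\<Sum>n=1..N. real n powr (- a))"
    by (intro tendsto_intros) (use zetaR_sums[OF assms(1)] in \<open>simp add: sums_def\<close>)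
  moreover have "(\<Sum>n<M. real (Suc n) powr (- a)) - (\<Sum>n=1..N. real n powr (- a)) \<le> T powr (1 - a) / (a - 1) + T powr (- a)"
    if "M \<ge> Suc N" for M
  proof -
    have "(\<Sum>n<M. real (Suc n) powr (- a)) = (\<Sum>n=1..M. real n powr (- a))"
      by (simp add: sum.atLeast1_atMost_eq)
    also have "\<dots> = (\<Sum>n=1..N. real n powr (- a)) + (\<Sum>n=Suc N..M. real n powr (- a))"
      using sum.ub_add_nat[of 1 N "\<lambda>n. real n powr (- a)" "M - N"] that by simp
    also have "(\<Sum>n=Suc N..M. real n powr (- a)) = real (Suc N) powr (- a) + (\<Sum>n=Suc (Suc N)..M. real n powr (- a))"
      using that by (rule sum.atLeast_Suc_atMost)
    finally have "(\<Sum>n<M. real (Suc n) powr (- a)) - (\<Sum>n=1..N. real n powr (- a)) =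
        real (Suc N) powr (- a) + (\<Sum>n=Suc (Suc N)..M. real n powr (- a))" by simp
    also have "\<dots> \<le> real (Suc N) powr (- a) + (real M powr (1 - a) - real (Suc N) powr (1 - a)) / (1 - a)"
      using sum_powr_le[of "Suc N" M a] that assms by simp
    also have "(real M powr (1 - a) - real (Suc N) powr (1 - a)) / (1 - a) = (real (Suc N) powr (1 - a) - real M powr (1 - a)) / (a - 1)"
      by (metis minus_diff_eq minus_divide_divide)
    also have "\<dots> \<le> T powr (1 - a) / (a - 1)"
    proof (intro divide_right_mono)
      have "real (Suc N) powr (1 - a) \<le> T powr (1 - a)" using N assms by (intro powr_mono2') auto
      then show "real (Suc N) powr (1 - a) - real M powr (1 - a) \<le> T powr (1 - a)" using powr_ge_zero[of "real M" "1 - a"] by linarith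
    qed (use assms in auto)
    also have "real (Suc N) powr (- a) \<le> T powr (- a)" using N assms by (intro powr_mono2') auto
    finally show ?thesis by simp
  qed
  ultimately show ?thesis unfolding N_def[symmetric] by (intro LIMSEQ_le_const2) auto
qed

lemma sum_powr_le_real:
  fixes T a :: real
  assumes "0 < a" "a < 1" "T \<ge> 1"
  shows "(\<Sum>n=1..nat \<lfloor>T\<rfloor>. real n powr (- a)) \<le> (T powr (1 - a) - a) / (1 - a)"
proof -
  define N where "N = nat \<lfloor>T\<rfloor>"
  have N: "real N \<le> T" "1 \<le> N" using assms by (auto simp: N_def le_nat_iff)
  have "(\<Sum>n=1..N. real n powr (- a)) = 1 + (\<Sum>n=Suc 1..N. real n powr (- a))"
    using sum.atLeast_Suc_atMost[of 1 N "\<lambda>n. real n powr (- a)"] N by simp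
  also have "\<dots> \<le> 1 + (real N powr (1 - a) - real 1 powr (1 - a)) / (1 - a)"
    by (intro add_left_mono sum_powr_le) (use N assms in auto)
  also have "\<dots> \<le> 1 + (T powr (1 - a) - 1) / (1 - a)"
    using assms N by (intro add_left_mono divide_right_mono diff_mono) (auto intro!: powr_mono2)
  also have "\<dots> = (T powr (1 - a) - a) / (1 - a)" using assms by (simp add: field_simps)
  finally show ?thesis by (simp add: N_def)
qed

lemma sum_below_diagonal:
  fixes h :: "nat \<Rightarrow> nat \<Rightarrow> real"
  shows "(\<Sum>n=1..N. \<Sum>m=1..<n. h m n) = (\<Sum>m=1..N. \<Sum>n=Suc m..N. h m n)"
proof (induction N)
  case (Suc N)
  have "(\<Sum>m=1..Suc N. \<Sum>n=Suc m..Suc N. h m n) = (\<Sum>m=1..N. (\<Sum>n=Suc m..N. h m n) + h m (Suc N))"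
    by simp
  also have "\<dots> = (\<Sum>m=1..N. \<Sum>n=Suc m..N. h m n) + (\<Sum>m=1..<Suc N. h m (Suc N))"
    unfolding sum.distrib atLeastLessThanSuc_atLeastAtMost ..
  finally show ?case using Suc.IH by simp
qed simp

lemma harm_le: "(\<Sum>n=1..N. 1 / real n) \<le> 1 + ln (real N)" if "N \<ge> 1" for N
  using that
proof (induction N rule: dec_induct)
  case (step n)
  have "1 - real n / real (Suc n) \<le> - ln (real n / real (Suc n))"
    using ln_le_minus_one[of "real n / real (Suc n)"] step by simp
  moreover have "1 - real n / real (Suc n) = 1 / real (Suc n)" by (simp add: field_simps)
  moreover have "- ln (real n / real (Suc n)) = ln (real (Suc n)) - ln (real n)" using step by (simp add: ln_div del: of_nat_Suc)
  ultimately show ?case using step by simp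
qed simp

text \<open>The right-hand side is \<open>T\<close> times the bracket in the definition of \<open>\<epsilon>\<^sub>1\<close>, up to the truncation \<open>max 0\<close>.\<close>
lemma off_diagonal_bound:
  assumes s: "1/2 < s" "s < 1" and T: "T \<ge> 1"
  shows "off_diagonal s T \<le> ((T powr (1 - s) - s)^2 / (1 - s)^2 - zetaR (2 * s) + T powr (1 - 2 * s) / (2 * s - 1) + T powr (- 2 * s)) / 2
       + (1 + ln T) * ((T powr (2 - 2 * s) - (2 * s - 1)) / (2 - 2 * s))"
proof -
  define N where "N = nat \<lfloor>T\<rfloor>"
  have N: "real N \<le> T" "1 \<le> N" using T by (auto simp: N_def le_nat_iff)
  define a where "a = (\<lambda>n::nat. real n powr (- s))"
  have a0: "a n \<ge> 0" for n by (simp add: a_def)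
  \<comment> \<open>From \<open>1 - m/n \<le> ln (n/m)\<close> one gets
    \<open>1 / ln (n/m) \<le> 1 + m/(n - m)\<close>. In the second part \<open>a n\<close> is
    replaced by the larger \<open>a m\<close>, so that the sum over \<open>n\<close> becomes
    harmonic.\<close>
  have t: "a m * a n / ln (real n / real m) \<le> a m * a n + real m powr (1 - 2 * s) * (1 / real (n - m))"
    if "m \<in> {1..<n}" for m n
  proof -
    have mn: "0 < real m" "real m < real n" "real (n - m) = real n - real m" using that by auto
    have "ln (real m / real n) \<le> real m / real n - 1" using mn by (intro ln_le_minus_one) auto
    then have "1 - real m / real n \<le> ln (real n / real m)" using mn by (simp add: ln_div)
    moreover have "1 - real m / real n > 0" using mn by simp
    ultimately have "1 / ln (real n / real m) \<le> 1 / (1 - real m / real n)" by (intro divide_left_mono) auto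
    also have "\<dots> = 1 + real m / (real n - real m)" using mn by (simp add: field_simps)
    finally have "a m * a n * (1 / ln (real n / real m)) \<le> a m * a n * (1 + real m / (real n - real m))"
      by (intro mult_left_mono) (auto simp: a_def)
    also have "\<dots> = a m * a n + (a m * real m) * a n * (1 / real (n - m))" using mn by (simp add: algebra_simps)
    also have "(a m * real m) * a n * (1 / real (n - m)) \<le> (a m * real m) * a m * (1 / real (n - m))"
      using mn s by (intro mult_right_mono mult_left_mono) (auto simp: a_def intro!: powr_mono2')
    also have "(a m * real m) * a m = real m powr (1 - 2 * s)"
      using mn by (simp add: a_def powr_add[symmetric] powr_mult_base mult.commute[of _ "real m"] flip: powr_add)
    finally show ?thesis by simp
  qed
  have "(\<Sum>n=1..N. \<Sum>m=1..<n. a m * a n / ln (real n / real m)) \<le>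
     (\<Sum>n=1..N. \<Sum>m=1..<n. a m * a n + real m powr (1 - 2 * s) * (1 / real (n - m)))"
    by (intro sum_mono t)
  also have "\<dots> = (\<Sum>n=1..N. \<Sum>m=1..<n. a m * a n) + (\<Sum>n=1..N. \<Sum>m=1..<n. real m powr (1 - 2 * s) * (1 / real (n - m)))"
    by (simp add: sum.distrib)
  \<comment> \<open>The diagonal subtracted here is the source of \<open>- zetaR (2 * s)\<close> in
    the final bound.\<close>
  also have "(\<Sum>n=1..N. \<Sum>m=1..<n. a m * a n) = ((\<Sum>n=1..N. a n)^2 - (\<Sum>n=1..N. a n ^ 2)) / 2"
  proof (induction N)
    case (Suc N)
    have "{1..<Suc N} = {1..N}" by auto
    then have "(\<Sum>n=1..Suc N. \<Sum>m=1..<n. a m * a n) = ((\<Sum>n=1..N. a n)^2 - (\<Sum>n=1..N. a n ^ 2)) / 2 + (\<Sum>m=1..N. a m) * a (Suc N)"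
      using Suc.IH by (simp add: sum_distrib_right)
    then show ?case by (simp add: power2_eq_square field_simps)
  qed simp
  finally have main: "(\<Sum>n=1..N. \<Sum>m=1..<n. a m * a n / ln (real n / real m)) \<le>
     ((\<Sum>n=1..N. a n)^2 - (\<Sum>n=1..N. a n ^ 2)) / 2 +
     (\<Sum>n=1..N. \<Sum>m=1..<n. real m powr (1 - 2 * s) * (1 / real (n - m)))" .
  have "(\<Sum>n=1..N. \<Sum>m=1..<n. real m powr (1 - 2 * s) * (1 / real (n - m))) =
     (\<Sum>m=1..N. \<Sum>n=Suc m..N. real m powr (1 - 2 * s) * (1 / real (n - m)))"
    by (rule sum_below_diagonal)
  also have "\<dots> \<le> (\<Sum>m=1..N. real m powr (1 - 2 * s) * (1 + ln T))"
  proof (rule sum_mono)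
    fix m assume m: "m \<in> {1..N}"
    have "(\<Sum>n=Suc m..N. 1 / real (n - m)) = (\<Sum>r=1..N-m. 1 / real r)"
      by (rule sum.reindex_bij_witness[of _ "\<lambda>r. r + m" "\<lambda>n. n - m"]) auto
    also have "\<dots> \<le> (\<Sum>r=1..N. 1 / real r)" by (rule sum_mono2) auto
    also have "\<dots> \<le> 1 + ln (real N)" by (rule harm_le[OF N(2)])
    also have "\<dots> \<le> 1 + ln T" using N by simp
    finally show "(\<Sum>n=Suc m..N. real m powr (1 - 2 * s) * (1 / real (n - m))) \<le> real m powr (1 - 2 * s) * (1 + ln T)"
      unfolding sum_distrib_left[symmetric] by (intro mult_left_mono) auto
  qed
  also have "\<dots> = (1 + ln T) * (\<Sum>m=1..N. real m powr (- (2 * s - 1)))" by (simp add: sum_distrib_left mult.commute)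
  also have "\<dots> \<le> (1 + ln T) * ((T powr (1 - (2 * s - 1)) - (2 * s - 1)) / (1 - (2 * s - 1)))"
    unfolding N_def using s T by (intro mult_left_mono sum_powr_le_real) auto
  also have "\<dots> = (1 + ln T) * ((T powr (2 - 2 * s) - (2 * s - 1)) / (2 - 2 * s))" by simp
  finally have X: "(\<Sum>n=1..N. \<Sum>m=1..<n. real m powr (1 - 2 * s) * (1 / real (n - m))) \<le>
     (1 + ln T) * ((T powr (2 - 2 * s) - (2 * s - 1)) / (2 - 2 * s))" .
  have P: "(\<Sum>n=1..N. a n)^2 \<le> (T powr (1 - s) - s)^2 / (1 - s)^2"
    unfolding power_divide[symmetric] using sum_powr_le_real[of s T] s T
    by (intro power_mono) (auto simp: a_def N_def intro!: sum_nonneg)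
  have "(\<Sum>n=1..N. a n ^ 2) = (\<Sum>n=1..N. real n powr (- (2 * s)))"
    by (intro sum.cong refl) (simp add: a_def powr_add[symmetric] power2_eq_square)
  then have Q: "zetaR (2 * s) - (\<Sum>n=1..N. a n ^ 2) \<le> T powr (1 - 2 * s) / (2 * s - 1) + T powr (- 2 * s)"
    using sum_norm_zeta_tail[of "2 * s" T] s T by (simp add: N_def)
  have "(p - q) / 2 + F0 \<le> (P' - Z + U + V) / 2 + F" if "p \<le> P'" "Z - q \<le> U + V" "F0 \<le> F" for p q F F0 P' Z U V :: real
    using that by (simp add: field_simps)
  from this[OF P Q X] main show ?thesis unfolding N_def a_def off_diagonal_def by (rule order_trans[rotated])
qed

definition bracket :: "real \<Rightarrow> real \<Rightarrow> real" where
  "bracket s T = ln T * T powr (1 - 2 * s) / (2 * (1 - s))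
     - (2 * s - 1) * ln T / (2 * (1 - s) * T)
     + max 0 ((1 - 3 * s + 3 * s^2) / (2 * (1 - s)^2) - zetaR (2 * s) / 2) / T
     + (2 - s) * T powr (1 - 2 * s) / (2 * (1 - s)^2)
     - s * T powr (-s) / (1 - s)^2
     + T powr (-2 * s) / (2 * (2 * s - 1))
     + T powr (-2 * s - 1) / 2"

lemma eps1_bracket: "eps1 s H = 4 * H0 / (H0 - H) * bracket s H0"
  unfolding eps1_def bracket_def ..

text \<open>The constant terms combine to \<open>C\<close>. Only its positive part is kept, since
  the monotonicity argument needs a nonnegative coefficient of \<open>1/T\<close>.\<close>

lemma off_diagonal_bracket:
  assumes s: "1/2 < s" "s < 1" and T: "T \<ge> 1"
  shows "off_diagonal s T \<le> T * bracket s T"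
proof -
  define p where "p = 1 - s"
  have sp: "s = 1 - p" and p: "p > 0" using s by (auto simp: p_def)
  define P where "P = T powr (1 - s)"
  define U where "U = T powr (1 - 2 * s)"
  define V where "V = T powr (- 2 * s)"
  have PP: "T powr (2 - 2 * s) = P^2" using T by (simp add: P_def powr_add[symmetric] power2_eq_square)
  have TU: "T * T powr (1 - 2 * s) = P^2" using T powr_mult_base[of T "1 - 2 * s"] PP by (simp add: algebra_simps)
  have TP: "T * T powr (- s) = P" using T powr_mult_base[of T "- s"] by (simp add: P_def)
  have TV: "T * T powr (- 2 * s) = U" using T powr_mult_base[of T "- 2 * s"] by (simp add: U_def)
  have TW: "T * T powr (- 2 * s - 1) = V" using T powr_mult_base[of T "- 2 * s - 1"] by (simp add: V_def)
  define C where "C = (1 - 3 * s + 3 * s^2) / (2 * (1 - s)^2) - zetaR (2 * s) / 2"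
  have "T * bracket s T = ln T * (T * T powr (1 - 2 * s)) / (2 * (1 - s))
     - (2 * s - 1) * ln T / (2 * (1 - s)) + max 0 C
     + (2 - s) * (T * T powr (1 - 2 * s)) / (2 * (1 - s)^2)
     - s * (T * T powr (-s)) / (1 - s)^2
     + (T * T powr (-2 * s)) / (2 * (2 * s - 1))
     + (T * T powr (-2 * s - 1)) / 2"
  proof -
    have "T * (l * a / e - b * l / (e * T) + M / T + g * a / h - s * k / j + v / w + z / 2) =
      l * (T * a) / e - b * l / e + M + g * (T * a) / h - s * (T * k) / j + (T * v) / w + (T * z) / 2"
      for l a e b M g h k j v w z :: real
      using T by (simp add: algebra_simps)
    then show ?thesis unfolding bracket_def C_def by simp
  qed
  also have "\<dots> = ln T * P^2 / (2 * p) - (2 * s - 1) * ln T / (2 * p) + max 0 C + (2 - s) * P^2 / (2 * p^2)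
     - s * P / p^2 + U / (2 * (2 * s - 1)) + V / 2"
    unfolding TU TP TV TW p_def ..
  finally have e: "T * bracket s T = ln T * P^2 / (2 * p) - (2 * s - 1) * ln T / (2 * p) + max 0 C + (2 - s) * P^2 / (2 * p^2)
     - s * P / p^2 + U / (2 * (2 * s - 1)) + V / 2" .
  have id: "(P - s)^2 / p^2 / 2 + (P^2 - (2 * s - 1)) / (2 * p) = (1 - 3 * s + 3 * s^2) / (2 * p^2) + (2 - s) * P^2 / (2 * p^2) - s * P / p^2"
  proof -
    have "(P - s)^2 + p * (P^2 - (2 * s - 1)) = (1 - 3 * s + 3 * s^2) + (2 - s) * P^2 - 2 * s * P"
      unfolding p_def by (simp add: power2_eq_square algebra_simps)
    then have "((P - s)^2 + p * (P^2 - (2 * s - 1))) / (2 * p^2) = ((1 - 3 * s + 3 * s^2) + (2 - s) * P^2 - 2 * s * P) / (2 * p^2)" by simp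
    then show ?thesis using p by (simp add: add_divide_distrib diff_divide_distrib power2_eq_square)
  qed
  have "((P - s)^2 / (1 - s)^2 - zetaR (2 * s) + U / (2 * s - 1) + V) / 2 + (1 + ln T) * ((P^2 - (2 * s - 1)) / (2 - 2 * s))
     = ((P - s)^2 / p^2 / 2 + (P^2 - (2 * s - 1)) / (2 * p)) - zetaR (2 * s) / 2 + U / (2 * (2 * s - 1)) + V / 2
       + ln T * P^2 / (2 * p) - (2 * s - 1) * ln T / (2 * p)"
  proof -
    have e2: "2 - 2 * s = 2 * p" by (simp add: p_def)
    show ?thesis unfolding e2 p_def[symmetric] by (simp add: add_divide_distrib diff_divide_distrib algebra_simps)
  qed
  also have "\<dots> \<le> T * bracket s T"
    unfolding e id using max.cobounded2[of C 0] by (simp add: C_def p_def[symmetric])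
  finally show ?thesis
    using off_diagonal_bound[OF s T] unfolding P_def[symmetric] U_def[symmetric] PP V_def by simp
qed

section \<open>Monotonicity of the mean-square error beyond \<open>H0\<close>\<close>

lemma ln_H0_ge: "ln H0 \<ge> 24.1"
proof -
  have "exp (24.1::real) = exp 1 ^ 24 * exp 0.1" by (simp flip: exp_of_nat_mult exp_add)
  also have "\<dots> \<le> 2.72 ^ 24 * (1 + 0.1 + 0.1^2)"
    using e_less_272 by (intro mult_mono power_mono exp_bound) auto
  also have "\<dots> \<le> H0" by (simp add: H0_def power_divide)
  finally have "ln (exp (24.1::real)) \<le> ln H0" by (subst ln_le_cancel_iff) (auto simp: H0_def)
  then show ?thesis by simp
qed

text \<open>What the sign of the derivative in \<open>bracket_antimono\<close> reduces to, with
  \<open>p = 1 - s\<close>: the left side is \<open>2 s^2 + q\<close> with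
  \<open>q = 2 s - 1\<close>, and the factors on the right are lower bounds for \<open>A\<close> and
  \<open>exp (p x)\<close> at \<open>x \<ge> 24.1\<close>.\<close>

lemma bracket_polynomial_le:
  fixes p :: real
  assumes "0.0277 \<le> p" "p \<le> 0.4792"
  shows "3 - 6 * p + 2 * p^2 \<le> (1 + 22.1 * p - 50.2 * p^2) * (1 + 24.1 * p + 290.4 * p^2)"
proof -
  have "(1 + 22.1 * p - 50.2 * p^2) * (1 + 24.1 * p + 290.4 * p^2) - (3 - 6 * p + 2 * p^2)
     = - 2 + 52.2 * p + 770.81 * p^2 + (5208.02 - 14578.08 * p) * p^3"
    by (simp add: power2_eq_square power3_eq_cube field_simps)
  also have "\<dots> \<ge> 0"
  \<comment> \<open>Up to \<open>0.3\<close> the term with \<open>p^3\<close> is nonnegative; beyond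
    it the quadratic part outweighs that term.\<close>
  proof (cases "p \<le> 0.3")
    case True
    have "(0.0277::real)^2 \<le> p^2" using assms by (intro power_mono) auto
    then have "0 \<le> - 2 + 52.2 * p + 770.81 * p^2" using assms(1) by (simp add: power2_eq_square field_simps)
    moreover have "0 \<le> (5208.02 - 14578.08 * p) * p^3" using True assms by (intro mult_nonneg_nonneg) auto
    ultimately show ?thesis by simp
  next
    case False
    define d where "d = (5208.02 - 14578.08 * p) * p^3"
    have "- 1778 \<le> 5208.02 - 14578.08 * p" using assms by simp
    then have 1: "- 1778 * p^3 \<le> d" unfolding d_def using assms by (intro mult_right_mono) auto
    have "p * p^2 \<le> 12/25 * p^2" using assms by (intro mult_right_mono) auto
    then have 2: "25 * p^3 \<le> 12 * p^2" by (simp add: power3_eq_cube power2_eq_square)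
    have "p * p \<le> 12/25 * p" using assms by (intro mult_right_mono) auto
    then have 3: "25 * p^2 \<le> 12 * p" by (simp add: power2_eq_square)
    have 4: "0 \<le> -2 + 52 * p + 770 * p^2 + d" using 1 2 3 False by linarith
    have "- 2 + 52 * p + 770 * p^2 \<le> - 2 + 52.2 * p + 770.81 * p^2"
      using assms by (intro add_mono mult_right_mono) auto
    then show ?thesis using 4 unfolding d_def by linarith
  qed
  finally show ?thesis by simp
qed

text \<open>In the variable \<open>x = ln T\<close> the bracket is a combination
  \<open>\<beta>\<close> of exponentials with at most linear coefficients. In the derivative the
  terms with \<open>M\<close>, \<open>f\<close> and \<open>1/2\<close> are nonpositive, and
  multiplying the others by \<open>2 * p^2 / exp (- s * x)\<close> leaves the inequality
  \<open>key\<close>.\<close>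

lemma bracket_antimono:
  assumes s: "0.5208 \<le> s" "s \<le> 0.9723" and T: "H0 \<le> T"
  shows "bracket s T \<le> bracket s H0"
proof -
  define p where "p = 1 - s"
  have sp: "s = 1 - p" and p: "0.0277 \<le> p" "p \<le> 0.4792" "p > 0" using s by (auto simp: p_def)
  define q where "q = 2 * s - 1"
  have q: "q > 0" "q = 1 - 2 * p" using s by (auto simp: q_def p_def)
  define M where "M = max 0 ((1 - 3 * s + 3 * s^2) / (2 * (1 - s)^2) - zetaR (2 * s) / 2)"
  have M: "M \<ge> 0" by (simp add: M_def)
  define a where "a = 1 / (2 * p)"
  define b where "b = q / (2 * p)"
  define d where "d = (1 + p) / (2 * p^2)"
  define e where "e = s / p^2"
  define f where "f = 1 / (2 * q)"
  note cdefs = a_def b_def d_def e_def f_def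
  define \<beta> where "\<beta> = (\<lambda>x. a * (x * exp (- (q * x))) - b * (x * exp (- x)) + M * exp (- x)
     + d * exp (- (q * x)) - e * exp (- (s * x)) + f * exp (- (2 * s * x)) + 1/2 * exp (- ((2 * s + 1) * x)))"
  define \<beta>' where "\<beta>' = (\<lambda>x. a * (exp (- (q * x)) - q * x * exp (- (q * x))) - b * (exp (- x) - x * exp (- x)) - M * exp (- x)
     - d * (q * exp (- (q * x))) + e * (s * exp (- (s * x))) - f * (2 * s * exp (- (2 * s * x))) - 1/2 * ((2 * s + 1) * exp (- ((2 * s + 1) * x))))"
  have br: "bracket s t = \<beta> (ln t)" if "t > 0" for t
  proof -
    have "t powr a = exp (a * ln t)" "1 / t = exp (- ln t)" for a using that by (auto simp: powr_def exp_minus inverse_eq_divide)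
    note pw = this
    have "bracket s t = ln t * t powr (- q) / (2 * p) - q * ln t * (1 / t) / (2 * p) + M * (1 / t)
     + (1 + p) * t powr (- q) / (2 * p^2) - s * t powr (-s) / p^2
     + t powr (-2 * s) / (2 * q) + t powr (-2 * s - 1) / 2"
      unfolding bracket_def M_def[symmetric] p_def q_def by simp
    then show ?thesis unfolding pw \<beta>_def cdefs by (simp add: algebra_simps)
  qed
  have deriv: "(\<beta> has_real_derivative \<beta>' x) (at x)" for x
  proof -
    have "((\<lambda>x. a * (x * exp (- (q * x))) - b * (x * exp (- x)) + M * exp (- x)
     + d * exp (- (q * x)) - e * exp (- (s * x)) + f * exp (- (u * x)) + h * exp (- (k * x))) has_real_derivative
      a * (exp (- (q * x)) - q * x * exp (- (q * x))) - b * (exp (- x) - x * exp (- x)) - M * exp (- x)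
     - d * (q * exp (- (q * x))) + e * (s * exp (- (s * x))) - f * (u * exp (- (u * x))) - h * (k * exp (- (k * x)))) (at x)"
     for a b M d e f h q s u k :: real
      by (auto intro!: derivative_eq_intros simp: algebra_simps)
    then show ?thesis unfolding \<beta>_def \<beta>'_def .
  qed
  have neg: "\<beta>' x \<le> 0" if "x \<ge> 24.1" for x
  proof -
    \<comment> \<open>\<open>E\<close> is the common factor: the exponentials with rates
      \<open>q\<close> and \<open>1\<close> are \<open>E * g\<close> and \<open>E / g\<close>, since
      \<open>q = s - p\<close> and \<open>1 = s + p\<close>.\<close>
    define E where "E = exp (- (s * x))"
    define g where "g = exp (p * x)"
    have e1: "exp (- (q * x)) = E * g" unfolding E_def g_def exp_add[symmetric] q sp by (simp add: algebra_simps)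
    have e2: "exp (- x) = E * (1 / g)" unfolding E_def g_def exp_minus[symmetric] inverse_eq_divide[symmetric] exp_add[symmetric] sp by (simp add: algebra_simps)
    have E: "E > 0" and g0: "g > 0" by (auto simp: E_def g_def)
    have px: "p * 24.1 \<le> p * x" using that p by (intro mult_left_mono) auto
    have g1: "g \<ge> 1 + 24.1 * p + 290.4 * p^2"
    proof -
      have "1 + 24.1 * p + 290.4 * p^2 \<le> 1 + (p * 24.1) + (p * 24.1)^2 / 2" by (simp add: power2_eq_square field_simps)
      also have "\<dots> \<le> exp (p * 24.1)" using p by (intro exp_lower_Taylor_quadratic) auto
      also have "\<dots> \<le> g" unfolding g_def using px by simp
      finally show ?thesis .
    qed
    have g2: "p * x \<le> g" unfolding g_def using exp_ge_add_one_self[of "p * x"] by linarith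
    define A where "A = p * (q * x - 1) + (1 + p) * q"
    have A: "1 + 22.1 * p - 50.2 * p^2 \<le> A"
    proof -
      have "p * (q * 24.1 - 1) + (1 + p) * q \<le> A" unfolding A_def using that p q by (intro add_right_mono mult_left_mono diff_right_mono) auto
      also have "p * (q * 24.1 - 1) + (1 + p) * q = 1 + 22.1 * p - 50.2 * p^2" unfolding q(2) by (simp add: power2_eq_square field_simps)
      finally show ?thesis .
    qed
    have A0: "0 \<le> 1 + 22.1 * p - 50.2 * p^2"
    proof -
      have "50.2 * p^2 \<le> 50.2 * (0.4792 * p)" using p by (simp add: power2_eq_square)
      then show ?thesis using p by (simp add: field_simps)
    qed
    have "3 - 6 * p + 2 * p^2 \<le> (1 + 22.1 * p - 50.2 * p^2) * (1 + 24.1 * p + 290.4 * p^2)" by (rule bracket_polynomial_le) (use p in auto)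
    also have "\<dots> \<le> A * g" using A A0 g1 p by (intro mult_mono) auto
    finally have AG: "3 - 6 * p + 2 * p^2 \<le> A * g" .
    have "q * p * (x - 1) * (1 / g) \<le> q"
    proof -
      have "q * (p * (x - 1)) \<le> q * g" using g2 p q by (intro mult_left_mono) (auto simp: algebra_simps)
      then show ?thesis using g0 by (simp add: field_simps)
    qed
    moreover have "2 * s^2 + q = 3 - 6 * p + 2 * p^2" unfolding q(2) sp by (simp add: power2_eq_square algebra_simps)
    ultimately have key: "2 * s^2 + q * p * (x - 1) * (1 / g) \<le> A * g" using AG by linarith
    have "\<beta>' x \<le> a * (exp (- (q * x)) - q * x * exp (- (q * x))) - b * (exp (- x) - x * exp (- x))
       - d * (q * exp (- (q * x))) + e * (s * exp (- (s * x)))"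
    proof -
      have "M * exp (- x) \<ge> 0" "f * (2 * s * exp (- (2 * s * x))) \<ge> 0" "1/2 * ((2 * s + 1) * exp (- ((2 * s + 1) * x))) \<ge> 0"
        using M s q by (auto simp: f_def)
      then show ?thesis unfolding \<beta>'_def by linarith
    qed
    also have "\<dots> = E / (2 * p^2) * (2 * s^2 + q * p * (x - 1) * (1 / g) - A * g)"
    proof -
      define k where "k = 1 / (2 * p^2)"
      have c: "a = p * k" "b = q * p * k" "d = (1 + p) * k" "e = 2 * s * k"
        unfolding cdefs k_def using p by (simp_all add: power2_eq_square)
      have K: "E / (2 * p^2) = E * k" by (simp add: k_def)
      have R: "p * k * (E * g - q * x * (E * g)) - q * p * k * (E * g' - x * (E * g')) - (1 + p) * k * (q * (E * g)) + 2 * s * k * (s * E)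
         = E * k * (2 * s^2 + q * p * (x - 1) * g' - (p * (q * x - 1) + (1 + p) * q) * g)" for g'
        by (simp add: power2_eq_square algebra_simps)
      show ?thesis unfolding e1 e2 E_def[symmetric] A_def c K by (rule R)
    qed
    also have "\<dots> \<le> 0" using key E p by (intro mult_nonneg_nonpos) auto
    finally show ?thesis .
  qed
  have "\<beta> (ln T) \<le> \<beta> (ln H0)"
  proof (rule DERIV_nonpos_imp_nonincreasing[where f = \<beta>])
    show "ln H0 \<le> ln T" using T by (subst ln_le_cancel_iff) (auto simp: H0_def)
    show "\<exists>y. (\<beta> has_real_derivative y) (at x) \<and> y \<le> 0" if "ln H0 \<le> x" for x
      using deriv neg[of x] ln_H0_ge that by (intro exI[of _ "\<beta>' x"]) auto
  qed
  then show ?thesis using br[of T] br[of H0] T by (simp add: H0_def)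
qed

text \<open>The bracket has terms of both signs; its own sign is read off from the nonnegative
  off-diagonal sum that it dominates.\<close>

lemma eps1_nonneg:
  assumes s: "0.5208 < s" "s < 0.9723" and H: "H < H0"
  shows "bracket s H0 \<ge> 0" "eps1 s H \<ge> 0"
proof -
  have "0 \<le> off_diagonal s H0"
    unfolding off_diagonal_def
    by (intro sum_nonneg divide_nonneg_nonneg mult_nonneg_nonneg ln_ge_zero) auto
  also have "\<dots> \<le> H0 * bracket s H0" by (rule off_diagonal_bracket) (use s in \<open>auto simp: H0_def\<close>)
  finally show b: "bracket s H0 \<ge> 0" by (simp add: zero_le_mult_iff H0_def)
  show "eps1 s H \<ge> 0" unfolding eps1_bracket using b H by (simp add: H0_def)
qed

lemma dpoly_mean_square_eps1:
  assumes s: "0.5208 < s" "s < 0.9723" and H: "1000 \<le> H" "H < H0" "H0 \<le> T"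
  shows "integral {H..T} (\<lambda>t. (norm (dpoly s t))^2) \<le> (T - H) * (zetaR (2 * s) + eps1 s H)"
proof -
  have T: "T \<ge> 1000" using H by simp
  have H0: "H0 > 0" by (simp add: H0_def)
  have "integral {H..T} (\<lambda>t. (norm (dpoly s t))^2) \<le> (T - H) * (\<Sum>n=1..nat \<lfloor>T\<rfloor>. real n powr (- 2 * s))
      + 4 * off_diagonal s T"
    by (rule dpoly_mean_square) (use H in auto)
  also have "\<dots> \<le> (T - H) * zetaR (2 * s) + 4 * (T * bracket s H0)"
  proof (intro add_mono mult_left_mono)
    have z: "(\<lambda>n. real (Suc n) powr (- (2 * s))) sums zetaR (2 * s)" by (rule zetaR_sums) (use s in auto)
    have "(\<Sum>n=1..nat \<lfloor>T\<rfloor>. real n powr (- 2 * s)) = (\<Sum>n<nat \<lfloor>T\<rfloor>. real (Suc n) powr (- (2 * s)))"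
      by (simp add: sum.atLeast1_atMost_eq)
    also have "\<dots> \<le> zetaR (2 * s)"
      using sum_le_suminf[OF sums_summable[OF z], of "{..<nat \<lfloor>T\<rfloor>}"] sums_unique[OF z] by simp
    finally show "(\<Sum>n=1..nat \<lfloor>T\<rfloor>. real n powr (- 2 * s)) \<le> zetaR (2 * s)" .
    have "off_diagonal s T \<le> T * bracket s T"
      by (rule off_diagonal_bracket) (use s T in auto)
    also have "\<dots> \<le> T * bracket s H0" using T bracket_antimono[of s T] s H by (intro mult_left_mono) auto
    finally show "off_diagonal s T \<le> T * bracket s H0" .
  qed (use H in auto)
  also have "4 * (T * bracket s H0) \<le> (T - H) * eps1 s H"
  proof -
    \<comment> \<open>\<open>T / (T - H)\<close> decreases in \<open>T\<close>; its value at
      \<open>H0\<close> is the factor \<open>H0 / (H0 - H)\<close> in \<open>eps1\<close>.\<close>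
    have "T * (H0 - H) \<le> (T - H) * H0" using mult_left_mono[of H0 T H] H by (simp add: algebra_simps)
    then have "T \<le> (T - H) * (H0 / (H0 - H))" using H by (simp add: field_simps)
    then have "T * (4 * bracket s H0) \<le> (T - H) * (H0 / (H0 - H)) * (4 * bracket s H0)"
      using eps1_nonneg(1)[OF s H(2)] by (intro mult_right_mono) auto
    moreover have "(T - H) * (4 * H0 / (H0 - H) * bracket s H0) = (T - H) * (H0 / (H0 - H)) * (4 * bracket s H0)" by simp
    moreover have "4 * (T * bracket s H0) = T * (4 * bracket s H0)" by simp
    ultimately show ?thesis unfolding eps1_bracket by (simp only:)
  qed
  finally show ?thesis by (simp add: algebra_simps)
qed

text \<open>\<open>eps2\<close> is \<open>c0^2\<close> times the average of the decreasing function
  \<open>t powr (- 2 * s)\<close> over \<open>{H..H0}\<close>. Extending the interval to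
  \<open>T\<close> can only lower the average, as the value \<open>h\<close> at \<open>H0\<close>
  separates the two pieces.\<close>

lemma eps2_bound:
  assumes s: "1/2 < s" "s < 1" and H: "0 < H" "H < H0" "H0 \<le> T"
  shows "((\<lambda>t. c0^2 * t powr (- 2 * s)) has_integral c0^2 * ((H powr (1 - 2 * s) - T powr (1 - 2 * s)) / (2 * s - 1))) {H..T}"
    and "c0^2 * ((H powr (1 - 2 * s) - T powr (1 - 2 * s)) / (2 * s - 1)) \<le> (T - H) * eps2 s H"
    and "eps2 s H > 0"
proof -
  define q where "q = 2 * s - 1"
  have q: "q > 0" using s by (simp add: q_def)
  have I: "((\<lambda>t. t powr (- 2 * s)) has_integral ((a powr (- q) - b powr (- q)) / q)) {a..b}" if "0 < a" "a \<le> b" for a b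
  proof -
    have "((\<lambda>t. t powr (- 2 * s)) has_integral (- (b powr (- q) / q) - (- (a powr (- q) / q)))) {a..b}"
    proof (rule fundamental_theorem_of_calculus[OF that(2)])
      fix x assume "x \<in> {a..b}"
      then have "x > 0" using that by auto
      then have "((\<lambda>t. - (t powr (- q) / q)) has_real_derivative - (- q * x powr (- q - 1) / q)) (at x)"
        by (auto intro!: derivative_eq_intros)
      moreover have "- (- q * x powr (- q - 1) / q) = x powr (- q - 1)" using q by simp
      moreover have "- q - 1 = - 2 * s" by (simp add: q_def)
      ultimately have "((\<lambda>t. - (t powr (- q) / q)) has_real_derivative x powr (- 2 * s)) (at x)" by simp
      then show "((\<lambda>t. - (t powr (- q) / q)) has_vector_derivative x powr (- 2 * s)) (at x within {a..b})"
        unfolding has_real_derivative_iff_has_vector_derivative by (rule has_vector_derivative_at_within)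
    qed
    then show ?thesis by (simp add: diff_divide_distrib)
  qed
  have e: "1 - 2 * s = - q" by (simp add: q_def)
  show "((\<lambda>t. c0^2 * t powr (- 2 * s)) has_integral c0^2 * ((H powr (1 - 2 * s) - T powr (1 - 2 * s)) / (2 * s - 1))) {H..T}"
    unfolding e q_def[symmetric] by (intro has_integral_mult_right I) (use H in auto)
  define h where "h = H0 powr (- 2 * s)"
  define \<phi> where "\<phi> = (H powr (- q) - H0 powr (- q)) / q"
  have "measure lborel {H..H0} *\<^sub>R h \<le> \<phi>"
    unfolding \<phi>_def
  proof (rule has_integral_le[OF has_integral_const_real I])
    show "h \<le> x powr (- 2 * s)" if "x \<in> {H..H0}" for x
      unfolding h_def using that H s by (intro powr_mono2') auto
  qed (use H in auto)
  then have A: "h * (H0 - H) \<le> \<phi>" using H by (simp add: mult.commute)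
  have "(H0 powr (- q) - T powr (- q)) / q \<le> measure lborel {H0..T} *\<^sub>R h"
  proof (rule has_integral_le[OF I has_integral_const_real])
    show "x powr (- 2 * s) \<le> h" if "x \<in> {H0..T}" for x
      unfolding h_def using that H s by (intro powr_mono2') auto
  qed (use H in auto)
  then have B: "(H0 powr (- q) - T powr (- q)) / q \<le> h * (T - H0)" using H by (simp add: mult.commute)
  from A B have "(H powr (- q) - T powr (- q)) / q \<le> \<phi> + (T - H0) * (\<phi> / (H0 - H))"
  proof -
    assume a: "h * (H0 - H) \<le> \<phi>" and b: "(H0 powr (- q) - T powr (- q)) / q \<le> h * (T - H0)"
    have "h \<le> \<phi> / (H0 - H)" using a H by (simp add: field_simps)
    then have "h * (T - H0) \<le> (\<phi> / (H0 - H)) * (T - H0)" using H by (intro mult_right_mono) auto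
    moreover have "(H powr (- q) - T powr (- q)) / q = \<phi> + (H0 powr (- q) - T powr (- q)) / q"
      by (simp add: \<phi>_def diff_divide_distrib)
    ultimately show ?thesis using b by (simp add: mult.commute)
  qed
  also have "\<dots> = (T - H) * (\<phi> / (H0 - H))"
  proof -
    have "\<phi> = (H0 - H) * (\<phi> / (H0 - H))" using H by simp
    then have "\<phi> + (T - H0) * (\<phi> / (H0 - H)) = (H0 - H) * (\<phi> / (H0 - H)) + (T - H0) * (\<phi> / (H0 - H))" by simp
    also have "\<dots> = (T - H) * (\<phi> / (H0 - H))" unfolding distrib_right[symmetric] by simp
    finally show ?thesis .
  qed
  finally have *: "(H powr (- q) - T powr (- q)) / q \<le> (T - H) * (\<phi> / (H0 - H))" .
  have e2: "eps2 s H = c0^2 * (\<phi> / (H0 - H))" unfolding eps2_def \<phi>_def q_def by simp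
  show "c0^2 * ((H powr (1 - 2 * s) - T powr (1 - 2 * s)) / (2 * s - 1)) \<le> (T - H) * eps2 s H"
    unfolding e q_def[symmetric] e2 using mult_left_mono[OF *, of "c0^2"] by (simp add: mult_ac)
  have "H0 powr (- q) < H powr (- q)" using H q by (intro powr_less_mono2_neg) auto
  then show "eps2 s H > 0" unfolding e2 \<phi>_def using H q by (simp add: c0_def)
qed

theorem zeta_mean_square:
  assumes s: "0.5208 < s" "s < 0.9723" and H: "1000 \<le> H" "H < H0" "H0 \<le> T"
  shows "integral {H..T} (\<lambda>t. (norm (zeta (Complex s t)))^2) \<le> (T - H) * (zetaR (2 * s) + E1 s H)"
    and "zetaR (2 * s) + E1 s H \<ge> 1"
proof -
  define Z where "Z = zetaR (2 * s) + eps1 s H"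
  define e where "e = eps2 s H"
  have s': "1/2 < s" "s < 1" using s by auto
  have Z: "Z \<ge> 1" using zetaR_ge(2)[of "2 * s"] eps1_nonneg(2)[OF s H(2)] s by (simp add: Z_def)
  have e: "e > 0" unfolding e_def by (rule eps2_bound(3)[OF s' _ H(2,3)]) (use H in auto)
  have E1: "zetaR (2 * s) + E1 s H = Z + e + 2 * sqrt (e * Z)"
    by (simp add: E1_def eps3_def Z_def e_def)
  then show "zetaR (2 * s) + E1 s H \<ge> 1" using Z e by (simp add: add_increasing2)
  \<comment> \<open>The minimiser of \<open>\<kappa> Z + e / \<kappa>\<close>. Both terms then equal
    \<open>sqrt (e * Z)\<close>, and their sum is \<open>eps3\<close>.\<close>
  define \<kappa> where "\<kappa> = sqrt (e / Z)"
  have \<kappa>: "\<kappa> > 0" using Z e by (simp add: \<kappa>_def)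
  have pt: "(norm (zeta (Complex s t)))^2 \<le> (1 + \<kappa>) * (norm (dpoly s t))^2 + (1 + 1 / \<kappa>) * (c0^2 * t powr (- 2 * s))"
    if t: "t \<in> {H..T}" for t
  proof -
    define x where "x = norm (dpoly s t)"
    define y where "y = c0 * t powr (- s)"
    have "norm (zeta (Complex s t)) \<le> x + norm (zeta (Complex s t) - dpoly s t)" unfolding x_def by (rule norm_triangle_sub)
    also have "norm (zeta (Complex s t) - dpoly s t) \<le> y"
      unfolding dpoly_def y_def by (rule zeta_approx) (use t H s in auto)
    finally have "(norm (zeta (Complex s t)))^2 \<le> (x + y)^2" by (intro power_mono) auto
    also have "(x + y)^2 \<le> (1 + \<kappa>) * x^2 + (1 + 1 / \<kappa>) * y^2"
    proof -
      have "0 \<le> (\<kappa> * x - y)^2 / \<kappa>" using \<kappa> by simp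
      also have "\<dots> = (1 + \<kappa>) * x^2 + (1 + 1 / \<kappa>) * y^2 - (x + y)^2"
        using \<kappa> by (simp add: field_simps power2_eq_square)
      finally show ?thesis by simp
    qed
    also have "y^2 = c0^2 * t powr (- 2 * s)"
      by (simp add: y_def power_mult_distrib power2_eq_square[of "t powr _"] powr_add[symmetric])
    finally show ?thesis by (simp add: x_def)
  qed
  have HT: "0 \<le> H" "H \<le> T" using H by auto
  have zi: "(\<lambda>t. (norm (zeta (Complex s t)))^2) integrable_on {H..T}"
  proof (intro integrable_continuous_real continuous_intros)
    show "continuous_on {H..T} (\<lambda>t. zeta (Complex s t))"
      by (rule continuous_on_compose2[OF holomorphic_on_imp_continuous_on[OF zeta_holomorphic]])
        (use H s in \<open>auto intro!: continuous_intros simp: complex_eq_iff\<close>)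
  qed
  note D = dpoly_mean_square(1)[OF HT, of s]
  note R = eps2_bound(1)[OF s' _ H(2,3)]
  have H1: "0 < H" using H by simp
  have "integral {H..T} (\<lambda>t. (norm (zeta (Complex s t)))^2) \<le>
     (1 + \<kappa>) * integral {H..T} (\<lambda>t. (norm (dpoly s t))^2) + (1 + 1 / \<kappa>) * (c0^2 * ((H powr (1 - 2 * s) - T powr (1 - 2 * s)) / (2 * s - 1)))"
    by (rule has_integral_le[OF integrable_integral[OF zi]
          has_integral_add[OF has_integral_mult_right[OF integrable_integral[OF D]] has_integral_mult_right[OF R[OF H1]]]])
      (rule pt)
  also have "\<dots> \<le> (1 + \<kappa>) * ((T - H) * Z) + (1 + 1 / \<kappa>) * ((T - H) * e)"
    unfolding Z_def e_def using \<kappa> H1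
    by (intro add_mono mult_left_mono dpoly_mean_square_eps1 s H eps2_bound(2)[OF s' _ H(2,3)]) auto
  also have "\<dots> = (T - H) * (Z + e + (\<kappa> * Z + e / \<kappa>))"
  proof -
    have "(1 + k) * (W * Z) + (1 + 1 / k) * (W * e) = W * (Z + e + (k * Z + e / k))" for k W :: real
      by (simp add: algebra_simps)
    then show ?thesis .
  qed
  also have "\<kappa> * Z = sqrt (e * Z)"
  proof -
    have "\<kappa> * Z = sqrt (e / Z) * sqrt (Z * Z)" using Z by (simp add: \<kappa>_def)
    also have "\<dots> = sqrt (e * Z)" unfolding real_sqrt_mult[symmetric] using Z by simp
    finally show ?thesis .
  qed
  also have "e / \<kappa> = sqrt (e * Z)"
  proof -
    have "e / \<kappa> = sqrt (e * e) / sqrt (e / Z)" using e by (simp add: \<kappa>_def)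
    also have "\<dots> = sqrt (e * Z)" unfolding real_sqrt_divide[symmetric] using e Z by simp
    finally show ?thesis .
  qed
  finally show "integral {H..T} (\<lambda>t. (norm (zeta (Complex s t)))^2) \<le> (T - H) * (zetaR (2 * s) + E1 s H)"
    unfolding E1 by (simp add: algebra_simps)
qed

section \<open>The zero density estimate\<close>

lemma edge_int_minus:
  assumes "0 < r" "t \<noteq> 0"
  shows "edge_int r X (- t) = - edge_int r X t"
proof -
  have "integral {r..X} (\<lambda>x. - (x - r) * Im (zquot x (- t))) = integral {r..X} (\<lambda>x. - (- (x - r) * Im (zquot x t)))"
    by (rule integral_cong) (use assms in \<open>simp add: zquot_minus\<close>)
  then show ?thesis unfolding edge_int_def by simp
qed

text \<open>The bottom side enters with the opposite orientation. Conjugation makes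
  \<open>edge_int\<close> odd in the height, so \<open>- edge_int s X H\<close> is the integral at
  \<open>- H\<close>, and the same one-sided strip bound covers both sides. The final
  \<open>1\<close> pays for the right side, by the third condition on \<open>X\<close>.\<close>

lemma littlewood:
  assumes s: "0.52 \<le> s" "s \<le> 0.9723" and H: "1000 \<le> H" "H < T"
    and X: "X \<ge> 12" "X * 2 powr (- X) \<le> 1/50" "T * (X * 2 powr (- X)) \<le> 1/20"
    and nz_low: "\<And>x t. 1/2 < x \<Longrightarrow> 0 < \<bar>t\<bar> \<Longrightarrow> \<bar>t\<bar> \<le> H \<Longrightarrow> zeta (Complex x t) \<noteq> 0"
    and nz_top: "\<And>x t. x \<in> {s..X} \<Longrightarrow> t \<in> {T, T + 2} \<Longrightarrow> zeta (Complex x t) \<noteq> 0"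
    and nz_left: "\<And>t. t \<in> {H..T+2} \<Longrightarrow> zeta (Complex s t) \<noteq> 0"
  shows "2 * pi * (\<Sum>z | z \<in> box (Complex s H) (Complex X T) \<and> zeta z = 0. (Re z - s) * real (zero_mult zeta z))
    \<le> integral {H..T} (zlog s) + (1.13 * (3/2 - s) * (ln (T + 2) + ln H) + 140 * (3/2 - s)) + 1"
    and "finite {z. z \<in> box (Complex s H) (Complex X T) \<and> zeta z = 0}"
    and "continuous_on {H..T} (zlog s)"
proof -
  have "zeta_strip s T X (T + 2)"
    by unfold_locales (use s H X nz_top nz_left in auto)
  then have top: "edge_int s X T \<le> 1.13 * (3/2 - s) * ln (T + 2) + 70 * (3/2 - s)" by (rule zeta_strip.edge_bound)
  have "zeta_strip s (- H) X H"
    by unfold_locales (use s H X nz_low in auto)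
  then have "edge_int s X (- H) \<le> 1.13 * (3/2 - s) * ln H + 70 * (3/2 - s)" by (rule zeta_strip.edge_bound)
  then have bot: "- edge_int s X H \<le> 1.13 * (3/2 - s) * ln H + 70 * (3/2 - s)"
    using edge_int_minus[of s H X] s H by simp
  define h where "h = (\<lambda>z::complex. z - of_real s)"
  define h' where "h' = (\<lambda>z::complex. 1::complex)"
  have nzX: "zeta (Complex X t) \<noteq> 0" for t using zeta_nonzero_Re_gt_1[of "Complex X t"] X by simp
  have hd: "(h has_field_derivative h' z) (at z)" for z unfolding h_def h'_def by (auto intro!: derivative_eq_intros)
  have p: "0 < s" "s < X" "H < T" "0 < H \<or> T < 0" using s H X by auto
  have c: "continuous_on UNIV h'" unfolding h'_def by (rule continuous_on_const)
  have n1: "zeta (Complex x t) \<noteq> 0" if "x \<in> {s..X}" "t \<in> {H, T}" for x t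
    using nz_low[of x H] nz_top[of x t] that s H by auto
  have n2: "zeta (Complex x t) \<noteq> 0" if "x \<in> {s, X}" "t \<in> {H..T}" for x t
    using nz_left[of t] nzX[of t] that by auto
  note G = zeta_green[OF p hd c n1 n2]
  show "finite {z. z \<in> box (Complex s H) (Complex X T) \<and> zeta z = 0}" by (rule G(2))
  have hor: "green_hor zeta h h' s X t = edge_int s X t" for t
    unfolding green_hor_def edge_int_def zquot_def h_def h'_def by simp
  have left: "green_ver zeta h h' H T s = - integral {H..T} (zlog s)"
    unfolding green_ver_def zlog_def h_def h'_def by simp
  have right: "green_ver zeta h h' H T X \<le> 1"
  proof -
    have c: "continuous_on {H..T} (zlog X)" "continuous_on {H..T} (zquot X)"
      by (rule zeta_vsegment_cont; use H X nzX in auto)+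
    have "green_ver zeta h h' H T X = integral {H..T} (\<lambda>t. (X - s) * Re (zquot X t) - zlog X t)"
      unfolding green_ver_def zlog_def zquot_def h_def h'_def by simp
    also have "\<dots> \<le> integral {H..T} (\<lambda>t. 14 * (X * 2 powr (- X)))"
    proof (rule integral_mono_real)
      fix t
      have q: "\<bar>Re (zquot X t)\<bar> \<le> 9 * 2 powr (- X)"
        using norm_zquot_le_powr[of X t] abs_Re_le_cmod[of "zquot X t"] X by linarith
      have l: "\<bar>zlog X t\<bar> \<le> 4.4 * 2 powr (- X)" using abs_zlog_le_powr X by simp
      have "(X - s) * Re (zquot X t) \<le> (X - s) * (9 * 2 powr (- X))" using q X s by (intro mult_left_mono) auto
      also have "\<dots> \<le> X * (9 * 2 powr (- X))" using s by (intro mult_right_mono) auto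
      finally have "(X - s) * Re (zquot X t) - zlog X t \<le> 9 * (X * 2 powr (- X)) + 4.4 * 2 powr (- X)" using l by (simp add: abs_le_iff)
      also have "\<dots> \<le> 9 * (X * 2 powr (- X)) + 5 * (X * 2 powr (- X))"
        using X by (intro add_left_mono mult_mono) auto
      finally show "(X - s) * Re (zquot X t) - zlog X t \<le> 14 * (X * 2 powr (- X))" by simp
    qed (auto intro!: continuous_intros c)
    also have "\<dots> = (T - H) * (14 * (X * 2 powr (- X)))" using H by simp
    also have "\<dots> \<le> T * (14 * (X * 2 powr (- X)))" using H X by (intro mult_right_mono) auto
    also have "\<dots> \<le> 1" using X(3) by simp
    finally show ?thesis .
  qed
  have reh: "Re (h z) = Re z - s" for z by (simp add: h_def)
  show "2 * pi * (\<Sum>z | z \<in> box (Complex s H) (Complex X T) \<and> zeta z = 0. (Re z - s) * real (zero_mult zeta z))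
    \<le> integral {H..T} (zlog s) + (1.13 * (3/2 - s) * (ln (T + 2) + ln H) + 140 * (3/2 - s)) + 1"
    using G(1)[unfolded hor left reh] top bot right unfolding distrib_left by linarith
  show "continuous_on {H..T} (zlog s)"
    by (rule zeta_vsegment_cont(1)) (use H s nz_left in auto)
qed

text \<open>Carries the mean-square bound from \<open>\<sigma>0\<close> to a nearby line without
  zeros.\<close>

lemma mean_square_continuous:
  assumes "0 < a" "a \<le> b" "0 < H"
  shows "continuous_on {a..b} (\<lambda>x. integral {H..T} (\<lambda>t. (norm (zeta (Complex x t)))^2))"
proof -
  have "continuous_on {a..b} (\<lambda>x. integral (cbox H T) (\<lambda>t. (norm (zeta (Complex x t)))^2))"
  proof (rule integral_continuous_on_param)
    have "continuous_on ({a..b} \<times> cbox H T) (\<lambda>p. zeta (Complex (fst p) (snd p)))"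
      by (rule continuous_on_compose2[OF holomorphic_on_imp_continuous_on[OF zeta_holomorphic]])
        (use assms in \<open>auto intro!: continuous_intros simp: complex_eq_iff\<close>)
    then show "continuous_on ({a..b} \<times> cbox H T) (\<lambda>(x, t). (norm (zeta (Complex x t)))^2)"
      unfolding case_prod_beta by (intro continuous_intros)
  qed
  then show ?thesis by simp
qed

lemma ex_avoid_finite:
  fixes a b :: real
  assumes "a < b" "finite F"
  obtains x where "a < x" "x < b" "x \<notin> F"
proof -
  have "infinite ({a<..<b} - F)" using assms by (simp add: Diff_infinite_finite infinite_Ioo)
  then obtain x where "x \<in> {a<..<b} - F" by (metis finite.emptyI ex_in_conv)
  then show ?thesis using that[of x] by simp
qed

text \<open>The quadratic Taylor term of \<open>exp (ln 2 * X)\<close> with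
  \<open>ln 2 \<ge> 2/3\<close>. Decay like \<open>1 / X\<close> is enough, because \<open>X\<close>
  may be taken proportional to \<open>T\<close>.\<close>

lemma two_powr_bound:
  assumes "(X::real) > 0"
  shows "X * 2 powr (- X) \<le> 9 / (2 * X)"
proof -
  have l: "2/3 * X \<le> ln 2 * X" using ln2_ge_two_thirds assms by (intro mult_right_mono) auto
  have "(2/3 * X)^2 / 2 \<le> 1 + 2/3 * X + (2/3 * X)^2 / 2" using assms by simp
  also have "\<dots> \<le> exp (2/3 * X)" using assms by (intro exp_lower_Taylor_quadratic) auto
  also have "\<dots> \<le> exp (ln 2 * X)" using l by simp
  also have "\<dots> = 2 powr X" by (simp add: powr_def mult.commute)
  finally have "2/9 * X^2 \<le> 2 powr X" by (simp add: power2_eq_square)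
  then have le: "X / 2 powr X \<le> X / (2/9 * X^2)" using assms by (intro divide_left_mono) auto
  have "X * 2 powr (- X) = X / 2 powr X" by (simp add: powr_minus_divide)
  moreover have "X / (2/9 * X^2) = 9 / (2 * X)" using assms by (simp add: power2_eq_square)
  ultimately show ?thesis using le by (simp only:)
qed

section \<open>Numerical size of \<open>E3\<close> and \<open>E4\<close>\<close>

lemma pi_div_ln2: "pi / ln 2 \<ge> 4.52"
proof -
  have "4.52 * ln 2 \<le> 4.52 * (25/36 :: real)" using ln2_le_25_over_36 by (intro mult_left_mono) auto
  also have "\<dots> \<le> pi" using pi_approx(1) by simp
  finally show ?thesis by (simp add: field_simps)
qed

lemma E3_ge:
  assumes "s \<le> 3/2"
  shows "E3 s \<ge> 1.13 * (sigma1 - s)"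
proof -
  have "E3 s = (pi / ln 2) * ((1 + 2 * eta) / 4) * (sigma1 - s)" by (simp add: E3_def)
  also have "\<dots> \<ge> 4.52 * (1 / 4) * (sigma1 - s)"
    using pi_div_ln2 assms by (intro mult_right_mono mult_mono) (auto simp: eta_def sigma1_def)
  finally show ?thesis by simp
qed

text \<open>The size comes from \<open>zetaR (1 + eta)\<close>, which is at least
  \<open>1 / eta = 10^4\<close> and enters to the fourth power. The logarithm is then at least
  \<open>34\<close>, and \<open>4.52 * 34\<close> exceeds \<open>153\<close>.\<close>

lemma E4_ge:
  assumes "s \<le> 3/2" "1000 \<le> H"
  shows "E4 s H \<ge> 153 * (sigma1 - s)"
proof -
  define b where "b = (3*(1 + eta)/H + 1) / (2*pi)"
  define Q where "Q = 3 * ((H + 3*(1 + eta)) / (H - (1 + 2*eta))) * b powr ((1 + 2*eta)/2)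
          * zetaR (1 + eta)^4 / zetaR (2*(1 + eta))^2"
  have b: "b \<ge> 1 / 6.3" "b \<le> 1" "b > 0"
  proof -
    have h: "0 \<le> 3*(1 + eta)/H" "3*(1 + eta)/H \<le> 1" using assms by (auto simp: eta_def divide_le_eq)
    have p: "2 * pi \<le> 6.3" "2 * pi \<ge> 2" using pi_approx by auto
    show "b \<ge> 1 / 6.3" unfolding b_def using h p by (intro frac_le) auto
    then show "b > 0" by (rule less_le_trans[rotated]) simp
    have "3*(1 + eta)/H + 1 \<le> 2*pi" using h p by linarith
    then show "b \<le> 1" unfolding b_def by simp
  qed
  have bp: "1 / 6.3 \<le> b powr ((1 + 2*eta)/2)"
  proof -
    have "1 / 6.3 \<le> b powr 1" using b by simp
    also have "\<dots> \<le> b powr ((1 + 2*eta)/2)" using b by (intro powr_mono') (auto simp: eta_def)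
    finally show ?thesis .
  qed
  have r: "1 \<le> (H + 3*(1 + eta)) / (H - (1 + 2*eta))" using assms by (simp add: eta_def le_divide_eq)
  have z1: "10000 \<le> zetaR (1 + eta)" using zetaR_ge(1)[of "1 + eta"] by (simp add: eta_def)
  have z2: "zetaR (2*(1 + eta)) \<le> 2" "zetaR (2*(1 + eta)) \<ge> 1"
  proof -
    have "zetaR (2*(1 + eta)) \<le> (2*(1 + eta)) / (2*(1 + eta) - 1)" by (rule zetaR_le) (simp add: eta_def)
    also have "\<dots> \<le> 2" by (simp add: eta_def divide_le_eq)
    finally show "zetaR (2*(1 + eta)) \<le> 2" .
    show "zetaR (2*(1 + eta)) \<ge> 1" by (rule zetaR_ge(2)) (simp add: eta_def)
  qed
  have "3 * 1 * (1 / 6.3) * 10000^4 / 2^2 \<le> Q"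
  proof -
    have "3 * 1 * (1 / 6.3) * 10000^4 / 2^2 \<le> 3 * r * c * z^4 / w^2"
      if "1 \<le> r" "1 / 6.3 \<le> c" "10000 \<le> z" "1 \<le> w" "w \<le> 2" for r c z w :: real
    proof -
      have "0 \<le> c" using that(2) by (rule order_trans[rotated]) simp
      then show ?thesis using that by (intro frac_le mult_mono power_mono mult_nonneg_nonneg zero_le_power) auto
    qed
    from this[OF r bp z1 z2(2,1)] show ?thesis unfolding Q_def .
  qed
  moreover have "exp (34::real) \<le> 3 * 1 * (1 / 6.3) * 10000^4 / 2^2"
  proof -
    have "exp (34::real) = exp 1 ^ 34" by (simp flip: exp_of_nat_mult)
    also have "\<dots> \<le> 2.72 ^ 34" using e_less_272 by (intro power_mono) auto
    also have "\<dots> \<le> 3 * 1 * (1 / 6.3) * 10000^4 / 2^2" by (simp add: power_divide)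
    finally show ?thesis .
  qed
  ultimately have "exp 34 \<le> Q" by (rule order_trans[rotated])
  then have "ln (exp 34) \<le> ln Q" by (subst ln_le_cancel_iff) (auto intro: less_le_trans[OF exp_gt_zero])
  then have lq: "34 \<le> ln Q" by simp
  have "153 * (sigma1 - s) \<le> (4.52 * 34) * (sigma1 - s)" using assms by (intro mult_right_mono) (auto simp: sigma1_def eta_def)
  also have "\<dots> \<le> (pi / ln 2 * ln Q) * (sigma1 - s)"
    using pi_div_ln2 lq assms by (intro mult_right_mono mult_mono) (auto simp: sigma1_def eta_def)
  also have "\<dots> = pi * (sigma1 - s) / ln 2 * ln Q" by simp
  also have "\<dots> = E4 s H" unfolding E4_def Q_def b_def by (rule refl)
  finally show ?thesis .
qed

text \<open>The tangent to the logarithm is taken at the mean value \<open>A\<close>. The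
  \<open>+ 1\<close> in the mean-square hypothesis is the price of moving the left side, and
  \<open>A \<ge> 1\<close> turns it into \<open>1/2\<close>.\<close>

lemma zlog_integral_le:
  assumes A: "A \<ge> 1" and HT: "H < T" and s: "s > 0" "H > 0"
    and c: "continuous_on {H..T} (zlog s)" and nz: "\<And>t. t \<in> {H..T} \<Longrightarrow> zeta (Complex s t) \<noteq> 0"
    and M: "integral {H..T} (\<lambda>t. (norm (zeta (Complex s t)))^2) \<le> (T - H) * A + 1"
  shows "integral {H..T} (zlog s) \<le> (T - H) / 2 * ln A + 1/2"
proof -
  have zc: "continuous_on {H..T} (\<lambda>t. (norm (zeta (Complex s t)))^2)"
    by (intro continuous_intros continuous_on_compose2[OF holomorphic_on_imp_continuous_on[OF zeta_holomorphic]])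
      (use s in \<open>auto simp: complex_eq_iff\<close>)
  have "integral {H..T} (zlog s) \<le> integral {H..T} (\<lambda>t. (ln A - 1) / 2 + 1 / (2 * A) * (norm (zeta (Complex s t)))^2)"
  proof (rule integral_mono_real[OF c])
    show "continuous_on {H..T} (\<lambda>t. (ln A - 1) / 2 + 1 / (2 * A) * (norm (zeta (Complex s t)))^2)"
      by (intro continuous_intros zc)
    fix t assume t: "t \<in> {H..T}"
    define w where "w = norm (zeta (Complex s t))"
    have w: "w > 0" using nz[OF t] by (simp add: w_def)
    have "ln (w^2 / A) \<le> w^2 / A - 1" using w A by (intro ln_le_minus_one) auto
    then have "2 * ln w - ln A \<le> w^2 / A - 1" using w A by (simp add: ln_div ln_realpow)
    moreover have "1 / (2 * A) * w^2 = (w^2 / A) / 2" by simp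
    ultimately have "ln w \<le> (ln A - 1) / 2 + 1 / (2 * A) * w^2" by argo
    then show "zlog s t \<le> (ln A - 1) / 2 + 1 / (2 * A) * (norm (zeta (Complex s t)))^2"
      by (simp add: zlog_def w_def)
  qed
  also have "\<dots> = (T - H) * ((ln A - 1) / 2) + 1 / (2 * A) * integral {H..T} (\<lambda>t. (norm (zeta (Complex s t)))^2)"
  proof (rule integral_unique)
    have "((\<lambda>t. (ln A - 1) / 2) has_integral (T - H) * ((ln A - 1) / 2)) {H..T}"
      using has_integral_const_real[of "(ln A - 1) / 2" H T] HT by simp
    then show "((\<lambda>t. (ln A - 1) / 2 + 1 / (2 * A) * (norm (zeta (Complex s t)))^2) has_integral
       ((T - H) * ((ln A - 1) / 2) + 1 / (2 * A) * integral {H..T} (\<lambda>t. (norm (zeta (Complex s t)))^2))) {H..T}"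
      by (intro has_integral_add has_integral_mult_right integrable_integral integrable_continuous_real zc)
  qed
  also have "\<dots> \<le> (T - H) * ((ln A - 1) / 2) + 1 / (2 * A) * ((T - H) * A + 1)"
    using A by (intro add_left_mono mult_left_mono M) auto
  also have "\<dots> = (T - H) / 2 * ln A + 1 / (2 * A)"
  proof -
    have "W * ((l - 1) / 2) + 1 / (2 * A) * (W * A + 1) = W / 2 * l + 1 / (2 * A)" for W l
    proof -
      have "1 / (2 * A) * (W * A + 1) = W / 2 + 1 / (2 * A)" using A by (simp add: distrib_left)
      then show ?thesis by (simp add: right_diff_distrib diff_divide_distrib)
    qed
    then show ?thesis .
  qed
  also have "\<dots> \<le> (T - H) / 2 * ln A + 1/2" using A by simp
  finally show ?thesis .
qed

text \<open>Used with \<open>u = 3/2 - s\<close>, \<open>y = sigma1 - \<sigma>0\<close> and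
  \<open>q = ln (T * H)\<close>. Since \<open>y \<ge> 1/2\<close>, the \<open>153 y\<close> covers
  \<open>140 u\<close>, the \<open>1.13 y\<close> caused by \<open>l \<le> q + 1\<close>, and the
  final \<open>2\<close>.\<close>

lemma edge_budget:
  fixes u y l q e3 e4 :: real
  assumes "0 \<le> u" "u \<le> y" "1/2 \<le> y" "0 \<le> q" "l \<le> q + 1" "1.13 * y \<le> e3" "153 * y \<le> e4"
  shows "1.13 * u * l + 140 * u + 2 \<le> e3 * q + e4"
proof -
  have "1.13 * u * l \<le> 1.13 * u * (q + 1)" using assms by (intro mult_left_mono) auto
  also have "\<dots> \<le> 1.13 * y * (q + 1)" using assms by (intro mult_right_mono) auto
  also have "\<dots> = 1.13 * y * q + 1.13 * y" by (simp only: distrib_left mult_1_right)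
  also have "\<dots> \<le> e3 * q + 2 * y" using assms by (intro add_mono mult_right_mono) auto
  finally have "1.13 * u * l \<le> e3 * q + 2 * y" .
  then show ?thesis using assms(2,3,7) by linarith
qed

theorem theorem1:
  fixes \<sigma> T \<sigma>0 H :: real
  assumes RH_H0: "\<And>\<rho>. zeta \<rho> = 0 \<Longrightarrow> 0 < Re \<rho> \<Longrightarrow> Re \<rho> < 1 \<Longrightarrow> 0 < Im \<rho> \<Longrightarrow> Im \<rho> \<le> H0
                     \<Longrightarrow> Re \<rho> = 1/2"
    and "0.55 \<le> \<sigma>" and "\<sigma> \<le> 1" and "H0 \<le> T"
    and "0.5208 < \<sigma>0" and "\<sigma>0 < 0.9723" and "\<sigma>0 < \<sigma>"
    and "1000 \<le> H" and "H < H0"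
  shows "real (N_zeros \<sigma> T) \<le>
           ln (zetaR (2*\<sigma>0) + E1 \<sigma>0 H) / (4 * pi * (\<sigma> - \<sigma>0)) * (T - H)
         + E3 \<sigma>0 / (2 * pi * (\<sigma> - \<sigma>0)) * ln (T * H)
         + (E2 + E4 \<sigma>0 H) / (2 * pi * (\<sigma> - \<sigma>0))"
proof -
  note sg = assms(2,3) and s0 = assms(5,6,7) and HT = assms(8,9,4)
  have HH: "1000 \<le> H" "H < H0" "H0 \<le> T" "H < T" "1000 < T" using HT by auto
  define A where "A = zetaR (2 * \<sigma>0) + E1 \<sigma>0 H"
  have A: "A \<ge> 1" unfolding A_def by (rule zeta_mean_square(2)[OF s0(1,2) HH(1-3)])
  have nz_low: "zeta (Complex x t) \<noteq> 0" if "1/2 < x" "0 < \<bar>t\<bar>" "\<bar>t\<bar> \<le> H0" for x t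
  proof
    assume z: "zeta (Complex x t) = 0"
    then have z': "zeta (Complex x \<bar>t\<bar>) = 0" using zeta_abs_Im[of x t] that by simp
    consider "x < 1" | "x = 1" | "x > 1" by linarith
    then show False
    proof cases
      case 1
      then show False using RH_H0[OF z'] that by simp
    next
      case 2
      then show False using zeta_nonzero_Re_1[of t] z that by simp
    next
      case 3
      then show False using zeta_nonzero_Re_gt_1[of "Complex x t"] z by simp
    qed
  qed
  define Zs where "Zs = {\<rho>. \<rho> \<noteq> 1 \<and> \<sigma> \<le> Re \<rho> \<and> Re \<rho> \<le> 1 \<and> 0 \<le> Im \<rho> \<and> Im \<rho> \<le> T \<and> zeta \<rho> = 0}"
  \<comment> \<open>This places the counted zeros above the side \<open>Im z = H\<close>. Real
    points have to be treated separately: the hypothesis on zeros requires a positive imaginary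
    part.\<close>
  have Zs_Im: "Im \<rho> > H0" if "\<rho> \<in> Zs" for \<rho>
  proof (rule ccontr)
    assume n: "\<not> Im \<rho> > H0"
    have r: "\<rho> \<noteq> 1" "\<sigma> \<le> Re \<rho>" "Re \<rho> \<le> 1" "0 \<le> Im \<rho>" "zeta \<rho> = 0" using that by (auto simp: Zs_def)
    show False
    proof (cases "Im \<rho> = 0")
      case True
      then have e: "\<rho> = of_real (Re \<rho>)" by (simp add: complex_eq_iff)
      then have "Re \<rho> < 1" using r by (metis less_eq_real_def of_real_1)
      then have "zetaR (Re \<rho>) < 0" using r sg by (intro zeta_real_neg) auto
      moreover have "zetaR (Re \<rho>) = 0" unfolding zetaR_def e[symmetric] r(5) by simp
      ultimately show False by simp
    next
      case False
      then show False using nz_low[of "Re \<rho>" "Im \<rho>"] r n sg by simp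
    qed
  qed
  \<comment> \<open>Proportional to \<open>T\<close>, so that the decay \<open>9 / (2 * X)\<close>
    of \<open>two_powr_bound\<close> beats the length of the right side.\<close>
  define X where "X = 600 * (T + 1)"
  have X: "X \<ge> 12" "X * 2 powr (- X) \<le> 1/50" "(T + 1) * (X * 2 powr (- X)) \<le> 1/20"
  proof -
    show X12: "X \<ge> 12" using HH by (simp add: X_def)
    have b: "X * 2 powr (- X) \<le> 9 / (2 * X)" by (rule two_powr_bound) (use X12 in simp)
    have "9 / (2 * X) \<le> 1/50" using HH by (simp add: X_def field_simps)
    with b show "X * 2 powr (- X) \<le> 1/50" by linarith
    have "(T + 1) * (X * 2 powr (- X)) \<le> (T + 1) * (9 / (2 * X))" using b HH by (intro mult_left_mono) auto
    also have "\<dots> \<le> 1/20" using HH by (simp add: X_def field_simps)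
    finally show "(T + 1) * (X * 2 powr (- X)) \<le> 1/20" .
  qed
  \<comment> \<open>A compact region containing every zero that the chosen sides could meet,
    including those at height \<open>T' + 2\<close>.\<close>
  define F where "F = {z \<in> cbox (Complex (1/2) 1) (Complex X (T + 3)). zeta z = 0}"
  have F: "finite F" unfolding F_def
    by (rule finite_zeta_zeros) (auto simp: in_cbox_complex_iff)
  have inF: "Complex x t \<in> F" if "zeta (Complex x t) = 0" "1/2 \<le> x" "x \<le> X" "1 \<le> t" "t \<le> T + 3" for x t
    using that by (auto simp: F_def in_cbox_complex_iff)
  \<comment> \<open>Chosen so that lengthening the left side by \<open>\<tau>\<close> adds at most
    \<open>1/2\<close> to the integral bound, whatever the size of \<open>A\<close>.\<close>
  define \<tau> where "\<tau> = 1 / (1 + ln A)"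
  have \<tau>: "\<tau> > 0" "\<tau> \<le> 1" "\<tau> * ln A \<le> 1"
  proof -
    have "ln A \<ge> 0" using A by simp
    then show "\<tau> > 0" "\<tau> \<le> 1" "\<tau> * ln A \<le> 1" by (simp_all add: \<tau>_def)
  qed
  \<comment> \<open>Both \<open>T'\<close> and \<open>T' + 2\<close> must avoid the heights of
    zeros, since the strip above the rectangle has its far side at \<open>T' + 2\<close>.\<close>
  obtain T' where T': "T < T'" "T' < T + \<tau>" "T' \<notin> Im ` F \<union> (\<lambda>z. Im z - 2) ` F"
    by (rule ex_avoid_finite[of T "T + \<tau>" "Im ` F \<union> (\<lambda>z. Im z - 2) ` F"]) (use \<tau>(1) F in simp_all)
  define Ms where "Ms = (\<lambda>x. integral {H..T'} (\<lambda>t. (norm (zeta (Complex x t)))^2))"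
  have "continuous_on {1/2..1} Ms" unfolding Ms_def by (rule mean_square_continuous) (use HH in auto)
  then have "isCont Ms \<sigma>0" by (rule continuous_on_interior) (use s0 in auto)
  then obtain \<delta> where \<delta>: "\<delta> > 0" "\<And>x. \<bar>x - \<sigma>0\<bar> < \<delta> \<Longrightarrow> \<bar>Ms x - Ms \<sigma>0\<bar> < 1"
    unfolding continuous_at_eps_delta dist_real_def using zero_less_one by blast
  \<comment> \<open>The shift stays below the excess \<open>0.0002\<close> of \<open>sigma1\<close>
    over \<open>3/2\<close>, so that \<open>3/2 - s \<le> sigma1 - \<sigma>0\<close> still holds;
    \<open>\<delta>\<close> keeps the change of the mean square below \<open>1\<close>.\<close>
  obtain s where s: "\<sigma>0 - min \<delta> 0.0001 < s" "s < \<sigma>0" "s \<notin> Re ` F"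
    by (rule ex_avoid_finite[of "\<sigma>0 - min \<delta> 0.0001" \<sigma>0 "Re ` F"]) (use \<delta>(1) F in simp_all)
  have sr: "0.52 \<le> s" "s \<le> 0.9723" "\<sigma>0 - s \<le> 0.0001" "\<sigma>0 - s < \<delta>" using s s0 by auto
  have T'2: "T' \<le> T + 1" using T' \<tau> by simp
  have nz_top: "zeta (Complex x t) \<noteq> 0" if "x \<in> {s..X}" "t \<in> {T', T' + 2}" for x t
  proof
    assume "zeta (Complex x t) = 0"
    then have "Complex x t \<in> F" by (rule inF) (use that sr T'(1) T'2 HH in auto)
    then have "t \<in> Im ` F" "t - 2 \<in> (\<lambda>z. Im z - 2) ` F" by (auto intro: rev_image_eqI)
    then show False using T'(3) that(2) by auto
  qed
  have nz_left: "zeta (Complex s t) \<noteq> 0" if "t \<in> {H..T' + 2}" for t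
  proof
    assume "zeta (Complex s t) = 0"
    then have "Complex s t \<in> F" by (rule inF) (use that sr T'2 HH X in auto)
    then have "s \<in> Re ` F" by (auto intro: rev_image_eqI)
    then show False using s(3) by simp
  qed
  have HT': "H < T'" using HH T' by simp
  have X3: "T' * (X * 2 powr (- X)) \<le> 1/20"
    using X(1) T'2 by (intro order_trans[OF mult_right_mono X(3)]) auto
  have nzl: "zeta (Complex x t) \<noteq> 0" if "1/2 < x" "0 < \<bar>t\<bar>" "\<bar>t\<bar> \<le> H" for x t
    using nz_low[of x t] that HH by simp
  note LW = littlewood[OF sr(1,2) HH(1) HT' X(1,2) X3 nzl nz_top nz_left]
  define L where "L = 1.13 * (3/2 - s) * (ln (T' + 2) + ln H) + 140 * (3/2 - s)"
  have int: "integral {H..T'} (zlog s) \<le> (T - H) / 2 * ln A + 1"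
  proof -
    have "Ms \<sigma>0 \<le> (T' - H) * A" unfolding Ms_def A_def
      by (rule zeta_mean_square(1)[OF s0(1,2) HH(1,2)]) (use HH T' in auto)
    moreover have "Ms s \<le> Ms \<sigma>0 + 1" using \<delta>(2)[of s] sr s by (simp add: abs_less_iff)
    ultimately have "Ms s \<le> (T' - H) * A + 1" by simp
    then have "integral {H..T'} (zlog s) \<le> (T' - H) / 2 * ln A + 1/2"
      unfolding Ms_def using A HT' sr HH LW(3) nz_left by (intro zlog_integral_le) auto
    also have "(T' - H) / 2 * ln A \<le> (T + \<tau> - H) / 2 * ln A"
      using T' A by (intro mult_right_mono) auto
    also have "\<dots> = (T - H) / 2 * ln A + (\<tau> * ln A) / 2" by (simp add: field_simps)
    finally show ?thesis using \<tau>(3) by simp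
  qed
  \<comment> \<open>As \<open>s < \<sigma>0\<close>, every counted zero has weight
    \<open>Re z - s \<ge> \<sigma> - \<sigma>0\<close>; the other zeros in the rectangle only
    add.\<close>
  have count: "(\<sigma> - \<sigma>0) * real (N_zeros \<sigma> T) \<le>
     (\<Sum>z | z \<in> box (Complex s H) (Complex X T') \<and> zeta z = 0. (Re z - s) * real (zero_mult zeta z))"
  proof -
    have "(\<sigma> - \<sigma>0) * real (N_zeros \<sigma> T) = (\<Sum>z\<in>Zs. (\<sigma> - \<sigma>0) * real (zero_mult zeta z))"
      by (simp add: N_zeros_def Zs_def[symmetric] sum_distrib_left)
    also have "\<dots> \<le> (\<Sum>z\<in>Zs. (Re z - s) * real (zero_mult zeta z))"
      using s by (intro sum_mono mult_right_mono) (auto simp: Zs_def)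
    also have "\<dots> \<le> (\<Sum>z | z \<in> box (Complex s H) (Complex X T') \<and> zeta z = 0. (Re z - s) * real (zero_mult zeta z))"
    proof (rule sum_mono2[OF LW(2)])
      show "Zs \<subseteq> {z. z \<in> box (Complex s H) (Complex X T') \<and> zeta z = 0}"
      proof
        fix z assume z: "z \<in> Zs"
        then have "\<sigma> \<le> Re z" "Re z \<le> 1" "Im z \<le> T" "zeta z = 0" by (auto simp: Zs_def)
        moreover have "H < Im z" using Zs_Im[OF z] HH by linarith
        ultimately show "z \<in> {z. z \<in> box (Complex s H) (Complex X T') \<and> zeta z = 0}"
          using s(2) s0 T'(1) X(1) by (simp add: in_box_complex_iff)
      qed
    qed (auto simp: in_box_complex_iff)
    finally show ?thesis .
  qed
  \<comment> \<open>The \<open>2\<close> is \<open>1\<close> from moving the left and top sides and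
    \<open>1\<close> from the right side.\<close>
  have main: "2 * pi * ((\<sigma> - \<sigma>0) * real (N_zeros \<sigma> T)) \<le> (T - H) / 2 * ln A + L + 2"
  proof -
    have "2 * pi * ((\<sigma> - \<sigma>0) * real (N_zeros \<sigma> T)) \<le>
       2 * pi * (\<Sum>z | z \<in> box (Complex s H) (Complex X T') \<and> zeta z = 0. (Re z - s) * real (zero_mult zeta z))"
      by (intro mult_left_mono count) auto
    then show ?thesis using LW(1)[folded L_def] int by linarith
  qed
  have edges: "L + 2 \<le> E3 \<sigma>0 * ln (T * H) + (E2 + E4 \<sigma>0 H)"
  proof -
    have lnTH: "ln (T * H) = ln T + ln H" using HH by (simp add: ln_mult)
    have "T + 3 = T * (1 + 3 / T)" using HH by (simp add: distrib_left)
    then have "ln (T + 3) = ln (T * (1 + 3 / T))" by (rule arg_cong)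
    also have "\<dots> = ln T + ln (1 + 3 / T)" by (rule ln_mult_pos) (use HH in \<open>auto intro!: add_pos_pos\<close>)
    finally have "ln (T + 3) = ln T + ln (1 + 3 / T)" .
    moreover have "ln (1 + 3 / T) \<le> 3 / T" using HH by (intro ln_add_one_self_le_self) auto
    moreover have "3 / T \<le> 1" using HH by simp
    moreover have "ln (T' + 2) \<le> ln (T + 3)" using T'2 T' HH by (subst ln_le_cancel_iff) auto
    ultimately have lT: "ln (T' + 2) + ln H \<le> ln (T * H) + 1" unfolding lnTH by linarith
    have "L + 2 \<le> E3 \<sigma>0 * ln (T * H) + E4 \<sigma>0 H"
      unfolding L_def
    proof (rule edge_budget[OF _ _ _ _ lT])
      show "0 \<le> 3/2 - s" "3/2 - s \<le> sigma1 - \<sigma>0" "1/2 \<le> sigma1 - \<sigma>0"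
        using sr s s0 by (auto simp: sigma1_def eta_def)
      show "0 \<le> ln (T * H)" unfolding lnTH using HH by (intro add_nonneg_nonneg) auto
      show "1.13 * (sigma1 - \<sigma>0) \<le> E3 \<sigma>0" by (rule E3_ge) (use s0 in simp)
      show "153 * (sigma1 - \<sigma>0) \<le> E4 \<sigma>0 H" by (rule E4_ge) (use s0 HH in auto)
    qed
    moreover have "0 \<le> E2" by (simp add: E2_def)
    ultimately show ?thesis by linarith
  qed
  define D where "D = 2 * pi * (\<sigma> - \<sigma>0)"
  have D: "D > 0" "2 * D = 4 * pi * (\<sigma> - \<sigma>0)" using s0 by (simp_all add: D_def)
  have "real (N_zeros \<sigma> T) * D = 2 * pi * ((\<sigma> - \<sigma>0) * real (N_zeros \<sigma> T))"
    by (simp add: D_def)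
  then have "real (N_zeros \<sigma> T) * D \<le> (T - H) / 2 * ln A + (E3 \<sigma>0 * ln (T * H) + (E2 + E4 \<sigma>0 H))"
    using main edges by linarith
  then have "real (N_zeros \<sigma> T) \<le> ((T - H) / 2 * ln A + (E3 \<sigma>0 * ln (T * H) + (E2 + E4 \<sigma>0 H))) / D"
    using D(1) by (simp add: pos_le_divide_eq)
  also have "\<dots> = ln A / (2 * D) * (T - H) + E3 \<sigma>0 / D * ln (T * H) + (E2 + E4 \<sigma>0 H) / D"
    by (simp add: add_divide_distrib)
  finally show ?thesis unfolding D(2) unfolding A_def D_def .
qed

end
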